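(* Let $k$ be a field of characteristic zero and let $A$ be an associative unital $k$-algebra. The bialgebra $\overline T(T(A))=T(T(A))\oplus k\mathbf 1$ (with bar-concatenation product and the coproduct $\Delta$ defined in the context), equipped with the half-coproducts $\Delta_\succ$ and $\Delta_\prec$ defined in the context, is an unshuffle bialgebra.
   Context: **The bialgebra.** $T(A):=\bigoplus_{n>0}A^{\otimes n}$, with elements written as words $a_1\cdots a_n$. $T(T(A)):=\bigoplus_{n>0}T(A)^{\otimes n}$ and $\overline T(T(A)):=\bigoplus_{n\ge0}T(A)^{\otimes n}$, with elements written with bars $w_1|\cdots|w_n$ ($w_i\in T(A)$); the product is bar-concatenation, with unit $\mathbf 1\in T(A)^{\otimes0}=k$. For a word $a_1\cdots a_n$ and $S=\{s_1<\cdots<s_p\}\subseteq[n]=\{1,\dots,n\}$, put $a_S:=a_{s_1}\cdots a_{s_p}$, $a_\emptyset:=\mathbf 1$. Let $J_1,\dots,J_r$ be the connected components of $[n]-S$ in $[n]$, i.e. its maximal runs of consecutive integers, in increasing order; put $a_{J^S_{[n]}}:=a_{J_1}|\cdots|a_{J_r}$ (equal to $\mathbf 1$ if $S=[n]$). The coproduct is $\Delta(a_1\cdots a_n):=\sum_{S\subseteq[n]}a_S\otimes a_{J^S_{[n]}}$, extended by $\Delta(w_1|\cdots|w_m):=\Delta(w_1)\cdots\Delta(w_m)$ and $\Delta(\mathbf 1)=\mathbf 1\otimes\mathbf 1$; the counit is the augmentation. **The half-coproducts.** On $T(A)$: $$\Delta^+_\prec(a_1\cdots a_n):=\sum_{1\in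 S\subseteq[n]}a_S\otimes a_{J^S_{[n]}},\qquad \Delta^+_\succ(a_1\cdots a_n):=\sum_{1\notin S\subseteq[n]}a_S\otimes a_{J^S_{[n]}}.$$ These are extended to $T(T(A))$ by $\Delta^+_\prec(w_1|\cdots|w_m):=\Delta^+_\prec(w_1)\Delta(w_2)\cdots\Delta(w_m)$ and $\Delta^+_\succ(w_1|\cdots|w_m):=\Delta^+_\succ(w_1)\Delta(w_2)\cdots\Delta(w_m)$. For $a\in T(T(A))$ put $\Delta_\prec(a):=\Delta^+_\prec(a)-a\otimes\mathbf 1$ and $\Delta_\succ(a):=\Delta^+_\succ(a)-\mathbf 1\otimes a$. **Unshuffle coalgebra.** A counital unshuffle coalgebra is a coaugmented coalgebra $\overline C=C\oplus k\mathbf 1$ with coproduct $\Delta(c)=\bar\Delta(c)+c\otimes\mathbf 1+\mathbf 1\otimes c$ for $c\in C$, such that on $C$ one has $\bar\Delta=\Delta_\prec+\Delta_\succ$ (with $\Delta_\prec,\Delta_\succ:C\to C\otimes C$ linear) and $$(\Delta_\prec\otimes I)\circ\Delta_\prec=(I\otimes\bar\Delta)\circ\Delta_\prec,\quad (\Delta_\succ\otimes I)\circ\Delta_\prec=(I\otimes\Delta_\prec)\circ\Delta_\succ,\quad (\bar\Delta\otimes I)\circ\Delta_\succ=(I\otimes\Delta_\succ)\circ\Delta_\succ,$$ where $I$ denotes the identity map. **Unshuffle bialgebra.** An unshuffle bialgebra is a unital and counital bialgebra $\overline B=B\oplus k\mathbf 1$ with product $\cdot$ and coproduct $\Delta$,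 which is at the same time a counital unshuffle coalgebra with $\bar\Delta=\Delta_\prec+\Delta_\succ$, such that for $a,b\in B$ $$\Delta^+_\prec(a\cdot b)=\Delta^+_\prec(a)\cdot\Delta(b),\qquad \Delta^+_\succ(a\cdot b)=\Delta^+_\succ(a)\cdot\Delta(b),$$ where $\Delta^+_\prec(a):=\Delta_\prec(a)+a\otimes\mathbf 1$ and $\Delta^+_\succ(a):=\Delta_\succ(a)+\mathbf 1\otimes a$. *)

theory Defs
  imports "HOL-Algebra.Module" "HOL-Algebra.QuotRing"
begin

section \<open>Linear algebra over a ring record\<close>

definition linear_maps ::
  "('k, 'r) ring_scheme \<Rightarrow> ('k, 'v, 'm) module_scheme \<Rightarrow> ('k, 'w, 'n) module_scheme \<Rightarrow> ('v \<Rightarrow> 'w) set"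
  where "linear_maps R M N =
    {f \<in> carrier M \<rightarrow> carrier N.
       (\<forall>x\<in>carrier M. \<forall>y\<in>carrier M. f (x \<oplus>\<^bsub>M\<^esub> y) = f x \<oplus>\<^bsub>N\<^esub> f y) \<and>
       (\<forall>a\<in>carrier R. \<forall>x\<in>carrier M. f (a \<odot>\<^bsub>M\<^esub> x) = a \<odot>\<^bsub>N\<^esub> f x)}"

definition mod_span :: "('k, 'r) ring_scheme \<Rightarrow> ('k, 'v, 'm) module_scheme \<Rightarrow> 'v set \<Rightarrow> 'v set"
  where "mod_span R M G = \<Inter>{H. submodule H R M \<and> G \<subseteq> H}"

text \<open>
  The unique linear map from \<open>M\<close> to \<open>N\<close> that sends the spanning vector \<open>g x\<close> to \<open>\<phi> x\<close>
  for all \<open>x \<in> I\<close> (with value \<open>undefined\<close> outside the carrier of \<open>M\<close>).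
\<close>
definition linear_extension ::
  "('k, 'r) ring_scheme \<Rightarrow> ('k, 'v, 'm) module_scheme \<Rightarrow> ('k, 'w, 'n) module_scheme \<Rightarrow>
   'x set \<Rightarrow> ('x \<Rightarrow> 'v) \<Rightarrow> ('x \<Rightarrow> 'w) \<Rightarrow> 'v \<Rightarrow> 'w"
  where "linear_extension R M N I g \<phi> =
    (THE f. f \<in> linear_maps R M N \<and> f \<in> extensional (carrier M) \<and> (\<forall>x\<in>I. f (g x) = \<phi> x))"

definition regular_module :: "('k, 'r) ring_scheme \<Rightarrow> ('k, 'k) module"
  where "regular_module R =
    \<lparr>carrier = carrier R, mult = mult R, one = \<one>\<^bsub>R\<^esub>, zero = \<zero>\<^bsub>R\<^esub>, add = add R, smult = mult R\<rparr>"

text \<open>The library locale \<open>algebra\<close> is restricted to commutative algebras; this one is not.\<close>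
locale assoc_algebra = module R M + ring M for R (structure) and M (structure) +
  assumes smult_mult_left:
      "\<lbrakk>a \<in> carrier R; x \<in> carrier M; y \<in> carrier M\<rbrakk> \<Longrightarrow>
       (a \<odot>\<^bsub>M\<^esub> x) \<otimes>\<^bsub>M\<^esub> y = a \<odot>\<^bsub>M\<^esub> (x \<otimes>\<^bsub>M\<^esub> y)"
    and smult_mult_right:
      "\<lbrakk>a \<in> carrier R; x \<in> carrier M; y \<in> carrier M\<rbrakk> \<Longrightarrow>
       x \<otimes>\<^bsub>M\<^esub> (a \<odot>\<^bsub>M\<^esub> y) = a \<odot>\<^bsub>M\<^esub> (x \<otimes>\<^bsub>M\<^esub> y)"

text \<open>The monoid algebra: finitely supported functions on a monoid, with the convolution product.\<close>
definition monoid_algebra ::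
  "('k, 'r) ring_scheme \<Rightarrow> ('x, 'g) monoid_scheme \<Rightarrow> ('k, 'x \<Rightarrow> 'k) module"
  where "monoid_algebra R G =
    \<lparr>carrier = {f. f \<in> UNIV \<rightarrow> carrier R \<and> finite {x. f x \<noteq> \<zero>\<^bsub>R\<^esub>} \<and> {x. f x \<noteq> \<zero>\<^bsub>R\<^esub>} \<subseteq> carrier G},
     mult = (\<lambda>f g z. \<Oplus>\<^bsub>R\<^esub>p \<in> {(x, y). f x \<noteq> \<zero>\<^bsub>R\<^esub> \<and> g y \<noteq> \<zero>\<^bsub>R\<^esub> \<and> x \<otimes>\<^bsub>G\<^esub> y = z}.
               f (fst p) \<otimes>\<^bsub>R\<^esub> g (snd p)),
     one = (\<lambda>z. if z = \<one>\<^bsub>G\<^esub> then \<one>\<^bsub>R\<^esub> else \<zero>\<^bsub>R\<^esub>),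
     zero = (\<lambda>z. \<zero>\<^bsub>R\<^esub>),
     add = (\<lambda>f g z. f z \<oplus>\<^bsub>R\<^esub> g z),
     smult = (\<lambda>a f z. a \<otimes>\<^bsub>R\<^esub> f z)\<rparr>"

definition delta :: "('k, 'r) ring_scheme \<Rightarrow> 'x \<Rightarrow> 'x \<Rightarrow> 'k"
  where "delta R x = (\<lambda>z. if z = x then \<one>\<^bsub>R\<^esub> else \<zero>\<^bsub>R\<^esub>)"

text \<open>Extends the library's quotient ring (cosets of \<open>I\<close>) by scalar multiplication.\<close>
definition quotient_algebra :: "('k, 'v, 'm) module_scheme \<Rightarrow> 'v set \<Rightarrow> ('k, 'v set) module"
  where "quotient_algebra M I =
    ring.extend (M Quot I) (module.fields (\<lambda>a Y. \<Union>x\<in>Y. I +>\<^bsub>M\<^esub> (a \<odot>\<^bsub>M\<^esub> x)))"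


section \<open>Tensor products\<close>

definition bilinear_rels ::
  "('k, 'r) ring_scheme \<Rightarrow> ('k, 'v, 'm) module_scheme \<Rightarrow> ('k, 'w, 'n) module_scheme \<Rightarrow> ('v \<times> 'w \<Rightarrow> 'k) set"
  where "bilinear_rels R M N = (let F = monoid_algebra R (M \<times>\<times> N) in
      {delta R (x \<oplus>\<^bsub>M\<^esub> x', y) \<ominus>\<^bsub>F\<^esub> (delta R (x, y) \<oplus>\<^bsub>F\<^esub> delta R (x', y)) | x x' y.
         x \<in> carrier M \<and> x' \<in> carrier M \<and> y \<in> carrier N} \<union>
      {delta R (x, y \<oplus>\<^bsub>N\<^esub> y') \<ominus>\<^bsub>F\<^esub> (delta R (x, y) \<oplus>\<^bsub>F\<^esub> delta R (x, y')) | x y y'.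
         x \<in> carrier M \<and> y \<in> carrier N \<and> y' \<in> carrier N} \<union>
      {delta R (a \<odot>\<^bsub>M\<^esub> x, y) \<ominus>\<^bsub>F\<^esub> a \<odot>\<^bsub>F\<^esub> delta R (x, y) | a x y.
         a \<in> carrier R \<and> x \<in> carrier M \<and> y \<in> carrier N} \<union>
      {delta R (x, a \<odot>\<^bsub>N\<^esub> y) \<ominus>\<^bsub>F\<^esub> a \<odot>\<^bsub>F\<^esub> delta R (x, y) | a x y.
         a \<in> carrier R \<and> x \<in> carrier M \<and> y \<in> carrier N})"

text \<open>
  The free module on pairs modulo bilinearity. If \<open>M\<close> and \<open>N\<close> are algebras, its product
  is the usual one, determined by \<open>(x \<otimes> y)(x' \<otimes> y') = xx' \<otimes> yy'\<close>; if they are mere modules,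
  the fields \<open>mult\<close> and \<open>one\<close> carry no meaning.
\<close>
definition tensor ::
  "('k, 'r) ring_scheme \<Rightarrow> ('k, 'v, 'm) module_scheme \<Rightarrow> ('k, 'w, 'n) module_scheme \<Rightarrow>
   ('k, ('v \<times> 'w \<Rightarrow> 'k) set) module"
  where "tensor R M N = (let F = monoid_algebra R (M \<times>\<times> N) in
    quotient_algebra F (mod_span R F (bilinear_rels R M N)))"

definition tens ::
  "('k, 'r) ring_scheme \<Rightarrow> ('k, 'v, 'm) module_scheme \<Rightarrow> ('k, 'w, 'n) module_scheme \<Rightarrow>
   'v \<Rightarrow> 'w \<Rightarrow> ('v \<times> 'w \<Rightarrow> 'k) set"
  where "tens R M N x y = (let F = monoid_algebra R (M \<times>\<times> N) in
    mod_span R F (bilinear_rels R M N) +>\<^bsub>F\<^esub> delta R (x, y))"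

text \<open>For subspaces \<open>U \<subseteq> M\<close> and \<open>V \<subseteq> N\<close>, the space \<open>U \<otimes> V\<close> is identified with its image in \<open>M \<otimes> N\<close>.\<close>
definition tensor_sub ::
  "('k, 'r) ring_scheme \<Rightarrow> ('k, 'v, 'm) module_scheme \<Rightarrow> ('k, 'w, 'n) module_scheme \<Rightarrow>
   'v set \<Rightarrow> 'w set \<Rightarrow> ('k, ('v \<times> 'w \<Rightarrow> 'k) set) module"
  where "tensor_sub R M N U V =
    (tensor R M N)\<lparr>carrier := mod_span R (tensor R M N) {tens R M N u v | u v. u \<in> U \<and> v \<in> V}\<rparr>"

text \<open>The map \<open>f \<otimes> g : U \<otimes> V \<rightarrow> M' \<otimes> N'\<close> for \<open>f : U \<rightarrow> M'\<close>, \<open>g : V \<rightarrow> N'\<close>, \<open>U \<subseteq> M\<close>, \<open>V \<subseteq> N\<close>.\<close>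
definition tensor_map ::
  "('k, 'r) ring_scheme \<Rightarrow> ('k, 'v, 'm) module_scheme \<Rightarrow> ('k, 'w, 'n) module_scheme \<Rightarrow>
   'v set \<Rightarrow> 'w set \<Rightarrow> ('k, 'v2, 'm2) module_scheme \<Rightarrow> ('k, 'w2, 'n2) module_scheme \<Rightarrow>
   ('v \<Rightarrow> 'v2) \<Rightarrow> ('w \<Rightarrow> 'w2) \<Rightarrow> ('v \<times> 'w \<Rightarrow> 'k) set \<Rightarrow> ('v2 \<times> 'w2 \<Rightarrow> 'k) set"
  where "tensor_map R M N U V M' N' f g =
    linear_extension R (tensor_sub R M N U V) (tensor R M' N') (U \<times> V)
      (\<lambda>(u, v). tens R M N u v) (\<lambda>(u, v). tens R M' N' (f u) (g v))"

text \<open>The canonical identification \<open>(M \<otimes> M) \<otimes> M \<rightarrow> M \<otimes> (M \<otimes> M)\<close>.\<close>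
definition tensor_assoc ::
  "('k, 'r) ring_scheme \<Rightarrow> ('k, 'v, 'm) module_scheme \<Rightarrow>
   (('v \<times> 'v \<Rightarrow> 'k) set \<times> 'v \<Rightarrow> 'k) set \<Rightarrow> ('v \<times> ('v \<times> 'v \<Rightarrow> 'k) set \<Rightarrow> 'k) set"
  where "tensor_assoc R M =
    linear_extension R (tensor R (tensor R M M) M) (tensor R M (tensor R M M))
      (carrier M \<times> carrier M \<times> carrier M)
      (\<lambda>(x, y, z). tens R (tensor R M M) M (tens R M M x y) z)
      (\<lambda>(x, y, z). tens R M (tensor R M M) x (tens R M M y z))"


section \<open>Tensor algebras\<close>

definition word_monoid :: "'v set \<Rightarrow> 'v list monoid"
  where "word_monoid S = \<lparr>carrier = lists S, mult = (@), one = []\<rparr>"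

definition multilinear_rels :: "('k, 'r) ring_scheme \<Rightarrow> ('k, 'v, 'm) module_scheme \<Rightarrow> ('v list \<Rightarrow> 'k) set"
  where "multilinear_rels R V = (let F = monoid_algebra R (word_monoid (carrier V)) in
      {delta R (xs @ [v \<oplus>\<^bsub>V\<^esub> w] @ ys) \<ominus>\<^bsub>F\<^esub> (delta R (xs @ [v] @ ys) \<oplus>\<^bsub>F\<^esub> delta R (xs @ [w] @ ys))
        | xs v w ys. xs \<in> lists (carrier V) \<and> v \<in> carrier V \<and> w \<in> carrier V \<and> ys \<in> lists (carrier V)} \<union>
      {delta R (xs @ [a \<odot>\<^bsub>V\<^esub> v] @ ys) \<ominus>\<^bsub>F\<^esub> a \<odot>\<^bsub>F\<^esub> delta R (xs @ [v] @ ys)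
        | xs a v ys. xs \<in> lists (carrier V) \<and> a \<in> carrier R \<and> v \<in> carrier V \<and> ys \<in> lists (carrier V)})"

text \<open>
  The direct sum of all \<open>V\<^sup>\<otimes>\<^sup>n\<close>, \<open>n \<ge> 0\<close>: the free module on words modulo multilinearity in the
  letters. The relations are homogeneous in the word length, so the quotient of the span of the
  words of length \<open>n\<close> is \<open>V\<^sup>\<otimes>\<^sup>n\<close>. The product is concatenation.
\<close>
definition tensor_algebra ::
  "('k, 'r) ring_scheme \<Rightarrow> ('k, 'v, 'm) module_scheme \<Rightarrow> ('k, ('v list \<Rightarrow> 'k) set) module"
  where "tensor_algebra R V = (let F = monoid_algebra R (word_monoid (carrier V)) in
    quotient_algebra F (mod_span R F (multilinear_rels R V)))"

definition word ::
  "('k, 'r) ring_scheme \<Rightarrow> ('k, 'v, 'm) module_scheme \<Rightarrow> 'v list \<Rightarrow> ('v list \<Rightarrow> 'k) set"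
  where "word R V vs = (let F = monoid_algebra R (word_monoid (carrier V)) in
    mod_span R F (multilinear_rels R V) +>\<^bsub>F\<^esub> delta R vs)"

text \<open>The direct sum of all \<open>V\<^sup>\<otimes>\<^sup>n\<close>, \<open>n > 0\<close>.\<close>
definition tensor_algebra_pos ::
  "('k, 'r) ring_scheme \<Rightarrow> ('k, 'v, 'm) module_scheme \<Rightarrow> ('k, ('v list \<Rightarrow> 'k) set) module"
  where "tensor_algebra_pos R V = (tensor_algebra R V)
    \<lparr>carrier := mod_span R (tensor_algebra R V) {word R V vs | vs. vs \<in> lists (carrier V) \<and> vs \<noteq> []}\<rparr>"

definition augmentation ::
  "('k, 'r) ring_scheme \<Rightarrow> ('k, 'v, 'm) module_scheme \<Rightarrow> ('v list \<Rightarrow> 'k) set \<Rightarrow> 'k"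
  where "augmentation R V =
    linear_extension R (tensor_algebra R V) (regular_module R) (lists (carrier V)) (word R V)
      (\<lambda>vs. if vs = [] then \<one>\<^bsub>R\<^esub> else \<zero>\<^bsub>R\<^esub>)"


section \<open>Unshuffle bialgebras\<close>

definition is_coalgebra ::
  "('k, 'r) ring_scheme \<Rightarrow> ('k, 'b, 'm) module_scheme \<Rightarrow> ('b \<Rightarrow> ('b \<times> 'b \<Rightarrow> 'k) set) \<Rightarrow> ('b \<Rightarrow> 'k) \<Rightarrow> bool"
  where "is_coalgebra R C \<Delta> \<epsilon> \<longleftrightarrow>
    module R C \<and>
    \<Delta> \<in> linear_maps R C (tensor R C C) \<and>
    \<epsilon> \<in> linear_maps R C (regular_module R) \<and>
    (\<forall>c\<in>carrier C.
       tensor_assoc R C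
         (tensor_map R C C (carrier C) (carrier C) (tensor R C C) C \<Delta> (\<lambda>x. x) (\<Delta> c)) =
       tensor_map R C C (carrier C) (carrier C) C (tensor R C C) (\<lambda>x. x) \<Delta> (\<Delta> c)) \<and>
    (\<forall>c\<in>carrier C.
       linear_extension R (tensor R C C) C (carrier C \<times> carrier C)
         (\<lambda>(x, y). tens R C C x y) (\<lambda>(x, y). \<epsilon> x \<odot>\<^bsub>C\<^esub> y) (\<Delta> c) = c) \<and>
    (\<forall>c\<in>carrier C.
       linear_extension R (tensor R C C) C (carrier C \<times> carrier C)
         (\<lambda>(x, y). tens R C C x y) (\<lambda>(x, y). \<epsilon> y \<odot>\<^bsub>C\<^esub> x) (\<Delta> c) = c)"

text \<open>
  A coaugmented coalgebra \<open>D = C \<oplus> k e\<close>: the coaugmentation \<open>k \<rightarrow> D\<close> is \<open>a \<mapsto> a e\<close>, a coalgebra map,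
  and \<open>C\<close> is the kernel of the counit.
\<close>
definition is_coaugmented_coalgebra ::
  "('k, 'r) ring_scheme \<Rightarrow> ('k, 'b, 'm) module_scheme \<Rightarrow> ('b \<Rightarrow> ('b \<times> 'b \<Rightarrow> 'k) set) \<Rightarrow> ('b \<Rightarrow> 'k) \<Rightarrow>
   'b \<Rightarrow> 'b set \<Rightarrow> bool"
  where "is_coaugmented_coalgebra R D \<Delta> \<epsilon> e C \<longleftrightarrow>
    is_coalgebra R D \<Delta> \<epsilon> \<and>
    e \<in> carrier D \<and> \<Delta> e = tens R D D e e \<and> \<epsilon> e = \<one>\<^bsub>R\<^esub> \<and>
    submodule C R D \<and> (\<forall>c\<in>C. \<epsilon> c = \<zero>\<^bsub>R\<^esub>) \<and>
    (\<forall>x\<in>carrier D. \<exists>!(c, a). c \<in> C \<and> a \<in> carrier R \<and> x = c \<oplus>\<^bsub>D\<^esub> a \<odot>\<^bsub>D\<^esub> e)"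

text \<open>All triple tensor products are identified with \<open>D \<otimes> (D \<otimes> D)\<close>.\<close>
definition is_unshuffle_coalgebra ::
  "('k, 'r) ring_scheme \<Rightarrow> ('k, 'b, 'm) module_scheme \<Rightarrow> ('b \<Rightarrow> ('b \<times> 'b \<Rightarrow> 'k) set) \<Rightarrow> ('b \<Rightarrow> 'k) \<Rightarrow>
   'b \<Rightarrow> 'b set \<Rightarrow> ('b \<Rightarrow> ('b \<times> 'b \<Rightarrow> 'k) set) \<Rightarrow> ('b \<Rightarrow> ('b \<times> 'b \<Rightarrow> 'k) set) \<Rightarrow> bool"
  where "is_unshuffle_coalgebra R D \<Delta> \<epsilon> e C \<Delta>p \<Delta>s \<longleftrightarrow>
    (let DD = tensor R D D;
         \<Delta>bar = (\<lambda>c. \<Delta>p c \<oplus>\<^bsub>DD\<^esub> \<Delta>s c);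
         left = (\<lambda>f t. tensor_assoc R D (tensor_map R D D C C DD D f (\<lambda>x. x) t));
         right = (\<lambda>f t. tensor_map R D D C C D DD (\<lambda>x. x) f t)
     in is_coaugmented_coalgebra R D \<Delta> \<epsilon> e C \<and>
        \<Delta>p \<in> linear_maps R (D\<lparr>carrier := C\<rparr>) (tensor_sub R D D C C) \<and>
        \<Delta>s \<in> linear_maps R (D\<lparr>carrier := C\<rparr>) (tensor_sub R D D C C) \<and>
        (\<forall>c\<in>C. \<Delta> c = \<Delta>bar c \<oplus>\<^bsub>DD\<^esub> tens R D D c e \<oplus>\<^bsub>DD\<^esub> tens R D D e c) \<and>
        (\<forall>c\<in>C. left \<Delta>p (\<Delta>p c) = right \<Delta>bar (\<Delta>p c)) \<and>
        (\<forall>c\<in>C. left \<Delta>s (\<Delta>p c) = right \<Delta>p (\<Delta>s c)) \<and>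
        (\<forall>c\<in>C. left \<Delta>bar (\<Delta>s c) = right \<Delta>s (\<Delta>s c)))"

definition is_bialgebra ::
  "('k, 'r) ring_scheme \<Rightarrow> ('k, 'b, 'm) module_scheme \<Rightarrow> ('b \<Rightarrow> ('b \<times> 'b \<Rightarrow> 'k) set) \<Rightarrow> ('b \<Rightarrow> 'k) \<Rightarrow> bool"
  where "is_bialgebra R B \<Delta> \<epsilon> \<longleftrightarrow>
    assoc_algebra R B \<and> is_coalgebra R B \<Delta> \<epsilon> \<and>
    \<Delta> \<in> ring_hom B (tensor R B B) \<and> \<epsilon> \<in> ring_hom B R"

definition is_unshuffle_bialgebra ::
  "('k, 'r) ring_scheme \<Rightarrow> ('k, 'b, 'm) module_scheme \<Rightarrow> ('b \<Rightarrow> ('b \<times> 'b \<Rightarrow> 'k) set) \<Rightarrow> ('b \<Rightarrow> 'k) \<Rightarrow>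
   'b set \<Rightarrow> ('b \<Rightarrow> ('b \<times> 'b \<Rightarrow> 'k) set) \<Rightarrow> ('b \<Rightarrow> ('b \<times> 'b \<Rightarrow> 'k) set) \<Rightarrow> bool"
  where "is_unshuffle_bialgebra R D \<Delta> \<epsilon> B \<Delta>p \<Delta>s \<longleftrightarrow>
    (let DD = tensor R D D;
         \<Delta>p_plus = (\<lambda>a. \<Delta>p a \<oplus>\<^bsub>DD\<^esub> tens R D D a \<one>\<^bsub>D\<^esub>);
         \<Delta>s_plus = (\<lambda>a. \<Delta>s a \<oplus>\<^bsub>DD\<^esub> tens R D D \<one>\<^bsub>D\<^esub> a)
     in is_bialgebra R D \<Delta> \<epsilon> \<and>
        is_unshuffle_coalgebra R D \<Delta> \<epsilon> \<one>\<^bsub>D\<^esub> B \<Delta>p \<Delta>s \<and>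
        (\<forall>a\<in>B. \<forall>b\<in>B. \<Delta>p_plus (a \<otimes>\<^bsub>D\<^esub> b) = \<Delta>p_plus a \<otimes>\<^bsub>DD\<^esub> \<Delta> b) \<and>
        (\<forall>a\<in>B. \<forall>b\<in>B. \<Delta>s_plus (a \<otimes>\<^bsub>D\<^esub> b) = \<Delta>s_plus a \<otimes>\<^bsub>DD\<^esub> \<Delta> b))"


section \<open>The double tensor algebra\<close>

definition T :: "('k, 'r) ring_scheme \<Rightarrow> ('k, 'a, 'm) module_scheme \<Rightarrow> ('k, ('a list \<Rightarrow> 'k) set) module"
  where "T R A = tensor_algebra_pos R A"

definition TT ::
  "('k, 'r) ring_scheme \<Rightarrow> ('k, 'a, 'm) module_scheme \<Rightarrow> ('k, (('a list \<Rightarrow> 'k) set list \<Rightarrow> 'k) set) module"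
  where "TT R A = tensor_algebra_pos R (T R A)"

definition TTbar ::
  "('k, 'r) ring_scheme \<Rightarrow> ('k, 'a, 'm) module_scheme \<Rightarrow> ('k, (('a list \<Rightarrow> 'k) set list \<Rightarrow> 'k) set) module"
  where "TTbar R A = tensor_algebra R (T R A)"

text \<open>The element \<open>w\<^sub>1 | \<dots> | w\<^sub>m\<close>, where each \<open>w\<^sub>i\<close> is given by its nonempty list of letters.\<close>
definition bar_word ::
  "('k, 'r) ring_scheme \<Rightarrow> ('k, 'a, 'm) module_scheme \<Rightarrow> 'a list list \<Rightarrow> (('a list \<Rightarrow> 'k) set list \<Rightarrow> 'k) set"
  where "bar_word R A ws = word R (T R A) (map (word R A) ws)"

text \<open>Positions in a word are counted from 1.\<close>
definition subword :: "'a list \<Rightarrow> nat set \<Rightarrow> 'a list"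
  where "subword as S = nths as {i. Suc i \<in> S}"

text \<open>
  The maximal runs of consecutive integers in \<open>K\<close>, in increasing order, for finite \<open>K\<close> not containing 0:
  each run is listed at its least element \<open>i\<close>.
\<close>
definition runs :: "nat set \<Rightarrow> nat set list"
  where "runs K = map (\<lambda>i. {j. i \<le> j \<and> {i..j} \<subseteq> K}) (sorted_list_of_set {i \<in> K. i - 1 \<notin> K})"

text \<open>
  The sum of \<open>a\<^sub>S \<otimes> a\<^bsub>J\<^sub>1\<^esub> | \<dots> | a\<^bsub>J\<^sub>r\<^esub>\<close> over the subsets \<open>S\<close> of \<open>{1..n}\<close> that satisfy \<open>P\<close>, where
  \<open>a\<^sub>S\<close> is the unit if \<open>S\<close> is empty and a single letter of \<open>TTbar R A\<close> otherwise.
\<close>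
definition coproduct_letters ::
  "('k, 'r) ring_scheme \<Rightarrow> ('k, 'a, 'm) module_scheme \<Rightarrow> (nat set \<Rightarrow> bool) \<Rightarrow> 'a list \<Rightarrow>
   ((('a list \<Rightarrow> 'k) set list \<Rightarrow> 'k) set \<times> (('a list \<Rightarrow> 'k) set list \<Rightarrow> 'k) set \<Rightarrow> 'k) set"
  where "coproduct_letters R A P as =
    (\<Oplus>\<^bsub>tensor R (TTbar R A) (TTbar R A)\<^esub> S \<in> {S. S \<subseteq> {1..length as} \<and> P S}.
       tens R (TTbar R A) (TTbar R A)
         (bar_word R A (if S = {} then [] else [subword as S]))
         (bar_word R A (map (subword as) (runs ({1..length as} - S)))))"

definition coproduct_T ::
  "('k, 'r) ring_scheme \<Rightarrow> ('k, 'a, 'm) module_scheme \<Rightarrow> (nat set \<Rightarrow> bool) \<Rightarrow> ('a list \<Rightarrow> 'k) set \<Rightarrow>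
   ((('a list \<Rightarrow> 'k) set list \<Rightarrow> 'k) set \<times> (('a list \<Rightarrow> 'k) set list \<Rightarrow> 'k) set \<Rightarrow> 'k) set"
  where "coproduct_T R A P =
    linear_extension R (T R A) (tensor R (TTbar R A) (TTbar R A))
      {as. as \<in> lists (carrier A) \<and> as \<noteq> []} (word R A) (coproduct_letters R A P)"

definition coproduct_list ::
  "('k, 'r) ring_scheme \<Rightarrow> ('k, 'a, 'm) module_scheme \<Rightarrow> ('a list \<Rightarrow> 'k) set list \<Rightarrow>
   ((('a list \<Rightarrow> 'k) set list \<Rightarrow> 'k) set \<times> (('a list \<Rightarrow> 'k) set list \<Rightarrow> 'k) set \<Rightarrow> 'k) set"
  where "coproduct_list R A ws =
    foldr (\<lambda>w t. coproduct_T R A (\<lambda>S. True) w \<otimes>\<^bsub>tensor R (TTbar R A) (TTbar R A)\<^esub> t) ws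
      \<one>\<^bsub>tensor R (TTbar R A) (TTbar R A)\<^esub>"

definition coproduct ::
  "('k, 'r) ring_scheme \<Rightarrow> ('k, 'a, 'm) module_scheme \<Rightarrow> (('a list \<Rightarrow> 'k) set list \<Rightarrow> 'k) set \<Rightarrow>
   ((('a list \<Rightarrow> 'k) set list \<Rightarrow> 'k) set \<times> (('a list \<Rightarrow> 'k) set list \<Rightarrow> 'k) set \<Rightarrow> 'k) set"
  where "coproduct R A =
    linear_extension R (TTbar R A) (tensor R (TTbar R A) (TTbar R A))
      (lists (carrier (T R A))) (word R (T R A)) (coproduct_list R A)"

definition half_coproduct_plus ::
  "('k, 'r) ring_scheme \<Rightarrow> ('k, 'a, 'm) module_scheme \<Rightarrow> (nat set \<Rightarrow> bool) \<Rightarrow>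
   (('a list \<Rightarrow> 'k) set list \<Rightarrow> 'k) set \<Rightarrow>
   ((('a list \<Rightarrow> 'k) set list \<Rightarrow> 'k) set \<times> (('a list \<Rightarrow> 'k) set list \<Rightarrow> 'k) set \<Rightarrow> 'k) set"
  where "half_coproduct_plus R A P =
    linear_extension R (TT R A) (tensor R (TTbar R A) (TTbar R A))
      {ws. ws \<in> lists (carrier (T R A)) \<and> ws \<noteq> []} (word R (T R A))
      (\<lambda>ws. coproduct_T R A P (hd ws) \<otimes>\<^bsub>tensor R (TTbar R A) (TTbar R A)\<^esub> coproduct_list R A (tl ws))"

definition coproduct_prec ::
  "('k, 'r) ring_scheme \<Rightarrow> ('k, 'a, 'm) module_scheme \<Rightarrow> (('a list \<Rightarrow> 'k) set list \<Rightarrow> 'k) set \<Rightarrow>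
   ((('a list \<Rightarrow> 'k) set list \<Rightarrow> 'k) set \<times> (('a list \<Rightarrow> 'k) set list \<Rightarrow> 'k) set \<Rightarrow> 'k) set"
  where "coproduct_prec R A a =
    half_coproduct_plus R A (\<lambda>S. 1 \<in> S) a
      \<ominus>\<^bsub>tensor R (TTbar R A) (TTbar R A)\<^esub> tens R (TTbar R A) (TTbar R A) a \<one>\<^bsub>TTbar R A\<^esub>"

definition coproduct_succ ::
  "('k, 'r) ring_scheme \<Rightarrow> ('k, 'a, 'm) module_scheme \<Rightarrow> (('a list \<Rightarrow> 'k) set list \<Rightarrow> 'k) set \<Rightarrow>
   ((('a list \<Rightarrow> 'k) set list \<Rightarrow> 'k) set \<times> (('a list \<Rightarrow> 'k) set list \<Rightarrow> 'k) set \<Rightarrow> 'k) set"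
  where "coproduct_succ R A a =
    half_coproduct_plus R A (\<lambda>S. 1 \<notin> S) a
      \<ominus>\<^bsub>tensor R (TTbar R A) (TTbar R A)\<^esub> tens R (TTbar R A) (TTbar R A) \<one>\<^bsub>TTbar R A\<^esub> a"

end

theory Submission
  imports Defs "HOL-Library.Multiset"
begin

text \<open>
  The coproduct of a word sums over all ways to select some of its letters. Its first tensor factor is
  the selected subword, its second one the bar product of the maximal runs of letters that are left
  out. Applying \<open>\<Delta>\<close> once more to the first or to the second factor gives each letter one of three
  roles: it is selected twice, selected once, or never selected. Both \<open>(\<Delta> \<otimes> I) \<circ> \<Delta>\<close> and
  \<open>(I \<otimes> \<Delta>) \<circ> \<Delta>\<close> sum the same term over all assignments of roles. For \<open>(\<Delta> \<otimes> I) \<circ> \<Delta>\<close> the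
  second selection is made inside the selected subword, for \<open>(I \<otimes> \<Delta>) \<circ> \<Delta>\<close> inside the runs, and in
  either case the middle factor consists of the letters selected once, cut at the letters that are
  selected twice. This is coassociativity. The half coproducts \<open>\<Delta>\<^sup>+\<close> prescribe whether the first
  letter is selected, so that the three unshuffle relations arise from the same identity by fixing the
  role of the first letter.

  To make this an induction on words, a selection is recorded together with all gaps between the
  selected letters, also the empty ones (\<open>splits\<close>). Prepending a letter then acts on a twofold
  selection by one map for each role, whether it is read as a selection in the subword or as a
  selection in the gaps (\<open>splits_coassoc\<close>, \<open>half_splits_coassoc\<close>). Empty words are harmless since
  they count as the unit of the bar product (\<open>bword\<close>); in return, the formulas for \<open>\<Delta>\<close> and
  \<open>\<Delta>\<^sup>+\<close> hold on lists of words that may contain empty ones, and can be iterated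
  (\<open>coproduct_bword\<close>, \<open>half_ext_bword\<close>).

  The unshuffle relations are about \<open>\<Delta>\<^sub>\<prec>\<close> and \<open>\<Delta>\<^sub>\<succ>\<close> and not about \<open>\<Delta>\<^sup>+\<close>. Let \<open>\<pi>\<close> be the projection
  of the bialgebra onto its augmentation ideal that kills the unit. Among the terms of \<open>\<Delta>\<^sup>+(a)\<close>, only
  the term \<open>a \<otimes> 1\<close> or \<open>1 \<otimes> a\<close> by which it exceeds the half coproduct has a unit as a factor; so it is
  the only one killed by \<open>\<pi> \<otimes> \<pi>\<close>, and the half coproducts are \<open>(\<pi> \<otimes> \<pi>) \<circ> \<Delta>\<^sup>+\<close> (\<open>half_ext_id_reduced\<close>, \<open>half_ext_Not_reduced\<close>). The sums over roles
  therefore also prove the unshuffle relations, with every bar word replaced by its projection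
  (\<open>reduced_unshuffle\<close>). Moreover \<open>\<pi>\<close> makes the half coproducts restrictions of linear maps on the
  whole bialgebra, so that maps on \<open>C \<otimes> C\<close> are computed in \<open>D \<otimes> D\<close>.

  The remaining work is linear algebra. Tensor products and tensor algebras are monoid algebras modulo
  relations (\<open>presented_algebra\<close>); their universal properties provide the linear maps, and every
  identity between linear maps is checked on a spanning set (\<open>linear_maps_eq_on_spanned\<close>).
\<close>


section \<open>Linear maps and spans\<close>

lemma linear_mapsI:
  assumes "\<And>x. x \<in> carrier M \<Longrightarrow> f x \<in> carrier N"
    and "\<And>x y. x \<in> carrier M \<Longrightarrow> y \<in> carrier M \<Longrightarrow> f (x \<oplus>\<^bsub>M\<^esub> y) = f x \<oplus>\<^bsub>N\<^esub> f y"
    and "\<And>a x. a \<in> carrier R \<Longrightarrow> x \<in> carrier M \<Longrightarrow> f (a \<odot>\<^bsub>M\<^esub> x) = a \<odot>\<^bsub>N\<^esub> f x"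
  shows "f \<in> linear_maps R M N"
  using assms by (auto simp: linear_maps_def)

lemma linear_maps_closed: "f \<in> linear_maps R M N \<Longrightarrow> x \<in> carrier M \<Longrightarrow> f x \<in> carrier N"
  and linear_maps_add: "f \<in> linear_maps R M N \<Longrightarrow> x \<in> carrier M \<Longrightarrow> y \<in> carrier M \<Longrightarrow>
    f (x \<oplus>\<^bsub>M\<^esub> y) = f x \<oplus>\<^bsub>N\<^esub> f y"
  and linear_maps_smult: "f \<in> linear_maps R M N \<Longrightarrow> a \<in> carrier R \<Longrightarrow> x \<in> carrier M \<Longrightarrow>
    f (a \<odot>\<^bsub>M\<^esub> x) = a \<odot>\<^bsub>N\<^esub> f x"
  by (auto simp: linear_maps_def)

lemma linear_maps_zero:
  assumes "module R M" "module R N" "f \<in> linear_maps R M N"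
  shows "f \<zero>\<^bsub>M\<^esub> = \<zero>\<^bsub>N\<^esub>"
proof -
  interpret M: module R M by fact
  interpret N: module R N by fact
  have "f (\<zero>\<^bsub>R\<^esub> \<odot>\<^bsub>M\<^esub> \<zero>\<^bsub>M\<^esub>) = \<zero>\<^bsub>R\<^esub> \<odot>\<^bsub>N\<^esub> f \<zero>\<^bsub>M\<^esub>"
    by (rule linear_maps_smult[OF assms(3)]) auto
  moreover have "f \<zero>\<^bsub>M\<^esub> \<in> carrier N" by (rule linear_maps_closed[OF assms(3)]) simp
  ultimately show ?thesis by simp
qed

lemma linear_maps_a_inv:
  assumes "module R M" "module R N" "f \<in> linear_maps R M N" "x \<in> carrier M"
  shows "f (\<ominus>\<^bsub>M\<^esub> x) = \<ominus>\<^bsub>N\<^esub> f x"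
proof -
  interpret M: module R M by fact
  interpret N: module R N by fact
  have "f ((\<ominus>\<^bsub>R\<^esub> \<one>\<^bsub>R\<^esub>) \<odot>\<^bsub>M\<^esub> x) = (\<ominus>\<^bsub>R\<^esub> \<one>\<^bsub>R\<^esub>) \<odot>\<^bsub>N\<^esub> f x"
    by (rule linear_maps_smult[OF assms(3)]) (use assms in auto)
  moreover have "f x \<in> carrier N" by (rule linear_maps_closed) fact+
  ultimately show ?thesis using assms(4) by (simp add: M.smult_l_minus N.smult_l_minus)
qed

lemma linear_maps_minus:
  assumes "module R M" "module R N" "f \<in> linear_maps R M N" "x \<in> carrier M" "y \<in> carrier M"
  shows "f (x \<ominus>\<^bsub>M\<^esub> y) = f x \<ominus>\<^bsub>N\<^esub> f y"
proof -
  interpret M: module R M by fact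
  interpret N: module R N by fact
  show ?thesis using assms
    by (simp add: a_minus_def linear_maps_add[OF assms(3)] linear_maps_a_inv)
qed

lemma linear_maps_id: "(\<lambda>x. x) \<in> linear_maps R M M"
  by (auto simp: linear_maps_def)

lemma linear_maps_compose:
  "f \<in> linear_maps R M N \<Longrightarrow> g \<in> linear_maps R N P \<Longrightarrow> (\<lambda>x. g (f x)) \<in> linear_maps R M P"
  by (auto simp: linear_maps_def Pi_def)

lemma linear_maps_zero_fun:
  assumes "module R N"
  shows "(\<lambda>x. \<zero>\<^bsub>N\<^esub>) \<in> linear_maps R M N"
proof -
  interpret N: module R N by fact
  show ?thesis by (auto intro!: linear_mapsI)
qed

lemma linear_maps_add_fun:
  assumes "module R N" "f \<in> linear_maps R M N" "g \<in> linear_maps R M N"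
  shows "(\<lambda>x. f x \<oplus>\<^bsub>N\<^esub> g x) \<in> linear_maps R M N"
proof -
  interpret N: module R N by fact
  note cl = linear_maps_closed[OF assms(2)] linear_maps_closed[OF assms(3)]
  show ?thesis
    by (rule linear_mapsI)
      (simp_all add: cl linear_maps_add[OF assms(2)] linear_maps_add[OF assms(3)]
        linear_maps_smult[OF assms(2)] linear_maps_smult[OF assms(3)] N.smult_r_distr N.add.m_ac)
qed

lemma linear_maps_smult_fun:
  assumes "module R N" "f \<in> linear_maps R M N" "a \<in> carrier R"
  shows "(\<lambda>x. a \<odot>\<^bsub>N\<^esub> f x) \<in> linear_maps R M N"
proof -
  interpret N: module R N by fact
  note cl = linear_maps_closed[OF assms(2)]
  show ?thesis
    by (rule linear_mapsI)
      (simp_all add: cl linear_maps_add[OF assms(2)] linear_maps_smult[OF assms(2)] assms(3)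
        N.smult_r_distr N.smult_assoc1[symmetric] N.R.m_comm)
qed

lemma linear_maps_submodule_domain:
  assumes "f \<in> linear_maps R M N" "U \<subseteq> carrier M"
  shows "f \<in> linear_maps R (M\<lparr>carrier := U\<rparr>) N"
  using assms by (auto simp: linear_maps_def Pi_def subset_iff)

lemma linear_maps_cong:
  assumes "module R M" "\<And>x. x \<in> carrier M \<Longrightarrow> f x = g x"
  shows "f \<in> linear_maps R M N \<longleftrightarrow> g \<in> linear_maps R M N"
proof -
  interpret M: module R M by fact
  show ?thesis by (simp add: linear_maps_def Pi_def assms)
qed

lemma linear_maps_minus_fun:
  assumes "module R M" "module R N" "f \<in> linear_maps R M N" "g \<in> linear_maps R M N"
  shows "(\<lambda>x. f x \<ominus>\<^bsub>N\<^esub> g x) \<in> linear_maps R M N"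
proof -
  interpret M: module R M by fact
  interpret N: module R N by fact
  note cl = linear_maps_closed[OF assms(3)] linear_maps_closed[OF assms(4)]
  have eq: "x \<ominus>\<^bsub>N\<^esub> y = x \<oplus>\<^bsub>N\<^esub> (\<ominus>\<^bsub>R\<^esub> \<one>\<^bsub>R\<^esub>) \<odot>\<^bsub>N\<^esub> y" if "y \<in> carrier N" for x y
    using that by (simp add: a_minus_def N.smult_l_minus)
  have "(\<lambda>x. f x \<oplus>\<^bsub>N\<^esub> (\<ominus>\<^bsub>R\<^esub> \<one>\<^bsub>R\<^esub>) \<odot>\<^bsub>N\<^esub> g x) \<in> linear_maps R M N"
    by (intro linear_maps_add_fun linear_maps_smult_fun assms) simp
  then show ?thesis
    by (rule iffD2[OF linear_maps_cong[OF assms(1)], rotated]) (simp add: eq cl)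
qed

text \<open>This is why a linear map is determined by its values on a spanning set.\<close>
lemma submodule_equalizer:
  assumes "module R M" "module R N" "f \<in> linear_maps R M N" "g \<in> linear_maps R M N"
  shows "submodule {x \<in> carrier M. f x = g x} R M"
proof -
  interpret M: module R M by fact
  interpret N: module R N by fact
  show ?thesis using assms
    by (intro M.submoduleI)
      (auto simp: linear_maps_zero linear_maps_a_inv linear_maps_add[OF assms(3)]
        linear_maps_add[OF assms(4)] linear_maps_smult[OF assms(3)] linear_maps_smult[OF assms(4)])
qed

lemma submodule_vimage:
  assumes "module R M" "module R N" "f \<in> linear_maps R M N" "submodule H R N"
  shows "submodule {x \<in> carrier M. f x \<in> H} R M"
proof -
  interpret M: module R M by fact
  interpret N: module R N by fact
  note H = N.submoduleE[OF assms(4)]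
  have "\<zero>\<^bsub>N\<^esub> \<in> H" using subgroup.one_closed[OF submodule.axioms(1)[OF assms(4)]] by simp
  then show ?thesis using assms H
    by (intro M.submoduleI)
      (auto simp: linear_maps_zero linear_maps_a_inv linear_maps_add[OF assms(3)]
        linear_maps_smult[OF assms(3)])
qed

lemma mod_span_superset: "G \<subseteq> mod_span R M G"
  by (auto simp: mod_span_def)

lemma mod_span_least: "submodule H R M \<Longrightarrow> G \<subseteq> H \<Longrightarrow> mod_span R M G \<subseteq> H"
  by (auto simp: mod_span_def)

lemma mod_span_submodule:
  assumes "module R M" "G \<subseteq> carrier M"
  shows "submodule (mod_span R M G) R M"
proof -
  interpret M: module R M by fact
  have "\<zero>\<^bsub>M\<^esub> \<in> H" if "submodule H R M" for H
    using subgroup.one_closed[OF submodule.axioms(1)[OF that]] by simp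
  moreover have "mod_span R M G \<subseteq> carrier M"
    by (rule mod_span_least[OF M.carrier_is_submodule assms(2)])
  ultimately show ?thesis
    by (intro M.submoduleI) (auto simp: mod_span_def M.submoduleE)
qed

text \<open>
  Spanning is stated with submodules instead of linear combinations: a property that cuts out a
  submodule passes from a spanning set to the whole module without writing out any sum.
\<close>
definition spanned :: "('k, 'r) ring_scheme \<Rightarrow> ('k, 'v, 'm) module_scheme \<Rightarrow> 'v set \<Rightarrow> bool"
  where "spanned R M G \<longleftrightarrow> G \<subseteq> carrier M \<and> (\<forall>H. submodule H R M \<longrightarrow> G \<subseteq> H \<longrightarrow> carrier M \<subseteq> H)"

lemma spannedD: "spanned R M G \<Longrightarrow> submodule H R M \<Longrightarrow> G \<subseteq> H \<Longrightarrow> x \<in> carrier M \<Longrightarrow> x \<in> H"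
  by (auto simp: spanned_def)

lemma spanned_carrier: "spanned R M G \<Longrightarrow> G \<subseteq> carrier M"
  by (auto simp: spanned_def)

lemma spanned_mono: "spanned R M G \<Longrightarrow> G \<subseteq> G' \<Longrightarrow> G' \<subseteq> carrier M \<Longrightarrow> spanned R M G'"
  unfolding spanned_def by (meson subset_trans)

lemma submodule_trans:
  assumes "module R M" "submodule U R M" "submodule H R (M\<lparr>carrier := U\<rparr>)"
  shows "submodule H R M"
proof -
  interpret M: module R M by fact
  interpret U: module R "M\<lparr>carrier := U\<rparr>"
    by (rule submodule.submodule_is_module[OF assms(2,1)])
  note UE = M.submoduleE[OF assms(2)] and HE = U.submoduleE[OF assms(3)]
  have z: "\<zero>\<^bsub>M\<^esub> \<in> H"
    using subgroup.one_closed[OF submodule.axioms(1)[OF assms(3)]] by simp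
  show ?thesis
  proof (rule M.submoduleI)
    fix a assume a: "a \<in> H"
    have "(\<ominus>\<^bsub>R\<^esub> \<one>\<^bsub>R\<^esub>) \<odot>\<^bsub>M\<^esub> a \<in> H" using HE(4)[of "\<ominus>\<^bsub>R\<^esub> \<one>\<^bsub>R\<^esub>" a] a by simp
    then show "\<ominus>\<^bsub>M\<^esub> a \<in> H" using a HE(1) UE(1) by (auto simp: M.smult_l_minus subset_iff)
  qed (use HE UE z in auto)
qed

lemma spanned_mod_span:
  assumes "module R M" "G \<subseteq> carrier M"
  shows "spanned R (M\<lparr>carrier := mod_span R M G\<rparr>) G"
  using mod_span_superset[of G R M] submodule_trans[OF assms(1) mod_span_submodule[OF assms]]
    mod_span_least[of _ R M G]
  unfolding spanned_def by auto

lemma module_mod_span: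
  assumes "module R M" "G \<subseteq> carrier M"
  shows "module R (M\<lparr>carrier := mod_span R M G\<rparr>)"
  by (rule submodule.submodule_is_module[OF mod_span_submodule[OF assms] assms(1)])

lemma linear_maps_eq_on_spanned:
  assumes "module R M" "module R N" "f \<in> linear_maps R M N" "g \<in> linear_maps R M N"
    and "spanned R M G" "\<And>x. x \<in> G \<Longrightarrow> f x = g x" "x \<in> carrier M"
  shows "f x = g x"
  using spannedD[OF assms(5) submodule_equalizer[OF assms(1-4)] _ assms(7)] assms(6)
    spanned_carrier[OF assms(5)] by blast

lemma spanned_trans:
  assumes "module R M" "spanned R M G" "G' \<subseteq> carrier M" "G \<subseteq> mod_span R M G'"
  shows "spanned R M G'"
  unfolding spanned_def
proof (intro conjI allI impI)
  fix H assume "submodule H R M" "G' \<subseteq> H"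
  then have "G \<subseteq> H" using mod_span_least assms(4) by blast
  then show "carrier M \<subseteq> H" using spannedD[OF assms(2) \<open>submodule H R M\<close>] by blast
qed (rule assms(3))

text \<open>
  Every linear extension occurring here is evaluated by exhibiting some linear map with the right
  values on a spanning family: uniqueness then makes the definite description denote that map.
\<close>
lemma linear_extension_eq:
  assumes M: "module R M" and N: "module R N" and sp: "spanned R M (g ` I)"
    and f: "f \<in> linear_maps R M N" and val: "\<And>x. x \<in> I \<Longrightarrow> f (g x) = \<phi> x" and y: "y \<in> carrier M"
  shows "linear_extension R M N I g \<phi> y = f y"
proof -
  let ?f = "restrict f (carrier M)"
  have "linear_extension R M N I g \<phi> = ?f"
    unfolding linear_extension_def
  proof (rule the_equality)
    have "?f \<in> linear_maps R M N" by (rule iffD2[OF linear_maps_cong[OF M] f]) simp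
    then show "?f \<in> linear_maps R M N \<and> ?f \<in> extensional (carrier M) \<and> (\<forall>x\<in>I. ?f (g x) = \<phi> x)"
      using spanned_carrier[OF sp] val by auto
  next
    fix h assume h: "h \<in> linear_maps R M N \<and> h \<in> extensional (carrier M) \<and> (\<forall>x\<in>I. h (g x) = \<phi> x)"
    show "h = ?f"
    proof (rule extensionalityI[of _ "carrier M"])
      fix x assume "x \<in> carrier M"
      then show "h x = ?f x"
        using linear_maps_eq_on_spanned[OF M N conjunct1[OF h] f sp _ \<open>x \<in> carrier M\<close>] h val
        by fastforce
    qed (use h in auto)
  qed
  then show ?thesis using y by simp
qed


section \<open>Sums over lists\<close>

text \<open>
  Sums over lists admit repeated terms, and the order of the list is irrelevant; this suits sums over
  selections, whose terms are compared as multisets.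
\<close>
definition lsum :: "('k, 'm) ring_scheme \<Rightarrow> ('x \<Rightarrow> 'k) \<Rightarrow> 'x list \<Rightarrow> 'k"
  where "lsum N f xs = foldr (\<lambda>x s. f x \<oplus>\<^bsub>N\<^esub> s) xs \<zero>\<^bsub>N\<^esub>"

lemma lsum_Nil [simp]: "lsum N f [] = \<zero>\<^bsub>N\<^esub>"
  and lsum_Cons [simp]: "lsum N f (x # xs) = f x \<oplus>\<^bsub>N\<^esub> lsum N f xs"
  by (simp_all add: lsum_def)

lemma lsum_cong: "xs = ys \<Longrightarrow> (\<And>x. x \<in> set ys \<Longrightarrow> f x = g x) \<Longrightarrow> lsum N f xs = lsum N g ys"
  unfolding lsum_def by (intro foldr_cong) auto

lemma lsum_map: "lsum N f (map g xs) = lsum N (\<lambda>x. f (g x)) xs"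
  by (induction xs) auto

context abelian_monoid
begin

lemma lsum_closed [simp]: "(\<And>x. x \<in> set xs \<Longrightarrow> f x \<in> carrier G) \<Longrightarrow> lsum G f xs \<in> carrier G"
  by (induction xs) auto

lemma lsum_append:
  "(\<And>x. x \<in> set xs \<union> set ys \<Longrightarrow> f x \<in> carrier G) \<Longrightarrow> lsum G f (xs @ ys) = lsum G f xs \<oplus> lsum G f ys"
  by (induction xs) (auto simp: a_assoc)

lemma lsum_concat_map:
  "(\<And>x y. x \<in> set xs \<Longrightarrow> y \<in> set (h x) \<Longrightarrow> f y \<in> carrier G) \<Longrightarrow>
    lsum G f (concat (map h xs)) = lsum G (\<lambda>x. lsum G f (h x)) xs"
proof (induction xs)
  case (Cons a xs)
  have "lsum G f (concat (map h xs)) = lsum G (\<lambda>x. lsum G f (h x)) xs"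
    by (rule Cons.IH) (use Cons.prems in auto)
  moreover have "lsum G f (h a @ concat (map h xs)) = lsum G f (h a) \<oplus> lsum G f (concat (map h xs))"
    by (rule lsum_append) (use Cons.prems in auto)
  ultimately show ?case by simp
qed simp

lemma lsum_add:
  "(\<And>x. x \<in> set xs \<Longrightarrow> f x \<in> carrier G) \<Longrightarrow> (\<And>x. x \<in> set xs \<Longrightarrow> g x \<in> carrier G) \<Longrightarrow>
    lsum G (\<lambda>x. f x \<oplus> g x) xs = lsum G f xs \<oplus> lsum G g xs"
  by (induction xs) (auto simp: add.m_ac)

lemma lsum_filter:
  "(\<And>x. x \<in> set xs \<Longrightarrow> Q x \<Longrightarrow> f x \<in> carrier G) \<Longrightarrow>
    lsum G (\<lambda>x. if Q x then f x else \<zero>) xs = lsum G f (filter Q xs)"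
proof (induction xs)
  case (Cons x xs)
  have "lsum G f (filter Q xs) \<in> carrier G"
    by (rule lsum_closed) (use Cons.prems in auto)
  then show ?case using Cons by auto
qed simp

lemma lsum_mset_cong:
  assumes "mset xs = mset ys" "\<And>x. x \<in> set xs \<Longrightarrow> f x \<in> carrier G"
  shows "lsum G f xs = lsum G f ys"
  using assms
proof (induction xs arbitrary: ys)
  case (Cons x xs)
  have "x \<in> set ys" using Cons.prems(1) by (metis list.set_intros(1) mset_eq_setD)
  then obtain us vs where ys: "ys = us @ x # vs" by (meson split_list)
  have fc: "f z \<in> carrier G" if "z \<in> set ys" for z
    using that Cons.prems mset_eq_setD by metis
  have "mset xs = mset (us @ vs)" using Cons.prems(1) by (simp add: ys)
  then have "lsum G f xs = lsum G f (us @ vs)" using Cons by simp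
  also have "f x \<oplus> \<dots> = lsum G f ys"
  proof -
    have cl: "lsum G f us \<in> carrier G" "lsum G f vs \<in> carrier G" "f x \<in> carrier G"
      using fc unfolding ys by auto
    have "lsum G f (us @ vs) = lsum G f us \<oplus> lsum G f vs"
      "lsum G f (us @ x # vs) = lsum G f us \<oplus> lsum G f (x # vs)"
      using fc unfolding ys by (intro lsum_append; auto)+
    then show ?thesis using cl by (simp add: ys add.m_lcomm)
  qed
  finally show ?case by simp
qed simp

end

lemma linear_maps_lsum:
  assumes "module R M" "module R N" "f \<in> linear_maps R M N" "\<And>x. x \<in> set xs \<Longrightarrow> g x \<in> carrier M"
  shows "f (lsum M g xs) = lsum N (\<lambda>x. f (g x)) xs"
proof -
  interpret M: module R M by fact
  interpret N: module R N by fact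
  show ?thesis using assms(4)
    by (induction xs) (auto simp: linear_maps_zero[OF assms(1-3)] linear_maps_add[OF assms(3)])
qed

lemma linear_maps_lsum_fun:
  assumes N: "module R N" and "\<And>x. x \<in> set xs \<Longrightarrow> g x \<in> linear_maps R M N"
  shows "(\<lambda>v. lsum N (\<lambda>x. g x v) xs) \<in> linear_maps R M N"
  using assms(2)
  by (induction xs) (auto intro!: linear_maps_zero_fun[OF N] linear_maps_add_fun[OF N])

lemma (in assoc_algebra) mult_linear:
  assumes "x \<in> carrier M"
  shows "(\<lambda>y. x \<otimes>\<^bsub>M\<^esub> y) \<in> linear_maps R M M" "(\<lambda>y. y \<otimes>\<^bsub>M\<^esub> x) \<in> linear_maps R M M"
  by (rule linear_mapsI;
      use assms in \<open>simp add: r_distr l_distr smult_mult_left smult_mult_right\<close>)+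


section \<open>Monoid algebras\<close>

text \<open>
  Associativity and the unit laws are linear in each argument, so they extend from a spanning set one
  argument at a time.
\<close>
lemma assoc_algebraI_on_spanned:
  assumes M: "module R M" and sp: "spanned R M X"
    and left: "\<And>y. y \<in> carrier M \<Longrightarrow> (\<lambda>x. x \<otimes>\<^bsub>M\<^esub> y) \<in> linear_maps R M M"
    and right: "\<And>x. x \<in> carrier M \<Longrightarrow> (\<lambda>y. x \<otimes>\<^bsub>M\<^esub> y) \<in> linear_maps R M M"
    and one: "\<one>\<^bsub>M\<^esub> \<in> carrier M"
    and assoc: "\<And>x y z. x \<in> X \<Longrightarrow> y \<in> X \<Longrightarrow> z \<in> X \<Longrightarrow>
      (x \<otimes>\<^bsub>M\<^esub> y) \<otimes>\<^bsub>M\<^esub> z = x \<otimes>\<^bsub>M\<^esub> (y \<otimes>\<^bsub>M\<^esub> z)"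
    and l_one: "\<And>x. x \<in> X \<Longrightarrow> \<one>\<^bsub>M\<^esub> \<otimes>\<^bsub>M\<^esub> x = x"
    and r_one: "\<And>x. x \<in> X \<Longrightarrow> x \<otimes>\<^bsub>M\<^esub> \<one>\<^bsub>M\<^esub> = x"
  shows "assoc_algebra R M"
proof -
  interpret M: module R M by (rule M)
  have cl: "x \<otimes>\<^bsub>M\<^esub> y \<in> carrier M" if "x \<in> carrier M" "y \<in> carrier M" for x y
    using linear_maps_closed[OF left[OF that(2)] that(1)] .
  have X: "x \<in> carrier M" if "x \<in> X" for x using that spanned_carrier[OF sp] by blast
  have a1: "(x \<otimes>\<^bsub>M\<^esub> y) \<otimes>\<^bsub>M\<^esub> z = x \<otimes>\<^bsub>M\<^esub> (y \<otimes>\<^bsub>M\<^esub> z)"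
    if "x \<in> X" "y \<in> X" "z \<in> carrier M" for x y z
    using linear_maps_eq_on_spanned[OF M M right[OF cl[OF X X]]
        linear_maps_compose[OF right[OF X] right[OF X]] sp] assoc that by blast
  have a2: "(x \<otimes>\<^bsub>M\<^esub> y) \<otimes>\<^bsub>M\<^esub> z = x \<otimes>\<^bsub>M\<^esub> (y \<otimes>\<^bsub>M\<^esub> z)"
    if "x \<in> X" "y \<in> carrier M" "z \<in> carrier M" for x y z
    using linear_maps_eq_on_spanned[OF M M linear_maps_compose[OF right[OF X] left]
        linear_maps_compose[OF left right[OF X]] sp] a1 that by blast
  have a3: "(x \<otimes>\<^bsub>M\<^esub> y) \<otimes>\<^bsub>M\<^esub> z = x \<otimes>\<^bsub>M\<^esub> (y \<otimes>\<^bsub>M\<^esub> z)"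
    if "x \<in> carrier M" "y \<in> carrier M" "z \<in> carrier M" for x y z
    using linear_maps_eq_on_spanned[OF M M linear_maps_compose[OF left left]
        left[OF cl] sp] a2 that by blast
  have l1: "\<one>\<^bsub>M\<^esub> \<otimes>\<^bsub>M\<^esub> x = x" if "x \<in> carrier M" for x
    using linear_maps_eq_on_spanned[OF M M right[OF one] linear_maps_id sp] l_one that by blast
  have r1: "x \<otimes>\<^bsub>M\<^esub> \<one>\<^bsub>M\<^esub> = x" if "x \<in> carrier M" for x
    using linear_maps_eq_on_spanned[OF M M left[OF one] linear_maps_id sp] r_one that by blast
  have "Group.monoid M"
    by (rule monoidI) (use cl one a3 l1 r1 in auto)
  then have "ring M"
    by (intro ringI M.abelian_group_axioms)
      (use linear_maps_add[OF left] linear_maps_add[OF right] in auto)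
  then show ?thesis
    by (intro assoc_algebra.intro M assoc_algebra_axioms.intro)
      (use linear_maps_smult[OF left] linear_maps_smult[OF right] in auto)
qed

lemma monoid_algebra_carrierI:
  assumes "\<And>x. f x \<in> carrier R" "finite S" "S \<subseteq> carrier G" "\<And>x. x \<notin> S \<Longrightarrow> f x = \<zero>\<^bsub>R\<^esub>"
  shows "f \<in> carrier (monoid_algebra R G)"
proof -
  have "{x. f x \<noteq> \<zero>\<^bsub>R\<^esub>} \<subseteq> S" using assms(4) by blast
  then show ?thesis using assms finite_subset by (fastforce simp: monoid_algebra_def)
qed

lemma monoid_algebra_carrierD:
  assumes "f \<in> carrier (monoid_algebra R G)"
  shows "f x \<in> carrier R" "finite {x. f x \<noteq> \<zero>\<^bsub>R\<^esub>}" "{x. f x \<noteq> \<zero>\<^bsub>R\<^esub>} \<subseteq> carrier G"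
  using assms by (auto simp: monoid_algebra_def)

lemma monoid_algebra_ops [simp]:
  "\<zero>\<^bsub>monoid_algebra R G\<^esub> = (\<lambda>z. \<zero>\<^bsub>R\<^esub>)"
  "f \<oplus>\<^bsub>monoid_algebra R G\<^esub> g = (\<lambda>z. f z \<oplus>\<^bsub>R\<^esub> g z)"
  "a \<odot>\<^bsub>monoid_algebra R G\<^esub> f = (\<lambda>z. a \<otimes>\<^bsub>R\<^esub> f z)"
  by (simp_all add: monoid_algebra_def)

lemma monoid_algebra_one: "\<one>\<^bsub>monoid_algebra R G\<^esub> = delta R \<one>\<^bsub>G\<^esub>"
  by (simp add: monoid_algebra_def delta_def)

context cring
begin

lemma monoid_algebra_add_closed:
  assumes "f \<in> carrier (monoid_algebra R G)" "g \<in> carrier (monoid_algebra R G)"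
  shows "(\<lambda>z. f z \<oplus> g z) \<in> carrier (monoid_algebra R G)"
  by (rule monoid_algebra_carrierI[where S = "{x. f x \<noteq> \<zero>} \<union> {x. g x \<noteq> \<zero>}"])
    (use monoid_algebra_carrierD[OF assms(1)] monoid_algebra_carrierD[OF assms(2)] in auto)

lemma monoid_algebra_smult_closed:
  assumes "a \<in> carrier R" "f \<in> carrier (monoid_algebra R G)"
  shows "(\<lambda>z. a \<otimes> f z) \<in> carrier (monoid_algebra R G)"
  by (rule monoid_algebra_carrierI[where S = "{x. f x \<noteq> \<zero>}"])
    (use assms(1) monoid_algebra_carrierD[OF assms(2)] in auto)

lemma delta_closed: "x \<in> carrier G \<Longrightarrow> delta R x \<in> carrier (monoid_algebra R G)"
  by (rule monoid_algebra_carrierI[where S = "{x}"]) (auto simp: delta_def)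

lemma monoid_algebra_module: "module R (monoid_algebra R G)"
proof (rule moduleI)
  let ?F = "monoid_algebra R G"
  note D = monoid_algebra_carrierD(1)
  show "abelian_group ?F"
  proof (rule abelian_groupI)
    fix f assume f: "f \<in> carrier ?F"
    have "(\<lambda>z. (\<ominus> \<one>) \<otimes> f z) \<in> carrier ?F"
      by (rule monoid_algebra_smult_closed[OF _ f]) simp
    moreover have "(\<lambda>z. (\<ominus> \<one>) \<otimes> f z) \<oplus>\<^bsub>?F\<^esub> f = \<zero>\<^bsub>?F\<^esub>"
      using D[OF f] by (auto simp: l_minus l_neg)
    ultimately show "\<exists>g\<in>carrier ?F. g \<oplus>\<^bsub>?F\<^esub> f = \<zero>\<^bsub>?F\<^esub>" by blast
  next
    show "\<zero>\<^bsub>?F\<^esub> \<in> carrier ?F"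
      by (rule monoid_algebra_carrierI[where S = "{}"]) auto
  qed (auto simp: monoid_algebra_add_closed D a_assoc a_comm fun_eq_iff a_lcomm)
qed (auto simp: monoid_algebra_smult_closed monoid_algebra_carrierD(1) l_distr r_distr m_assoc
    fun_eq_iff is_cring)

lemma monoid_algebra_spanned: "spanned R (monoid_algebra R G) (delta R ` carrier G)"
  unfolding spanned_def
proof (intro conjI allI impI)
  let ?F = "monoid_algebra R G"
  interpret F: module R ?F by (rule monoid_algebra_module)
  show "delta R ` carrier G \<subseteq> carrier ?F" by (auto intro: delta_closed)
  fix H assume H: "submodule H R ?F" and sub: "delta R ` carrier G \<subseteq> H"
  note HE = F.submoduleE[OF H]
  have zero: "\<zero>\<^bsub>?F\<^esub> \<in> H"
    using subgroup.one_closed[OF submodule.axioms(1)[OF H]] by simp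
  \<comment> \<open>induction on a finite set that contains the support\<close>
  have *: "f \<in> H" if "finite S" "S \<subseteq> carrier G" "\<And>x. f x \<in> carrier R" "\<And>x. x \<notin> S \<Longrightarrow> f x = \<zero>" for S f
    using that
  proof (induction S arbitrary: f rule: finite_induct)
    case empty
    then have "f = \<zero>\<^bsub>?F\<^esub>" by auto
    then show ?case using zero by simp
  next
    case (insert s S)
    let ?g = "f(s := \<zero>)"
    have "?g \<in> H" by (rule insert.IH) (use insert.prems in auto)
    moreover have "f s \<odot>\<^bsub>?F\<^esub> delta R s \<in> H"
      using sub insert.prems(1) by (intro HE(4) insert.prems(2)) auto
    ultimately have "?g \<oplus>\<^bsub>?F\<^esub> f s \<odot>\<^bsub>?F\<^esub> delta R s \<in> H" by (rule HE(5))
    moreover have "?g \<oplus>\<^bsub>?F\<^esub> f s \<odot>\<^bsub>?F\<^esub> delta R s = f"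
      using insert.prems(2) by (auto simp: delta_def fun_eq_iff)
    ultimately show ?case by simp
  qed
  show "carrier ?F \<subseteq> H"
  proof
    fix f assume "f \<in> carrier ?F"
    note D = monoid_algebra_carrierD[OF this]
    show "f \<in> H" by (rule *[OF D(2,3,1)]) auto
  qed
qed

end

text \<open>
  The linear map on the free module that sends each basis element \<open>delta R x\<close> to \<open>\<phi> x\<close>.
\<close>
definition free_lift ::
  "('k, 'r) ring_scheme \<Rightarrow> ('k, 'v, 'm) module_scheme \<Rightarrow> ('x \<Rightarrow> 'v) \<Rightarrow> ('x \<Rightarrow> 'k) \<Rightarrow> 'v"
  where "free_lift R N \<phi> f = (\<Oplus>\<^bsub>N\<^esub>x \<in> {x. f x \<noteq> \<zero>\<^bsub>R\<^esub>}. f x \<odot>\<^bsub>N\<^esub> \<phi> x)"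

context module
begin

lemma free_lift_superset:
  assumes "\<And>x. f x \<in> carrier R" "finite S" "{x. f x \<noteq> \<zero>} \<subseteq> S" "\<phi> \<in> S \<rightarrow> carrier M"
  shows "free_lift R M \<phi> f = (\<Oplus>\<^bsub>M\<^esub>x \<in> S. f x \<odot>\<^bsub>M\<^esub> \<phi> x)"
  unfolding free_lift_def
  by (rule M.add.finprod_mono_neutral_cong_left) (use assms in \<open>auto simp: Pi_def\<close>)

lemma free_lift_linear:
  assumes \<phi>: "\<phi> \<in> carrier G \<rightarrow> carrier M"
  shows "free_lift R M \<phi> \<in> linear_maps R (monoid_algebra R G) M"
proof (rule linear_mapsI)
  let ?F = "monoid_algebra R G"
  fix f assume f: "f \<in> carrier ?F"
  note Df = monoid_algebra_carrierD[OF f]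
  show "free_lift R M \<phi> f \<in> carrier M"
    unfolding free_lift_def using Df \<phi> by (intro M.finsum_closed) auto
  {
    fix a assume a: "a \<in> carrier R"
    have "free_lift R M \<phi> (a \<odot>\<^bsub>?F\<^esub> f) = (\<Oplus>\<^bsub>M\<^esub>x \<in> {x. f x \<noteq> \<zero>}. (a \<otimes> f x) \<odot>\<^bsub>M\<^esub> \<phi> x)"
      using Df a \<phi> by (subst free_lift_superset[where S = "{x. f x \<noteq> \<zero>}"]) auto
    also have "\<dots> = (\<Oplus>\<^bsub>M\<^esub>x \<in> {x. f x \<noteq> \<zero>}. a \<odot>\<^bsub>M\<^esub> (f x \<odot>\<^bsub>M\<^esub> \<phi> x))"
      using Df a \<phi> by (intro M.finsum_cong) (auto simp: smult_assoc1 Pi_def subset_iff simp_implies_def)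
    also have "\<dots> = a \<odot>\<^bsub>M\<^esub> free_lift R M \<phi> f"
      unfolding free_lift_def using Df a \<phi>
      by (intro finsum_smult_ldistr[symmetric]) (auto simp: Pi_def subset_iff)
    finally show "free_lift R M \<phi> (a \<odot>\<^bsub>?F\<^esub> f) = a \<odot>\<^bsub>M\<^esub> free_lift R M \<phi> f" .
  }
  fix g assume g: "g \<in> carrier ?F"
  note Dg = monoid_algebra_carrierD[OF g]
  let ?S = "{x. f x \<noteq> \<zero>} \<union> {x. g x \<noteq> \<zero>}"
  have S: "finite ?S" "?S \<subseteq> carrier G" using Df Dg by auto
  then have \<phi>S: "\<phi> \<in> ?S \<rightarrow> carrier M" using \<phi> by blast
  have "free_lift R M \<phi> (f \<oplus>\<^bsub>?F\<^esub> g) = (\<Oplus>\<^bsub>M\<^esub>x \<in> ?S. (f x \<oplus> g x) \<odot>\<^bsub>M\<^esub> \<phi> x)"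
    using Df Dg by (subst free_lift_superset[OF _ S(1) _ \<phi>S]) auto
  also have "\<dots> = (\<Oplus>\<^bsub>M\<^esub>x \<in> ?S. f x \<odot>\<^bsub>M\<^esub> \<phi> x \<oplus>\<^bsub>M\<^esub> g x \<odot>\<^bsub>M\<^esub> \<phi> x)"
    using Df Dg \<phi>S
    by (intro M.finsum_cong) (auto simp: smult_l_distr Pi_def simp_implies_def)
  also have "\<dots> = (\<Oplus>\<^bsub>M\<^esub>x \<in> ?S. f x \<odot>\<^bsub>M\<^esub> \<phi> x) \<oplus>\<^bsub>M\<^esub> (\<Oplus>\<^bsub>M\<^esub>x \<in> ?S. g x \<odot>\<^bsub>M\<^esub> \<phi> x)"
    using Df Dg \<phi>S by (intro M.finsum_addf) (auto simp: Pi_def)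
  also have "\<dots> = free_lift R M \<phi> f \<oplus>\<^bsub>M\<^esub> free_lift R M \<phi> g"
    using Df Dg by (simp add: free_lift_superset[OF _ S(1) _ \<phi>S])
  finally show "free_lift R M \<phi> (f \<oplus>\<^bsub>?F\<^esub> g) = free_lift R M \<phi> f \<oplus>\<^bsub>M\<^esub> free_lift R M \<phi> g" .
qed

lemma free_lift_delta:
  assumes "\<phi> x \<in> carrier M"
  shows "free_lift R M \<phi> (delta R x) = \<phi> x"
proof -
  have "free_lift R M \<phi> (delta R x) = (\<Oplus>\<^bsub>M\<^esub>y \<in> {x}. delta R x y \<odot>\<^bsub>M\<^esub> \<phi> y)"
    using assms by (intro free_lift_superset) (auto simp: delta_def)
  then show ?thesis using assms by (simp add: delta_def)
qed

end

context cring
begin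

text \<open>
  The sum that defines the product runs over the supports of both factors. Summing over fixed larger
  sets instead makes its additivity in each factor visible.
\<close>
lemma monoid_algebra_mult_superset:
  assumes f: "f \<in> carrier (monoid_algebra R G)" and g: "g \<in> carrier (monoid_algebra R G)"
    and "finite S" "finite U" "{x. f x \<noteq> \<zero>} \<subseteq> S" "{x. g x \<noteq> \<zero>} \<subseteq> U"
  shows "(f \<otimes>\<^bsub>monoid_algebra R G\<^esub> g) z =
    (\<Oplus>p \<in> S \<times> U. if fst p \<otimes>\<^bsub>G\<^esub> snd p = z then f (fst p) \<otimes> g (snd p) else \<zero>)"
proof -
  note Df = monoid_algebra_carrierD[OF f] and Dg = monoid_algebra_carrierD[OF g]
  have "(\<Oplus>p \<in> {(x, y). f x \<noteq> \<zero> \<and> g y \<noteq> \<zero> \<and> x \<otimes>\<^bsub>G\<^esub> y = z}. f (fst p) \<otimes> g (snd p)) =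
    (\<Oplus>p \<in> S \<times> U. if fst p \<otimes>\<^bsub>G\<^esub> snd p = z then f (fst p) \<otimes> g (snd p) else \<zero>)"
    by (rule add.finprod_mono_neutral_cong_left) (use assms Df Dg in \<open>auto simp: Pi_def\<close>)
  then show ?thesis by (simp add: monoid_algebra_def)
qed

lemma monoid_algebra_mult_closed:
  assumes "Group.monoid G"
    and f: "f \<in> carrier (monoid_algebra R G)" and g: "g \<in> carrier (monoid_algebra R G)"
  shows "f \<otimes>\<^bsub>monoid_algebra R G\<^esub> g \<in> carrier (monoid_algebra R G)"
proof -
  note Df = monoid_algebra_carrierD[OF f] and Dg = monoid_algebra_carrierD[OF g]
  let ?S = "{x. f x \<noteq> \<zero>}" and ?T = "{x. g x \<noteq> \<zero>}"
  note eq = monoid_algebra_mult_superset[OF f g Df(2) Dg(2) order_refl order_refl]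
  show ?thesis
  proof (rule monoid_algebra_carrierI[where S = "(\<lambda>p. fst p \<otimes>\<^bsub>G\<^esub> snd p) ` (?S \<times> ?T)"])
    fix z show "(f \<otimes>\<^bsub>monoid_algebra R G\<^esub> g) z \<in> carrier R"
      unfolding eq using Df Dg by (intro finsum_closed) auto
    assume "z \<notin> (\<lambda>p. fst p \<otimes>\<^bsub>G\<^esub> snd p) ` (?S \<times> ?T)"
    then show "(f \<otimes>\<^bsub>monoid_algebra R G\<^esub> g) z = \<zero>"
      unfolding eq by (intro add.finprod_one_eqI) auto
  qed (use Df Dg monoid.m_closed[OF assms(1)] in \<open>auto simp: subset_iff\<close>)
qed

lemma monoid_algebra_mult_left_linear:
  assumes G: "Group.monoid G" and g: "g \<in> carrier (monoid_algebra R G)"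
  shows "(\<lambda>f. f \<otimes>\<^bsub>monoid_algebra R G\<^esub> g) \<in> linear_maps R (monoid_algebra R G) (monoid_algebra R G)"
proof (rule linear_mapsI)
  let ?F = "monoid_algebra R G"
  interpret F: module R ?F by (rule monoid_algebra_module)
  note Dg = monoid_algebra_carrierD[OF g]
  let ?T = "{x. g x \<noteq> \<zero>}"
  fix f assume f: "f \<in> carrier ?F"
  note Df = monoid_algebra_carrierD[OF f]
  show "f \<otimes>\<^bsub>?F\<^esub> g \<in> carrier ?F" by (rule monoid_algebra_mult_closed[OF G f g])
  {
    fix a assume a: "a \<in> carrier R"
    show "(a \<odot>\<^bsub>?F\<^esub> f) \<otimes>\<^bsub>?F\<^esub> g = a \<odot>\<^bsub>?F\<^esub> (f \<otimes>\<^bsub>?F\<^esub> g)"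
    proof
      fix z
      let ?S = "{x. f x \<noteq> \<zero>}"
      have "((a \<odot>\<^bsub>?F\<^esub> f) \<otimes>\<^bsub>?F\<^esub> g) z = (\<Oplus>p \<in> ?S \<times> ?T.
          if fst p \<otimes>\<^bsub>G\<^esub> snd p = z then (a \<odot>\<^bsub>?F\<^esub> f) (fst p) \<otimes> g (snd p) else \<zero>)"
        by (rule monoid_algebra_mult_superset) (use a f g Df Dg in \<open>auto simp: monoid_algebra_smult_closed\<close>)
      also have "\<dots> = (\<Oplus>p \<in> ?S \<times> ?T.
          a \<otimes> (if fst p \<otimes>\<^bsub>G\<^esub> snd p = z then f (fst p) \<otimes> g (snd p) else \<zero>))"
        by (rule finsum_cong) (use a Df Dg in \<open>auto simp: m_assoc simp_implies_def\<close>)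
      also have "\<dots> = a \<otimes> (f \<otimes>\<^bsub>?F\<^esub> g) z"
        unfolding monoid_algebra_mult_superset[OF f g Df(2) Dg(2) order_refl order_refl]
        by (rule finsum_rdistr[symmetric]) (use a Df Dg in auto)
      finally show "((a \<odot>\<^bsub>?F\<^esub> f) \<otimes>\<^bsub>?F\<^esub> g) z = (a \<odot>\<^bsub>?F\<^esub> (f \<otimes>\<^bsub>?F\<^esub> g)) z" by simp
    qed
  }
  fix f' assume f': "f' \<in> carrier ?F"
  note Df' = monoid_algebra_carrierD[OF f']
  show "(f \<oplus>\<^bsub>?F\<^esub> f') \<otimes>\<^bsub>?F\<^esub> g = f \<otimes>\<^bsub>?F\<^esub> g \<oplus>\<^bsub>?F\<^esub> f' \<otimes>\<^bsub>?F\<^esub> g"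
  proof
    fix z
    let ?S = "{x. f x \<noteq> \<zero>} \<union> {x. f' x \<noteq> \<zero>}"
    have S: "finite ?S" using Df Df' by auto
    let ?t = "\<lambda>f p. if fst p \<otimes>\<^bsub>G\<^esub> snd p = z then f (fst p) \<otimes> g (snd p) else \<zero>"
    have "((f \<oplus>\<^bsub>?F\<^esub> f') \<otimes>\<^bsub>?F\<^esub> g) z = (\<Oplus>p \<in> ?S \<times> ?T. ?t (f \<oplus>\<^bsub>?F\<^esub> f') p)"
      by (rule monoid_algebra_mult_superset)
        (use S f f' g Df Df' Dg in \<open>auto simp: monoid_algebra_add_closed\<close>)
    also have "\<dots> = (\<Oplus>p \<in> ?S \<times> ?T. ?t f p \<oplus> ?t f' p)"
      by (rule finsum_cong) (use Df Df' Dg in \<open>auto simp: l_distr simp_implies_def\<close>)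
    also have "\<dots> = (\<Oplus>p \<in> ?S \<times> ?T. ?t f p) \<oplus> (\<Oplus>p \<in> ?S \<times> ?T. ?t f' p)"
      by (rule finsum_addf) (use Df Df' Dg in auto)
    also have "\<dots> = (f \<otimes>\<^bsub>?F\<^esub> g) z \<oplus> (f' \<otimes>\<^bsub>?F\<^esub> g) z"
      by (simp add: monoid_algebra_mult_superset[OF f g S Dg(2) _ order_refl]
          monoid_algebra_mult_superset[OF f' g S Dg(2) _ order_refl])
    finally show "((f \<oplus>\<^bsub>?F\<^esub> f') \<otimes>\<^bsub>?F\<^esub> g) z = (f \<otimes>\<^bsub>?F\<^esub> g \<oplus>\<^bsub>?F\<^esub> f' \<otimes>\<^bsub>?F\<^esub> g) z" by simp
  qed
qed

text \<open>
  Exchanging the factors amounts to passing to the opposite monoid; this transfers linearity from the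
  first factor to the second.
\<close>
lemma monoid_algebra_mult_opposite:
  assumes f: "f \<in> carrier (monoid_algebra R G)" and g: "g \<in> carrier (monoid_algebra R G)"
  shows "f \<otimes>\<^bsub>monoid_algebra R G\<^esub> g = g \<otimes>\<^bsub>monoid_algebra R (G\<lparr>mult := \<lambda>x y. y \<otimes>\<^bsub>G\<^esub> x\<rparr>)\<^esub> f"
proof
  fix z
  note D = monoid_algebra_carrierD(1)[OF f] monoid_algebra_carrierD(1)[OF g]
  let ?S = "{(x, y). f x \<noteq> \<zero> \<and> g y \<noteq> \<zero> \<and> x \<otimes>\<^bsub>G\<^esub> y = z}"
  have "prod.swap ` ?S = {(y, x). g y \<noteq> \<zero> \<and> f x \<noteq> \<zero> \<and> x \<otimes>\<^bsub>G\<^esub> y = z}" by auto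
  then have "(g \<otimes>\<^bsub>monoid_algebra R (G\<lparr>mult := \<lambda>x y. y \<otimes>\<^bsub>G\<^esub> x\<rparr>)\<^esub> f) z =
      (\<Oplus>p \<in> prod.swap ` ?S. g (fst p) \<otimes> f (snd p))"
    by (simp add: monoid_algebra_def)
  also have "\<dots> = (\<Oplus>p \<in> ?S. g (snd p) \<otimes> f (fst p))"
    using D by (subst finsum_reindex) auto
  finally show "(f \<otimes>\<^bsub>monoid_algebra R G\<^esub> g) z =
      (g \<otimes>\<^bsub>monoid_algebra R (G\<lparr>mult := \<lambda>x y. y \<otimes>\<^bsub>G\<^esub> x\<rparr>)\<^esub> f) z"
    using D by (simp add: monoid_algebra_def m_comm)
qed

lemma monoid_algebra_mult_right_linear:
  assumes "Group.monoid G" and f: "f \<in> carrier (monoid_algebra R G)"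
  shows "(\<lambda>g. f \<otimes>\<^bsub>monoid_algebra R G\<^esub> g) \<in> linear_maps R (monoid_algebra R G) (monoid_algebra R G)"
proof -
  interpret G: Group.monoid G by fact
  let ?G = "G\<lparr>mult := \<lambda>x y. y \<otimes>\<^bsub>G\<^esub> x\<rparr>"
  have G': "Group.monoid ?G" by (rule monoidI) (simp_all add: G.m_assoc)
  have f': "f \<in> carrier (monoid_algebra R ?G)" using f by (simp add: monoid_algebra_def)
  have same: "carrier (monoid_algebra R ?G) = carrier (monoid_algebra R G)"
    by (simp add: monoid_algebra_def)
  have "(\<lambda>g. g \<otimes>\<^bsub>monoid_algebra R ?G\<^esub> f) \<in> linear_maps R (monoid_algebra R G) (monoid_algebra R G)"
    using monoid_algebra_mult_left_linear[OF G' f']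
    unfolding linear_maps_def same monoid_algebra_ops .
  then show ?thesis
    by (rule iffD2[OF linear_maps_cong[OF monoid_algebra_module], rotated])
      (rule monoid_algebra_mult_opposite[OF f])
qed

lemma delta_mult:
  assumes "x \<in> carrier G" "y \<in> carrier G"
  shows "delta R x \<otimes>\<^bsub>monoid_algebra R G\<^esub> delta R y = delta R (x \<otimes>\<^bsub>G\<^esub> y)"
proof
  fix z
  have "(delta R x \<otimes>\<^bsub>monoid_algebra R G\<^esub> delta R y) z = (\<Oplus>p \<in> {x} \<times> {y}.
      if fst p \<otimes>\<^bsub>G\<^esub> snd p = z then delta R x (fst p) \<otimes> delta R y (snd p) else \<zero>)"
    by (rule monoid_algebra_mult_superset[OF delta_closed delta_closed]) (auto simp: assms delta_def)
  then show "(delta R x \<otimes>\<^bsub>monoid_algebra R G\<^esub> delta R y) z = delta R (x \<otimes>\<^bsub>G\<^esub> y) z"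
    by (simp add: delta_def)
qed

lemma monoid_algebra_assoc_algebra:
  assumes "Group.monoid G"
  shows "assoc_algebra R (monoid_algebra R G)"
proof -
  interpret G: Group.monoid G by fact
  show ?thesis
    by (rule assoc_algebraI_on_spanned[OF monoid_algebra_module monoid_algebra_spanned
          monoid_algebra_mult_left_linear[OF assms] monoid_algebra_mult_right_linear[OF assms]])
      (auto simp: delta_mult monoid_algebra_one delta_closed G.m_assoc)
qed

end


section \<open>Quotients and presented algebras\<close>

lemma submodule_abelian_subgroup:
  assumes "module R M" "submodule I R M"
  shows "abelian_subgroup I M"
proof -
  interpret M: module R M by fact
  show ?thesis
    by (rule abelian_subgroupI3[OF additive_subgroup.intro[OF submodule.axioms(1)[OF assms(2)]]
          M.abelian_group_axioms])
qed

lemma quotient_algebra_fields: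
  "carrier (quotient_algebra M I) = (\<lambda>x. I +>\<^bsub>M\<^esub> x) ` carrier M"
  "X \<otimes>\<^bsub>quotient_algebra M I\<^esub> Y = rcoset_mult M I X Y"
  "\<one>\<^bsub>quotient_algebra M I\<^esub> = I +>\<^bsub>M\<^esub> \<one>\<^bsub>M\<^esub>"
  "\<zero>\<^bsub>quotient_algebra M I\<^esub> = I"
  "X \<oplus>\<^bsub>quotient_algebra M I\<^esub> Y = X <+>\<^bsub>M\<^esub> Y"
  "a \<odot>\<^bsub>quotient_algebra M I\<^esub> Y = (\<Union>x\<in>Y. I +>\<^bsub>M\<^esub> (a \<odot>\<^bsub>M\<^esub> x))"
  by (auto simp: quotient_algebra_def ring.defs module.defs FactRing_def A_RCOSETS_def')

lemma
  assumes M: "module R M" and I: "submodule I R M"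
  shows quotient_algebra_zero: "\<zero>\<^bsub>quotient_algebra M I\<^esub> = I +>\<^bsub>M\<^esub> \<zero>\<^bsub>M\<^esub>"
    and quotient_algebra_add: "x \<in> carrier M \<Longrightarrow> y \<in> carrier M \<Longrightarrow>
      (I +>\<^bsub>M\<^esub> x) \<oplus>\<^bsub>quotient_algebra M I\<^esub> (I +>\<^bsub>M\<^esub> y) = I +>\<^bsub>M\<^esub> (x \<oplus>\<^bsub>M\<^esub> y)"
    and quotient_algebra_smult: "a \<in> carrier R \<Longrightarrow> x \<in> carrier M \<Longrightarrow>
      a \<odot>\<^bsub>quotient_algebra M I\<^esub> (I +>\<^bsub>M\<^esub> x) = I +>\<^bsub>M\<^esub> (a \<odot>\<^bsub>M\<^esub> x)"
    and quotient_algebra_eq_iff: "x \<in> carrier M \<Longrightarrow> y \<in> carrier M \<Longrightarrow>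
      I +>\<^bsub>M\<^esub> x = I +>\<^bsub>M\<^esub> y \<longleftrightarrow> x \<ominus>\<^bsub>M\<^esub> y \<in> I"
proof -
  interpret M: module R M by (rule M)
  interpret I: abelian_subgroup I M by (rule submodule_abelian_subgroup[OF M I])
  note E = M.submoduleE[OF I]
  have coset: "I +>\<^bsub>M\<^esub> x = I +>\<^bsub>M\<^esub> y \<longleftrightarrow> x \<ominus>\<^bsub>M\<^esub> y \<in> I"
    if "x \<in> carrier M" "y \<in> carrier M" for x y
  proof
    assume "I +>\<^bsub>M\<^esub> x = I +>\<^bsub>M\<^esub> y"
    from I.a_repr_independenceD[OF that(1) this[symmetric]] show "x \<ominus>\<^bsub>M\<^esub> y \<in> I"
      unfolding a_minus_def by (rule I.a_rcos_module_imp[OF that(2)])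
  next
    assume "x \<ominus>\<^bsub>M\<^esub> y \<in> I"
    then have "x \<in> I +>\<^bsub>M\<^esub> y"
      unfolding a_minus_def by (rule I.a_rcos_module_rev[OF that(2,1)])
    from I.a_repr_independence'[OF this that(2)] show "I +>\<^bsub>M\<^esub> x = I +>\<^bsub>M\<^esub> y" by (rule sym)
  qed
  then show "x \<in> carrier M \<Longrightarrow> y \<in> carrier M \<Longrightarrow>
      I +>\<^bsub>M\<^esub> x = I +>\<^bsub>M\<^esub> y \<longleftrightarrow> x \<ominus>\<^bsub>M\<^esub> y \<in> I" .
  show "\<zero>\<^bsub>quotient_algebra M I\<^esub> = I +>\<^bsub>M\<^esub> \<zero>\<^bsub>M\<^esub>"
    using E(1) by (simp add: quotient_algebra_fields)
  show "x \<in> carrier M \<Longrightarrow> y \<in> carrier M \<Longrightarrow>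
      (I +>\<^bsub>M\<^esub> x) \<oplus>\<^bsub>quotient_algebra M I\<^esub> (I +>\<^bsub>M\<^esub> y) = I +>\<^bsub>M\<^esub> (x \<oplus>\<^bsub>M\<^esub> y)"
    by (simp add: quotient_algebra_fields I.a_rcos_sum)
  assume a: "a \<in> carrier R" and x: "x \<in> carrier M"
  have "I +>\<^bsub>M\<^esub> (a \<odot>\<^bsub>M\<^esub> y) = I +>\<^bsub>M\<^esub> (a \<odot>\<^bsub>M\<^esub> x)" if "y \<in> I +>\<^bsub>M\<^esub> x" for y
  proof -
    from that x obtain i where i: "i \<in> I" and y: "y = i \<oplus>\<^bsub>M\<^esub> x"
      by (auto simp: a_r_coset_def r_coset_def)
    have ic: "i \<in> carrier M" using i E(1) by blast
    have "a \<odot>\<^bsub>M\<^esub> y \<ominus>\<^bsub>M\<^esub> a \<odot>\<^bsub>M\<^esub> x = a \<odot>\<^bsub>M\<^esub> i"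
      using a x ic by (simp add: y M.smult_r_distr a_minus_def M.a_assoc M.r_neg)
    then have "a \<odot>\<^bsub>M\<^esub> y \<ominus>\<^bsub>M\<^esub> a \<odot>\<^bsub>M\<^esub> x \<in> I" using E(4) a i by simp
    then show ?thesis using a x ic by (subst coset) (auto simp: y)
  qed
  with I.a_rcos_self[OF x] show
    "a \<odot>\<^bsub>quotient_algebra M I\<^esub> (I +>\<^bsub>M\<^esub> x) = I +>\<^bsub>M\<^esub> (a \<odot>\<^bsub>M\<^esub> x)"
    unfolding quotient_algebra_fields by (intro SUP_eq_const) blast+
qed

text \<open>
  Axioms that are equations pass to surjective images. The quotient structure is obtained in this way
  from its description on cosets.
\<close>
lemma module_surjective_image:
  assumes M: "module R M" and surj: "carrier N = h ` carrier M"
    and zero: "\<zero>\<^bsub>N\<^esub> = h \<zero>\<^bsub>M\<^esub>"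
    and add: "\<And>x y. x \<in> carrier M \<Longrightarrow> y \<in> carrier M \<Longrightarrow> h x \<oplus>\<^bsub>N\<^esub> h y = h (x \<oplus>\<^bsub>M\<^esub> y)"
    and smult: "\<And>a x. a \<in> carrier R \<Longrightarrow> x \<in> carrier M \<Longrightarrow> a \<odot>\<^bsub>N\<^esub> h x = h (a \<odot>\<^bsub>M\<^esub> x)"
  shows "module R N"
proof -
  interpret M: module R M by (rule M)
  show ?thesis
  proof (rule moduleI)
    show "abelian_group N"
    proof (rule abelian_groupI)
      fix x assume "x \<in> carrier N"
      then obtain u where u: "u \<in> carrier M" "x = h u" using surj by auto
      then have "h (\<ominus>\<^bsub>M\<^esub> u) \<oplus>\<^bsub>N\<^esub> x = \<zero>\<^bsub>N\<^esub>" by (simp add: add zero M.l_neg)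
      then show "\<exists>y\<in>carrier N. y \<oplus>\<^bsub>N\<^esub> x = \<zero>\<^bsub>N\<^esub>" using u surj by blast
    qed (auto simp: surj zero add M.add.m_ac)
  qed (auto simp: surj add smult M.R.is_cring M.smult_l_distr M.smult_r_distr M.smult_assoc1)
qed

lemma assoc_algebra_surjective_image:
  assumes M: "assoc_algebra R M" and surj: "carrier N = h ` carrier M"
    and zero: "\<zero>\<^bsub>N\<^esub> = h \<zero>\<^bsub>M\<^esub>" and one: "\<one>\<^bsub>N\<^esub> = h \<one>\<^bsub>M\<^esub>"
    and add: "\<And>x y. x \<in> carrier M \<Longrightarrow> y \<in> carrier M \<Longrightarrow> h x \<oplus>\<^bsub>N\<^esub> h y = h (x \<oplus>\<^bsub>M\<^esub> y)"
    and mult: "\<And>x y. x \<in> carrier M \<Longrightarrow> y \<in> carrier M \<Longrightarrow> h x \<otimes>\<^bsub>N\<^esub> h y = h (x \<otimes>\<^bsub>M\<^esub> y)"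
    and smult: "\<And>a x. a \<in> carrier R \<Longrightarrow> x \<in> carrier M \<Longrightarrow> a \<odot>\<^bsub>N\<^esub> h x = h (a \<odot>\<^bsub>M\<^esub> x)"
  shows "assoc_algebra R N"
proof -
  interpret M: assoc_algebra R M by (rule M)
  have N: "module R N"
    by (rule module_surjective_image[OF M.module_axioms surj zero add smult])
  then interpret N: module R N .
  have "Group.monoid N"
    by (rule monoidI) (auto simp: surj mult one M.m_assoc)
  then have "ring N"
    by (intro ringI N.abelian_group_axioms) (auto simp: surj mult add M.l_distr M.r_distr)
  then show ?thesis
    by (intro assoc_algebra.intro N assoc_algebra_axioms.intro)
      (auto simp: surj mult smult M.smult_mult_left M.smult_mult_right)
qed

lemma quotient_algebra_module:
  assumes "module R M" "submodule I R M"
  shows "module R (quotient_algebra M I)"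
  by (rule module_surjective_image[OF assms(1) quotient_algebra_fields(1)
        quotient_algebra_zero[OF assms] quotient_algebra_add[OF assms] quotient_algebra_smult[OF assms]])

lemma quotient_algebra_proj_linear:
  assumes "module R M" "submodule I R M"
  shows "(\<lambda>x. I +>\<^bsub>M\<^esub> x) \<in> linear_maps R M (quotient_algebra M I)"
  by (rule linear_mapsI)
    (simp_all add: quotient_algebra_fields(1) quotient_algebra_add[OF assms] quotient_algebra_smult[OF assms])

lemma quotient_algebra_spanned:
  assumes M: "module R M" and I: "submodule I R M" and X: "spanned R M X"
  shows "spanned R (quotient_algebra M I) ((\<lambda>x. I +>\<^bsub>M\<^esub> x) ` X)"
  unfolding spanned_def
proof (intro conjI allI impI)
  let ?p = "\<lambda>x. I +>\<^bsub>M\<^esub> x"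
  show "?p ` X \<subseteq> carrier (quotient_algebra M I)"
    using spanned_carrier[OF X] by (auto simp: quotient_algebra_fields(1))
  fix H assume H: "submodule H R (quotient_algebra M I)" "?p ` X \<subseteq> H"
  have "submodule {x \<in> carrier M. ?p x \<in> H} R M"
    by (rule submodule_vimage[OF M quotient_algebra_module[OF M I]
          quotient_algebra_proj_linear[OF M I] H(1)])
  from spannedD[OF X this] have "?p x \<in> H" if "x \<in> carrier M" for x
    using H(2) spanned_carrier[OF X] that by auto
  then show "carrier (quotient_algebra M I) \<subseteq> H"
    by (auto simp: quotient_algebra_fields(1))
qed

lemma quotient_algebra_lift:
  assumes M: "module R M" and N: "module R N" and G: "G \<subseteq> carrier M"
    and \<phi>: "\<phi> \<in> linear_maps R M N" and kill: "\<And>x. x \<in> G \<Longrightarrow> \<phi> x = \<zero>\<^bsub>N\<^esub>"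
  shows "\<exists>\<psi>\<in>linear_maps R (quotient_algebra M (mod_span R M G)) N.
    \<forall>x\<in>carrier M. \<psi> (mod_span R M G +>\<^bsub>M\<^esub> x) = \<phi> x"
proof -
  interpret M: module R M by (rule M)
  interpret N: module R N by (rule N)
  let ?I = "mod_span R M G"
  have I: "submodule ?I R M" by (rule mod_span_submodule[OF M G])
  have "?I \<subseteq> {x \<in> carrier M. \<phi> x = \<zero>\<^bsub>N\<^esub>}"
    by (rule mod_span_least[OF submodule_equalizer[OF M N \<phi> linear_maps_zero_fun[OF N]]])
      (use G kill in auto)
  then have wd: "\<phi> x = \<phi> y" if "x \<in> carrier M" "y \<in> carrier M" "?I +>\<^bsub>M\<^esub> x = ?I +>\<^bsub>M\<^esub> y" for x y
  proof -
    have "\<phi> (x \<ominus>\<^bsub>M\<^esub> y) = \<zero>\<^bsub>N\<^esub>"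
      using that \<open>?I \<subseteq> _\<close> by (auto simp: quotient_algebra_eq_iff[OF M I])
    then have "\<phi> x \<oplus>\<^bsub>N\<^esub> (\<ominus>\<^bsub>N\<^esub> \<phi> y) = \<zero>\<^bsub>N\<^esub>"
      using that linear_maps_minus[OF M N \<phi>] by (simp add: a_minus_def)
    then show ?thesis
      using that linear_maps_closed[OF \<phi>] N.minus_equality[of "\<phi> x" "\<ominus>\<^bsub>N\<^esub> \<phi> y"] by simp
  qed
  define \<psi> where "\<psi> Y = \<phi> (SOME x. x \<in> carrier M \<and> ?I +>\<^bsub>M\<^esub> x = Y)" for Y
  have \<psi>: "\<psi> (?I +>\<^bsub>M\<^esub> x) = \<phi> x" if "x \<in> carrier M" for x
  proof -
    let ?P = "\<lambda>y. y \<in> carrier M \<and> ?I +>\<^bsub>M\<^esub> y = ?I +>\<^bsub>M\<^esub> x"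
    have "?P (SOME y. ?P y)" by (rule someI[of ?P x]) (simp add: that)
    then show ?thesis unfolding \<psi>_def using wd that by blast
  qed
  have "\<psi> \<in> linear_maps R (quotient_algebra M ?I) N"
    by (rule linear_mapsI)
      (auto simp: quotient_algebra_fields(1) quotient_algebra_add[OF M I]
        quotient_algebra_smult[OF M I] \<psi> linear_maps_closed[OF \<phi>] linear_maps_add[OF \<phi>]
        linear_maps_smult[OF \<phi>])
  then show ?thesis using \<psi> by blast
qed

text \<open>
  Multiplication by a fixed element is linear. Hence the span of \<open>G\<close> is a two-sided ideal as soon as it
  absorbs the products of elements of \<open>G\<close> with elements of the spanning set \<open>X\<close>.
\<close>
lemma quotient_algebra_assoc_algebra:
  assumes M: "assoc_algebra R M" and sp: "spanned R M X" and G: "G \<subseteq> carrier M"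
    and mult: "\<And>x g. x \<in> X \<Longrightarrow> g \<in> G \<Longrightarrow>
      x \<otimes>\<^bsub>M\<^esub> g \<in> mod_span R M G \<and> g \<otimes>\<^bsub>M\<^esub> x \<in> mod_span R M G"
  shows "assoc_algebra R (quotient_algebra M (mod_span R M G))"
    and "x \<in> carrier M \<Longrightarrow> y \<in> carrier M \<Longrightarrow>
      (mod_span R M G +>\<^bsub>M\<^esub> x) \<otimes>\<^bsub>quotient_algebra M (mod_span R M G)\<^esub> (mod_span R M G +>\<^bsub>M\<^esub> y) =
      mod_span R M G +>\<^bsub>M\<^esub> (x \<otimes>\<^bsub>M\<^esub> y)"
proof -
  interpret M: assoc_algebra R M by (rule M)
  note MM = M.module_axioms
  let ?I = "mod_span R M G"
  have I: "submodule ?I R M" by (rule mod_span_submodule[OF MM G])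
  note E = M.submoduleE[OF I]
  note left = M.mult_linear(2) and right = M.mult_linear(1)
  have gen: "x \<otimes>\<^bsub>M\<^esub> i \<in> ?I \<and> i \<otimes>\<^bsub>M\<^esub> x \<in> ?I" if "x \<in> X" "i \<in> ?I" for x i
  proof -
    have x: "x \<in> carrier M" using spanned_carrier[OF sp] that by blast
    have "?I \<subseteq> {i \<in> carrier M. x \<otimes>\<^bsub>M\<^esub> i \<in> ?I}"
      by (rule mod_span_least[OF submodule_vimage[OF MM MM right[OF x] I]])
        (use G mult[OF that(1)] in auto)
    moreover have "?I \<subseteq> {i \<in> carrier M. i \<otimes>\<^bsub>M\<^esub> x \<in> ?I}"
      by (rule mod_span_least[OF submodule_vimage[OF MM MM left[OF x] I]])
        (use G mult[OF that(1)] in auto)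
    moreover note that
    ultimately show ?thesis by blast
  qed
  have ideal: "x \<otimes>\<^bsub>M\<^esub> i \<in> ?I \<and> i \<otimes>\<^bsub>M\<^esub> x \<in> ?I" if "x \<in> carrier M" "i \<in> ?I" for x i
  proof -
    have i: "i \<in> carrier M" using E(1) that by blast
    have "x \<in> {x \<in> carrier M. x \<otimes>\<^bsub>M\<^esub> i \<in> ?I}"
      by (rule spannedD[OF sp submodule_vimage[OF MM MM left[OF i] I] _ that(1)])
        (use gen[OF _ that(2)] spanned_carrier[OF sp] in auto)
    moreover have "x \<in> {x \<in> carrier M. i \<otimes>\<^bsub>M\<^esub> x \<in> ?I}"
      by (rule spannedD[OF sp submodule_vimage[OF MM MM right[OF i] I] _ that(1)])
        (use gen[OF _ that(2)] spanned_carrier[OF sp] in auto)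
    ultimately show ?thesis by simp
  qed
  interpret I: ideal ?I M
    by (rule idealI[OF M.ring_axioms submodule.axioms(1)[OF I]]) (use ideal in auto)
  have mult': "(?I +>\<^bsub>M\<^esub> x) \<otimes>\<^bsub>quotient_algebra M ?I\<^esub> (?I +>\<^bsub>M\<^esub> y) = ?I +>\<^bsub>M\<^esub> (x \<otimes>\<^bsub>M\<^esub> y)"
    if "x \<in> carrier M" "y \<in> carrier M" for x y
    using that by (simp add: quotient_algebra_fields I.rcoset_mult_add)
  show "assoc_algebra R (quotient_algebra M ?I)"
    by (rule assoc_algebra_surjective_image[OF M quotient_algebra_fields(1)
          quotient_algebra_zero[OF MM I] quotient_algebra_fields(3) quotient_algebra_add[OF MM I]
          mult' quotient_algebra_smult[OF MM I]])
  show "x \<in> carrier M \<Longrightarrow> y \<in> carrier M \<Longrightarrow>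
    (?I +>\<^bsub>M\<^esub> x) \<otimes>\<^bsub>quotient_algebra M ?I\<^esub> (?I +>\<^bsub>M\<^esub> y) = ?I +>\<^bsub>M\<^esub> (x \<otimes>\<^bsub>M\<^esub> y)"
    by (rule mult')
qed

text \<open>
  The common form of tensor products and tensor algebras.
\<close>
definition presented_algebra ::
  "('k, 'r) ring_scheme \<Rightarrow> ('x, 'g) monoid_scheme \<Rightarrow> ('x \<Rightarrow> 'k) set \<Rightarrow> ('k, ('x \<Rightarrow> 'k) set) module"
  where "presented_algebra R G rels =
    quotient_algebra (monoid_algebra R G) (mod_span R (monoid_algebra R G) rels)"

definition presented_proj ::
  "('k, 'r) ring_scheme \<Rightarrow> ('x, 'g) monoid_scheme \<Rightarrow> ('x \<Rightarrow> 'k) set \<Rightarrow> ('x \<Rightarrow> 'k) \<Rightarrow> ('x \<Rightarrow> 'k) set"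
  where "presented_proj R G rels f = mod_span R (monoid_algebra R G) rels +>\<^bsub>monoid_algebra R G\<^esub> f"

context
  fixes R :: "('k, 'r) ring_scheme" and G :: "('x, 'g) monoid_scheme" and rels
  assumes R: "cring R" and rels: "rels \<subseteq> carrier (monoid_algebra R G)"
begin

lemma presented_submodule:
  "submodule (mod_span R (monoid_algebra R G) rels) R (monoid_algebra R G)"
  by (rule mod_span_submodule[OF cring.monoid_algebra_module[OF R] rels])

lemma presented_module: "module R (presented_algebra R G rels)"
  unfolding presented_algebra_def
  by (rule quotient_algebra_module[OF cring.monoid_algebra_module[OF R] presented_submodule])

lemma presented_proj_linear:
  "presented_proj R G rels \<in> linear_maps R (monoid_algebra R G) (presented_algebra R G rels)"
  unfolding presented_algebra_def presented_proj_def[abs_def]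
  by (rule quotient_algebra_proj_linear[OF cring.monoid_algebra_module[OF R] presented_submodule])

lemma presented_spanned:
  "spanned R (presented_algebra R G rels) ((\<lambda>x. presented_proj R G rels (delta R x)) ` carrier G)"
  using quotient_algebra_spanned[OF cring.monoid_algebra_module[OF R] presented_submodule
      cring.monoid_algebra_spanned[OF R]]
  unfolding presented_algebra_def presented_proj_def[abs_def] image_image .

lemma presented_proj_eqI:
  assumes "f \<in> carrier (monoid_algebra R G)" "g \<in> carrier (monoid_algebra R G)"
    and "f \<ominus>\<^bsub>monoid_algebra R G\<^esub> g \<in> rels"
  shows "presented_proj R G rels f = presented_proj R G rels g"
  unfolding presented_proj_def
  using quotient_algebra_eq_iff[OF cring.monoid_algebra_module[OF R] presented_submodule assms(1,2)]
    mod_span_superset[of rels R "monoid_algebra R G"] assms(3) by blast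

lemma presented_lift:
  assumes N: "module R N" and \<phi>: "\<phi> \<in> carrier G \<rightarrow> carrier N"
    and kill: "\<And>f. f \<in> rels \<Longrightarrow> free_lift R N \<phi> f = \<zero>\<^bsub>N\<^esub>"
  shows "\<exists>\<psi>\<in>linear_maps R (presented_algebra R G rels) N.
    \<forall>x\<in>carrier G. \<psi> (presented_proj R G rels (delta R x)) = \<phi> x"
proof -
  interpret R: cring R by (rule R)
  interpret N: module R N by (rule N)
  obtain \<psi> where \<psi>: "\<psi> \<in> linear_maps R (presented_algebra R G rels) N"
    "\<And>f. f \<in> carrier (monoid_algebra R G) \<Longrightarrow> \<psi> (presented_proj R G rels f) = free_lift R N \<phi> f"
    using quotient_algebra_lift[OF R.monoid_algebra_module N rels N.free_lift_linear[OF \<phi>] kill]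
    unfolding presented_algebra_def presented_proj_def by blast
  have "\<psi> (presented_proj R G rels (delta R x)) = \<phi> x" if "x \<in> carrier G" for x
    using that \<phi> by (subst \<psi>(2)) (auto simp: R.delta_closed intro!: N.free_lift_delta)
  then show ?thesis using \<psi>(1) by blast
qed

text \<open>
  Modulo the relations, multiplying \<open>f\<close> by a basis element is the linear lift of a translation. So the
  relations span an ideal if these lifts kill them. For bilinear and for multilinear relations this
  only asks that a translate of the universal map is again bilinear or multilinear.
\<close>
lemma presented_assoc_algebra:
  assumes G: "Group.monoid G"
    and kill: "\<And>x f. x \<in> carrier G \<Longrightarrow> f \<in> rels \<Longrightarrow>
      free_lift R (presented_algebra R G rels) (\<lambda>y. presented_proj R G rels (delta R (x \<otimes>\<^bsub>G\<^esub> y))) f =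
        \<zero>\<^bsub>presented_algebra R G rels\<^esub> \<and>
      free_lift R (presented_algebra R G rels) (\<lambda>y. presented_proj R G rels (delta R (y \<otimes>\<^bsub>G\<^esub> x))) f =
        \<zero>\<^bsub>presented_algebra R G rels\<^esub>"
  shows "assoc_algebra R (presented_algebra R G rels)"
    and "x \<in> carrier G \<Longrightarrow> y \<in> carrier G \<Longrightarrow>
      presented_proj R G rels (delta R x) \<otimes>\<^bsub>presented_algebra R G rels\<^esub> presented_proj R G rels (delta R y)
      = presented_proj R G rels (delta R (x \<otimes>\<^bsub>G\<^esub> y))"
    and "\<one>\<^bsub>presented_algebra R G rels\<^esub> = presented_proj R G rels (delta R \<one>\<^bsub>G\<^esub>)"
proof -
  interpret R: cring R by (rule R)
  interpret G: Group.monoid G by (rule G)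
  let ?F = "monoid_algebra R G" and ?P = "presented_algebra R G rels" and ?p = "presented_proj R G rels"
  interpret F: assoc_algebra R ?F by (rule R.monoid_algebra_assoc_algebra[OF G])
  interpret P: module R ?P by (rule presented_module)
  note p = presented_proj_linear and d = R.delta_closed
  have span: "f \<in> mod_span R ?F rels" if f: "f \<in> carrier ?F" and 0: "?p f = \<zero>\<^bsub>?P\<^esub>" for f
  proof -
    have "?p f = ?p \<zero>\<^bsub>?F\<^esub>" using 0 linear_maps_zero[OF F.module_axioms P.module_axioms p] by simp
    then have "f \<ominus>\<^bsub>?F\<^esub> \<zero>\<^bsub>?F\<^esub> \<in> mod_span R ?F rels"
      unfolding presented_proj_def
      using quotient_algebra_eq_iff[OF F.module_axioms presented_submodule f F.zero_closed] by blast
    then show ?thesis using f by (simp add: F.minus_eq del: monoid_algebra_ops)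
  qed
  have m: "x \<otimes>\<^bsub>?F\<^esub> g \<in> mod_span R ?F rels \<and> g \<otimes>\<^bsub>?F\<^esub> x \<in> mod_span R ?F rels"
    if "x \<in> delta R ` carrier G" "g \<in> rels" for x g
  proof -
    obtain y where y: "x = delta R y" "y \<in> carrier G" using \<open>x \<in> _\<close> by blast
    have g: "g \<in> carrier ?F" using \<open>g \<in> rels\<close> rels by blast
    have x: "x \<in> carrier ?F" unfolding y(1) by (rule d[OF y(2)])
    have pi: "(\<lambda>z. ?p (delta R (y \<otimes>\<^bsub>G\<^esub> z))) \<in> carrier G \<rightarrow> carrier ?P"
      "(\<lambda>z. ?p (delta R (z \<otimes>\<^bsub>G\<^esub> y))) \<in> carrier G \<rightarrow> carrier ?P"
      using y(2) by (auto intro!: linear_maps_closed[OF p] d)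
    have "?p (x \<otimes>\<^bsub>?F\<^esub> g) = free_lift R ?P (\<lambda>z. ?p (delta R (y \<otimes>\<^bsub>G\<^esub> z))) g"
      by (rule linear_maps_eq_on_spanned[OF F.module_axioms P.module_axioms
            linear_maps_compose[OF R.monoid_algebra_mult_right_linear[OF G x] p]
            P.free_lift_linear[OF pi(1)] R.monoid_algebra_spanned _ g])
        (elim imageE, use y pi in \<open>simp add: R.delta_mult Pi_def P.free_lift_delta\<close>)
    moreover have "?p (g \<otimes>\<^bsub>?F\<^esub> x) = free_lift R ?P (\<lambda>z. ?p (delta R (z \<otimes>\<^bsub>G\<^esub> y))) g"
      by (rule linear_maps_eq_on_spanned[OF F.module_axioms P.module_axioms
            linear_maps_compose[OF R.monoid_algebra_mult_left_linear[OF G x] p]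
            P.free_lift_linear[OF pi(2)] R.monoid_algebra_spanned _ g])
        (elim imageE, use y pi in \<open>simp add: R.delta_mult Pi_def P.free_lift_delta\<close>)
    ultimately show ?thesis
      using kill[OF y(2) \<open>g \<in> rels\<close>] x g by (intro conjI span F.m_closed) simp_all
  qed
  note * = quotient_algebra_assoc_algebra[OF R.monoid_algebra_assoc_algebra[OF G]
      R.monoid_algebra_spanned rels]
  show "assoc_algebra R ?P"
    unfolding presented_algebra_def by (rule *(1)) (rule m)
  show "?p (delta R x) \<otimes>\<^bsub>?P\<^esub> ?p (delta R y) = ?p (delta R (x \<otimes>\<^bsub>G\<^esub> y))"
    if "x \<in> carrier G" "y \<in> carrier G"
    unfolding presented_algebra_def presented_proj_def
    by (subst *(2)) (use m that in \<open>simp_all add: d R.delta_mult\<close>)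
  show "\<one>\<^bsub>?P\<^esub> = ?p (delta R \<one>\<^bsub>G\<^esub>)"
    by (simp add: presented_algebra_def presented_proj_def quotient_algebra_fields monoid_algebra_one)
qed

end


section \<open>Tensor products\<close>

definition bilinear ::
  "('k, 'r) ring_scheme \<Rightarrow> ('k, 'v, 'm) module_scheme \<Rightarrow> ('k, 'w, 'n) module_scheme \<Rightarrow>
   ('k, 'u, 'p) module_scheme \<Rightarrow> ('v \<Rightarrow> 'w \<Rightarrow> 'u) \<Rightarrow> bool"
  where "bilinear R M N P \<phi> \<longleftrightarrow>
    (\<forall>y\<in>carrier N. (\<lambda>x. \<phi> x y) \<in> linear_maps R M P) \<and> (\<forall>x\<in>carrier M. \<phi> x \<in> linear_maps R N P)"

lemma bilinearI:
  assumes "\<And>y. y \<in> carrier N \<Longrightarrow> (\<lambda>x. \<phi> x y) \<in> linear_maps R M P"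
    and "\<And>x. x \<in> carrier M \<Longrightarrow> (\<lambda>y. \<phi> x y) \<in> linear_maps R N P"
  shows "bilinear R M N P \<phi>"
  using assms by (auto simp: bilinear_def)

lemma bilinearD:
  assumes "bilinear R M N P \<phi>"
  shows "y \<in> carrier N \<Longrightarrow> (\<lambda>x. \<phi> x y) \<in> linear_maps R M P"
    and "x \<in> carrier M \<Longrightarrow> (\<lambda>y. \<phi> x y) \<in> linear_maps R N P"
  using assms by (auto simp: bilinear_def)

lemma bilinear_rels_add1: "\<lbrakk>x \<in> carrier M; x' \<in> carrier M; y \<in> carrier N\<rbrakk> \<Longrightarrow>
      delta R (x \<oplus>\<^bsub>M\<^esub> x', y) \<ominus>\<^bsub>monoid_algebra R (M \<times>\<times> N)\<^esub>
        (delta R (x, y) \<oplus>\<^bsub>monoid_algebra R (M \<times>\<times> N)\<^esub> delta R (x', y)) \<in> bilinear_rels R M N"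
  and bilinear_rels_add2: "\<lbrakk>x \<in> carrier M; y \<in> carrier N; y' \<in> carrier N\<rbrakk> \<Longrightarrow>
      delta R (x, y \<oplus>\<^bsub>N\<^esub> y') \<ominus>\<^bsub>monoid_algebra R (M \<times>\<times> N)\<^esub>
        (delta R (x, y) \<oplus>\<^bsub>monoid_algebra R (M \<times>\<times> N)\<^esub> delta R (x, y')) \<in> bilinear_rels R M N"
  and bilinear_rels_smult1: "\<lbrakk>a \<in> carrier R; x \<in> carrier M; y \<in> carrier N\<rbrakk> \<Longrightarrow>
      delta R (a \<odot>\<^bsub>M\<^esub> x, y) \<ominus>\<^bsub>monoid_algebra R (M \<times>\<times> N)\<^esub>
        a \<odot>\<^bsub>monoid_algebra R (M \<times>\<times> N)\<^esub> delta R (x, y) \<in> bilinear_rels R M N"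
  and bilinear_rels_smult2: "\<lbrakk>a \<in> carrier R; x \<in> carrier M; y \<in> carrier N\<rbrakk> \<Longrightarrow>
      delta R (x, a \<odot>\<^bsub>N\<^esub> y) \<ominus>\<^bsub>monoid_algebra R (M \<times>\<times> N)\<^esub>
        a \<odot>\<^bsub>monoid_algebra R (M \<times>\<times> N)\<^esub> delta R (x, y) \<in> bilinear_rels R M N"
  unfolding bilinear_rels_def Let_def by blast+

lemma bilinear_rels_cases:
  assumes "f \<in> bilinear_rels R M N"
  obtains
    (add1) x x' y where "x \<in> carrier M" "x' \<in> carrier M" "y \<in> carrier N"
      "f = delta R (x \<oplus>\<^bsub>M\<^esub> x', y) \<ominus>\<^bsub>monoid_algebra R (M \<times>\<times> N)\<^esub>
        (delta R (x, y) \<oplus>\<^bsub>monoid_algebra R (M \<times>\<times> N)\<^esub> delta R (x', y))"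
  | (add2) x y y' where "x \<in> carrier M" "y \<in> carrier N" "y' \<in> carrier N"
      "f = delta R (x, y \<oplus>\<^bsub>N\<^esub> y') \<ominus>\<^bsub>monoid_algebra R (M \<times>\<times> N)\<^esub>
        (delta R (x, y) \<oplus>\<^bsub>monoid_algebra R (M \<times>\<times> N)\<^esub> delta R (x, y'))"
  | (smult1) a x y where "a \<in> carrier R" "x \<in> carrier M" "y \<in> carrier N"
      "f = delta R (a \<odot>\<^bsub>M\<^esub> x, y) \<ominus>\<^bsub>monoid_algebra R (M \<times>\<times> N)\<^esub>
        a \<odot>\<^bsub>monoid_algebra R (M \<times>\<times> N)\<^esub> delta R (x, y)"
  | (smult2) a x y where "a \<in> carrier R" "x \<in> carrier M" "y \<in> carrier N"
      "f = delta R (x, a \<odot>\<^bsub>N\<^esub> y) \<ominus>\<^bsub>monoid_algebra R (M \<times>\<times> N)\<^esub>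
        a \<odot>\<^bsub>monoid_algebra R (M \<times>\<times> N)\<^esub> delta R (x, y)"
  using assms unfolding bilinear_rels_def Let_def by blast

lemma tensor_presented: "tensor R M N = presented_algebra R (M \<times>\<times> N) (bilinear_rels R M N)"
  by (simp add: tensor_def presented_algebra_def Let_def)

lemma tens_presented: "tens R M N x y = presented_proj R (M \<times>\<times> N) (bilinear_rels R M N) (delta R (x, y))"
  by (simp add: tens_def presented_proj_def Let_def)

context
  fixes R :: "('k, 'r) ring_scheme" and M :: "('k, 'v, 'm) module_scheme"
    and N :: "('k, 'w, 'n) module_scheme"
  assumes M: "module R M" and N: "module R N"
begin

interpretation M: module R M by (rule M)
interpretation N: module R N by (rule N)
interpretation F: module R "monoid_algebra R (M \<times>\<times> N)" by (rule M.R.monoid_algebra_module)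

private lemma delta_pair:
  "x \<in> carrier M \<Longrightarrow> y \<in> carrier N \<Longrightarrow> delta R (x, y) \<in> carrier (monoid_algebra R (M \<times>\<times> N))"
  by (rule M.R.delta_closed) (simp add: DirProd_def)

lemma bilinear_rels_carrier: "bilinear_rels R M N \<subseteq> carrier (monoid_algebra R (M \<times>\<times> N))"
proof
  fix f assume "f \<in> bilinear_rels R M N"
  then show "f \<in> carrier (monoid_algebra R (M \<times>\<times> N))"
    by (cases rule: bilinear_rels_cases)
      (simp_all add: delta_pair del: monoid_algebra_ops)
qed

lemma tensor_module: "module R (tensor R M N)"
  unfolding tensor_presented by (rule presented_module[OF M.R.is_cring bilinear_rels_carrier])

lemma tensor_spanned: "spanned R (tensor R M N) ((\<lambda>(x, y). tens R M N x y) ` (carrier M \<times> carrier N))"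
proof -
  have "(\<lambda>(x, y). tens R M N x y) ` (carrier M \<times> carrier N) =
    (\<lambda>x. presented_proj R (M \<times>\<times> N) (bilinear_rels R M N) (delta R x)) ` carrier (M \<times>\<times> N)"
    by (auto simp: tens_presented DirProd_def image_iff)
  then show ?thesis
    unfolding tensor_presented using presented_spanned[OF M.R.is_cring bilinear_rels_carrier] by simp
qed

lemma tens_bilinear: "bilinear R M N (tensor R M N) (tens R M N)"
proof -
  let ?p = "presented_proj R (M \<times>\<times> N) (bilinear_rels R M N)"
  have p: "?p \<in> linear_maps R (monoid_algebra R (M \<times>\<times> N)) (tensor R M N)"
    unfolding tensor_presented by (rule presented_proj_linear[OF M.R.is_cring bilinear_rels_carrier])
  note eqI = presented_proj_eqI[OF M.R.is_cring bilinear_rels_carrier]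
  note [simp del] = monoid_algebra_ops
  have cl: "tens R M N x y \<in> carrier (tensor R M N)" if "x \<in> carrier M" "y \<in> carrier N" for x y
    unfolding tens_presented by (rule linear_maps_closed[OF p delta_pair[OF that]])
  have "tens R M N (x \<oplus>\<^bsub>M\<^esub> x') y = tens R M N x y \<oplus>\<^bsub>tensor R M N\<^esub> tens R M N x' y"
    if "x \<in> carrier M" "x' \<in> carrier M" "y \<in> carrier N" for x x' y
    unfolding tens_presented
    by (subst linear_maps_add[OF p, symmetric])
      (use that in \<open>simp_all add: delta_pair eqI[OF _ _ bilinear_rels_add1]\<close>)
  moreover have "tens R M N x (y \<oplus>\<^bsub>N\<^esub> y') = tens R M N x y \<oplus>\<^bsub>tensor R M N\<^esub> tens R M N x y'"
    if "x \<in> carrier M" "y \<in> carrier N" "y' \<in> carrier N" for x y y'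
    unfolding tens_presented
    by (subst linear_maps_add[OF p, symmetric])
      (use that in \<open>simp_all add: delta_pair eqI[OF _ _ bilinear_rels_add2]\<close>)
  moreover have "tens R M N (a \<odot>\<^bsub>M\<^esub> x) y = a \<odot>\<^bsub>tensor R M N\<^esub> tens R M N x y"
    if "a \<in> carrier R" "x \<in> carrier M" "y \<in> carrier N" for a x y
    unfolding tens_presented
    by (subst linear_maps_smult[OF p, symmetric])
      (use that in \<open>simp_all add: delta_pair eqI[OF _ _ bilinear_rels_smult1]\<close>)
  moreover have "tens R M N x (a \<odot>\<^bsub>N\<^esub> y) = a \<odot>\<^bsub>tensor R M N\<^esub> tens R M N x y"
    if "a \<in> carrier R" "x \<in> carrier M" "y \<in> carrier N" for a x y
    unfolding tens_presented
    by (subst linear_maps_smult[OF p, symmetric])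
      (use that in \<open>simp_all add: delta_pair eqI[OF _ _ bilinear_rels_smult2]\<close>)
  ultimately show ?thesis by (intro bilinearI linear_mapsI) (auto simp: cl)
qed

lemma tens_closed: "x \<in> carrier M \<Longrightarrow> y \<in> carrier N \<Longrightarrow> tens R M N x y \<in> carrier (tensor R M N)"
  using linear_maps_closed[OF bilinearD(1)[OF tens_bilinear]] by blast

lemma free_lift_bilinear_rels:
  assumes P: "module R P" and \<phi>: "bilinear R M N P \<phi>" and f: "f \<in> bilinear_rels R M N"
  shows "free_lift R P (\<lambda>(x, y). \<phi> x y) f = \<zero>\<^bsub>P\<^esub>"
proof -
  interpret P: module R P by (rule P)
  let ?\<phi> = "\<lambda>(x, y). \<phi> x y"
  have cl: "\<phi> x y \<in> carrier P" if "x \<in> carrier M" "y \<in> carrier N" for x y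
    using linear_maps_closed[OF bilinearD(1)[OF \<phi>]] that by blast
  then have L: "free_lift R P ?\<phi> \<in> linear_maps R (monoid_algebra R (M \<times>\<times> N)) P"
    by (intro P.free_lift_linear) (auto simp: DirProd_def)
  have d: "free_lift R P ?\<phi> (delta R (x, y)) = \<phi> x y" if "x \<in> carrier M" "y \<in> carrier N" for x y
    using P.free_lift_delta[of ?\<phi> "(x, y)"] cl[OF that] by simp
  note [simp del] = monoid_algebra_ops
  note rules = linear_maps_minus[OF F.module_axioms P L] linear_maps_add[OF L] linear_maps_smult[OF L]
    delta_pair d cl linear_maps_add[OF bilinearD(1)[OF \<phi>]] linear_maps_add[OF bilinearD(2)[OF \<phi>]]
    linear_maps_smult[OF bilinearD(1)[OF \<phi>]] linear_maps_smult[OF bilinearD(2)[OF \<phi>]]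
  from f show ?thesis
    by (cases rule: bilinear_rels_cases) (simp_all add: rules a_minus_def[of P] P.r_neg)
qed

lemma tensor_lift:
  assumes P: "module R P" and \<phi>: "bilinear R M N P \<phi>"
  shows "\<exists>\<psi>\<in>linear_maps R (tensor R M N) P.
    \<forall>x\<in>carrier M. \<forall>y\<in>carrier N. \<psi> (tens R M N x y) = \<phi> x y"
proof -
  have pi: "(\<lambda>(x, y). \<phi> x y) \<in> carrier (M \<times>\<times> N) \<rightarrow> carrier P"
    using linear_maps_closed[OF bilinearD(1)[OF \<phi>]] by (auto simp: DirProd_def)
  from presented_lift[OF M.R.is_cring bilinear_rels_carrier P pi free_lift_bilinear_rels[OF P \<phi>]]
  show ?thesis unfolding tensor_presented tens_presented by (fastforce simp: DirProd_def)
qed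

lemma tensor_spanned_by:
  assumes X: "spanned R M X" and Y: "spanned R N Y"
  shows "spanned R (tensor R M N) ((\<lambda>(x, y). tens R M N x y) ` (X \<times> Y))"
    (is "spanned R _ ?G")
proof (rule spanned_trans[OF tensor_module tensor_spanned])
  have XY: "X \<subseteq> carrier M" "Y \<subseteq> carrier N" using X Y by (auto simp: spanned_def)
  show G: "?G \<subseteq> carrier (tensor R M N)" using XY by (auto intro!: tens_closed)
  note S = mod_span_submodule[OF tensor_module G]
  have 1: "tens R M N x y \<in> mod_span R (tensor R M N) ?G" if "x \<in> X" "y \<in> carrier N" for x y
  proof -
    have x: "x \<in> carrier M" using that XY by blast
    show ?thesis
      using spannedD[OF Y submodule_vimage[OF N tensor_module bilinearD(2)[OF tens_bilinear x] S] _ that(2)]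
        mod_span_superset[of ?G R "tensor R M N"] XY that(1) by blast
  qed
  have 2: "tens R M N x y \<in> mod_span R (tensor R M N) ?G" if "x \<in> carrier M" "y \<in> carrier N" for x y
    using spannedD[OF X submodule_vimage[OF M tensor_module bilinearD(1)[OF tens_bilinear that(2)] S] _ that(1)]
      1[OF _ that(2)] XY by blast
  then show "(\<lambda>(x, y). tens R M N x y) ` (carrier M \<times> carrier N) \<subseteq> mod_span R (tensor R M N) ?G"
    by auto
qed

lemma tensor_sub_module:
  assumes "U \<subseteq> carrier M" "V \<subseteq> carrier N"
  shows "module R (tensor_sub R M N U V)"
    and "spanned R (tensor_sub R M N U V) ((\<lambda>(u, v). tens R M N u v) ` (U \<times> V))"
    and "carrier (tensor_sub R M N U V) \<subseteq> carrier (tensor R M N)"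
proof -
  have eq: "{tens R M N u v | u v. u \<in> U \<and> v \<in> V} = (\<lambda>(u, v). tens R M N u v) ` (U \<times> V)" by auto
  have sub: "(\<lambda>(u, v). tens R M N u v) ` (U \<times> V) \<subseteq> carrier (tensor R M N)"
    using assms by (auto intro!: tens_closed)
  show "module R (tensor_sub R M N U V)"
    unfolding tensor_sub_def eq by (rule module_mod_span[OF tensor_module sub])
  show "spanned R (tensor_sub R M N U V) ((\<lambda>(u, v). tens R M N u v) ` (U \<times> V))"
    unfolding tensor_sub_def eq by (rule spanned_mod_span[OF tensor_module sub])
  show "carrier (tensor_sub R M N U V) \<subseteq> carrier (tensor R M N)"
    using module.submoduleE(1)[OF tensor_module mod_span_submodule[OF tensor_module sub]]
    unfolding tensor_sub_def eq by simp
qed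

text \<open>
  The tensors of all pairs span, so maps on the whole tensor product are a special case of maps
  on a tensor product of subspaces.
\<close>
lemma tensor_sub_full: "tensor_sub R M N (carrier M) (carrier N) = tensor R M N"
proof -
  note S = tensor_sub_module[OF order_refl order_refl]
  have "carrier (tensor R M N) \<subseteq> carrier (tensor_sub R M N (carrier M) (carrier N))"
  proof -
    have eq: "{tens R M N u v | u v. u \<in> carrier M \<and> v \<in> carrier N} =
      (\<lambda>(u, v). tens R M N u v) ` (carrier M \<times> carrier N)" by auto
    have "(\<lambda>(u, v). tens R M N u v) ` (carrier M \<times> carrier N) \<subseteq> carrier (tensor R M N)"
      by (auto intro!: tens_closed)
    then show ?thesis
      using spannedD[OF tensor_spanned mod_span_submodule[OF tensor_module] mod_span_superset]
      unfolding tensor_sub_def eq by auto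
  qed
  with S(3) have "carrier (tensor_sub R M N (carrier M) (carrier N)) = carrier (tensor R M N)" by blast
  then show ?thesis by (simp add: tensor_sub_def)
qed

lemma tensor_map_eq:
  assumes N': "module R (tensor R M' N')" and UV: "U \<subseteq> carrier M" "V \<subseteq> carrier N"
    and h: "h \<in> linear_maps R (tensor R M N) (tensor R M' N')"
    and val: "\<And>u v. u \<in> U \<Longrightarrow> v \<in> V \<Longrightarrow> h (tens R M N u v) = tens R M' N' (f u) (g v)"
    and t: "t \<in> carrier (tensor_sub R M N U V)"
  shows "tensor_map R M N U V M' N' f g t = h t"
  unfolding tensor_map_def
proof (rule linear_extension_eq[OF tensor_sub_module(1)[OF UV] N' tensor_sub_module(2)[OF UV] _ _ t])
  show "h \<in> linear_maps R (tensor_sub R M N U V) (tensor R M' N')"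
    using linear_maps_submodule_domain[OF h tensor_sub_module(3)[OF UV]]
    unfolding tensor_sub_def by simp
qed (use val in auto)

end

lemma tensor_map_lift:
  assumes "module R M" "module R N" "module R M'" "module R N'"
    and f: "f \<in> linear_maps R M M'" and g: "g \<in> linear_maps R N N'"
  shows "\<exists>h\<in>linear_maps R (tensor R M N) (tensor R M' N').
    \<forall>x\<in>carrier M. \<forall>y\<in>carrier N. h (tens R M N x y) = tens R M' N' (f x) (g y)"
proof (rule tensor_lift[OF assms(1,2) tensor_module[OF assms(3,4)]])
  note B = tens_bilinear[OF assms(3,4)]
  show "bilinear R M N (tensor R M' N') (\<lambda>x y. tens R M' N' (f x) (g y))"
    by (intro bilinearI linear_maps_compose[OF f bilinearD(1)[OF B]]
        linear_maps_compose[OF g bilinearD(2)[OF B]] linear_maps_closed[OF f] linear_maps_closed[OF g])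
qed

abbreviation tensor_map_full ::
  "('k, 'r) ring_scheme \<Rightarrow> ('k, 'v, 'm) module_scheme \<Rightarrow> ('k, 'w, 'n) module_scheme \<Rightarrow>
   ('k, 'v2, 'm2) module_scheme \<Rightarrow> ('k, 'w2, 'n2) module_scheme \<Rightarrow>
   ('v \<Rightarrow> 'v2) \<Rightarrow> ('w \<Rightarrow> 'w2) \<Rightarrow> ('v \<times> 'w \<Rightarrow> 'k) set \<Rightarrow> ('v2 \<times> 'w2 \<Rightarrow> 'k) set"
  where "tensor_map_full R M N \<equiv> tensor_map R M N (carrier M) (carrier N)"

lemma tensor_map_full:
  assumes "module R M" "module R N" "module R M'" "module R N'"
    and f: "f \<in> linear_maps R M M'" and g: "g \<in> linear_maps R N N'"
  shows tensor_map_full_linear: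
      "tensor_map_full R M N M' N' f g \<in> linear_maps R (tensor R M N) (tensor R M' N')"
    and tensor_map_full_tens: "x \<in> carrier M \<Longrightarrow> y \<in> carrier N \<Longrightarrow>
      tensor_map_full R M N M' N' f g (tens R M N x y) = tens R M' N' (f x) (g y)"
proof -
  obtain h where h: "h \<in> linear_maps R (tensor R M N) (tensor R M' N')"
    "\<And>x y. x \<in> carrier M \<Longrightarrow> y \<in> carrier N \<Longrightarrow> h (tens R M N x y) = tens R M' N' (f x) (g y)"
    using tensor_map_lift[OF assms] by blast
  have eq: "tensor_map_full R M N M' N' f g t = h t" if "t \<in> carrier (tensor R M N)" for t
    using tensor_map_eq[OF assms(1,2) tensor_module[OF assms(3,4)] order_refl order_refl h] that
    by (simp add: tensor_sub_full[OF assms(1,2)])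
  show "tensor_map_full R M N M' N' f g \<in> linear_maps R (tensor R M N) (tensor R M' N')"
    by (rule iffD2[OF linear_maps_cong[OF tensor_module[OF assms(1,2)] eq] h(1)])
  show "x \<in> carrier M \<Longrightarrow> y \<in> carrier N \<Longrightarrow>
      tensor_map_full R M N M' N' f g (tens R M N x y) = tens R M' N' (f x) (g y)"
    using h(2) by (simp add: eq tens_closed[OF assms(1,2)])
qed

text \<open>
  A map given only on \<open>U \<otimes> V\<close> is computed by any global map that agrees with it there: this replaces
  the injectivity of \<open>U \<otimes> V \<rightarrow> M \<otimes> N\<close>.
\<close>
lemma tensor_map_restrict:
  assumes "module R M" "module R N" "module R M'" "module R N'"
    and "f \<in> linear_maps R M M'" and "g \<in> linear_maps R N N'"
    and UV: "U \<subseteq> carrier M" "V \<subseteq> carrier N"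
    and "\<And>u. u \<in> U \<Longrightarrow> f' u = f u" "\<And>v. v \<in> V \<Longrightarrow> g' v = g v"
    and "t \<in> carrier (tensor_sub R M N U V)"
  shows "tensor_map R M N U V M' N' f' g' t = tensor_map_full R M N M' N' f g t"
  by (rule tensor_map_eq[OF assms(1,2) tensor_module[OF assms(3,4)] UV tensor_map_full_linear[OF assms(1-6)]
      _ assms(11)])
    (use tensor_map_full_tens[OF assms(1-6)] UV assms(9,10) in auto)

text \<open>
  For fixed \<open>z\<close> the map \<open>x \<otimes> y \<mapsto> x \<otimes> (y \<otimes> z)\<close> exists by bilinearity. It depends linearly on \<open>z\<close>, because
  it does so on the tensors \<open>x \<otimes> y\<close>; a second application of the universal property gives the
  associativity map.
\<close>
lemma tensor_assoc:
  assumes M: "module R M"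
  shows tensor_assoc_linear: "tensor_assoc R M \<in>
      linear_maps R (tensor R (tensor R M M) M) (tensor R M (tensor R M M))"
    and tensor_assoc_tens: "x \<in> carrier M \<Longrightarrow> y \<in> carrier M \<Longrightarrow> z \<in> carrier M \<Longrightarrow>
      tensor_assoc R M (tens R (tensor R M M) M (tens R M M x y) z) =
      tens R M (tensor R M M) x (tens R M M y z)"
proof -
  let ?MM = "tensor R M M" and ?P = "tensor R M (tensor R M M)"
  note MM = tensor_module[OF M M]
  note P = tensor_module[OF M MM]
  note B = tens_bilinear[OF M M] and BP = tens_bilinear[OF M MM]
  have "\<exists>L. \<forall>z\<in>carrier M. L z \<in> linear_maps R ?MM ?P \<and>
    (\<forall>x\<in>carrier M. \<forall>y\<in>carrier M. L z (tens R M M x y) = tens R M ?MM x (tens R M M y z))"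
  proof (intro bchoice ballI)
    fix z assume z: "z \<in> carrier M"
    have "bilinear R M M ?P (\<lambda>x y. tens R M ?MM x (tens R M M y z))"
      by (intro bilinearI bilinearD(1)[OF BP] linear_maps_compose[OF bilinearD(1)[OF B z] bilinearD(2)[OF BP]]
          tens_closed[OF M M] z)
    from tensor_lift[OF M M P this] show "\<exists>L. L \<in> linear_maps R ?MM ?P \<and>
      (\<forall>x\<in>carrier M. \<forall>y\<in>carrier M. L (tens R M M x y) = tens R M ?MM x (tens R M M y z))"
      by blast
  qed
  then obtain L where L: "\<And>z. z \<in> carrier M \<Longrightarrow> L z \<in> linear_maps R ?MM ?P"
    "\<And>x y z. x \<in> carrier M \<Longrightarrow> y \<in> carrier M \<Longrightarrow> z \<in> carrier M \<Longrightarrow>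
      L z (tens R M M x y) = tens R M ?MM x (tens R M M y z)"
    by blast
  interpret M: module R M by (rule M)
  have "bilinear R ?MM M ?P (\<lambda>t z. L z t)"
  proof (intro bilinearI)
    fix t assume t: "t \<in> carrier ?MM"
    show "(\<lambda>z. L z t) \<in> linear_maps R M ?P"
    proof (rule linear_mapsI)
      fix z assume z: "z \<in> carrier M"
      show "L z t \<in> carrier ?P" by (rule linear_maps_closed[OF L(1)[OF z] t])
      {
        fix a assume a: "a \<in> carrier R"
        have az: "a \<odot>\<^bsub>M\<^esub> z \<in> carrier M" using a z by simp
        show "L (a \<odot>\<^bsub>M\<^esub> z) t = a \<odot>\<^bsub>?P\<^esub> L z t"
          by (rule linear_maps_eq_on_spanned[OF MM P L(1)[OF az] linear_maps_smult_fun[OF P L(1)[OF z] a]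
                tensor_spanned[OF M M] _ t])
            (use a z az in \<open>auto simp: L linear_maps_smult[OF bilinearD(2)[OF B]]
               linear_maps_smult[OF bilinearD(2)[OF BP]] tens_closed[OF M M]\<close>)
      }
      fix z' assume z': "z' \<in> carrier M"
      have zz: "z \<oplus>\<^bsub>M\<^esub> z' \<in> carrier M" using z z' by simp
      show "L (z \<oplus>\<^bsub>M\<^esub> z') t = L z t \<oplus>\<^bsub>?P\<^esub> L z' t"
        by (rule linear_maps_eq_on_spanned[OF MM P L(1)[OF zz] linear_maps_add_fun[OF P L(1)[OF z] L(1)[OF z']]
              tensor_spanned[OF M M] _ t])
          (use z z' zz in \<open>auto simp: L linear_maps_add[OF bilinearD(2)[OF B]]
             linear_maps_add[OF bilinearD(2)[OF BP]] tens_closed[OF M M]\<close>)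
    qed
  qed (use L in auto)
  from tensor_lift[OF MM M P this] obtain h where h: "h \<in> linear_maps R (tensor R ?MM M) ?P"
    and hv: "\<And>x y z. x \<in> carrier M \<Longrightarrow> y \<in> carrier M \<Longrightarrow> z \<in> carrier M \<Longrightarrow>
      h (tens R ?MM M (tens R M M x y) z) = tens R M ?MM x (tens R M M y z)"
    using L(2) tens_closed[OF M M] by auto
  note MMM = tensor_module[OF MM M]
  have sp: "spanned R (tensor R ?MM M)
    ((\<lambda>(x, y, z). tens R ?MM M (tens R M M x y) z) ` (carrier M \<times> carrier M \<times> carrier M))"
  proof -
    have "spanned R M (carrier M)" by (auto simp: spanned_def)
    from tensor_spanned_by[OF MM M tensor_spanned[OF M M] this] show ?thesis
      by (rule back_subst[of "spanned R (tensor R ?MM M)"]) (auto simp: image_def)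
  qed
  have eq: "tensor_assoc R M t = h t" if "t \<in> carrier (tensor R ?MM M)" for t
    unfolding tensor_assoc_def
    by (rule linear_extension_eq[OF MMM P sp h _ that]) (auto simp: hv)
  show "tensor_assoc R M \<in> linear_maps R (tensor R ?MM M) ?P"
    by (rule iffD2[OF linear_maps_cong[OF MMM eq] h])
  show "x \<in> carrier M \<Longrightarrow> y \<in> carrier M \<Longrightarrow> z \<in> carrier M \<Longrightarrow>
      tensor_assoc R M (tens R (tensor R M M) M (tens R M M x y) z) =
      tens R M (tensor R M M) x (tens R M M y z)"
    by (subst eq) (auto simp: hv tens_closed[OF M M] tens_closed[OF MM M])
qed

lemma tensor_assoc_algebra:
  assumes M: "assoc_algebra R M" and N: "assoc_algebra R N"
  shows "assoc_algebra R (tensor R M N)"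
    and tens_mult: "\<lbrakk>x \<in> carrier M; y \<in> carrier N; x' \<in> carrier M; y' \<in> carrier N\<rbrakk> \<Longrightarrow>
      tens R M N x y \<otimes>\<^bsub>tensor R M N\<^esub> tens R M N x' y' =
      tens R M N (x \<otimes>\<^bsub>M\<^esub> x') (y \<otimes>\<^bsub>N\<^esub> y')"
    and tensor_one: "\<one>\<^bsub>tensor R M N\<^esub> = tens R M N \<one>\<^bsub>M\<^esub> \<one>\<^bsub>N\<^esub>"
proof -
  interpret M: assoc_algebra R M by (rule M)
  interpret N: assoc_algebra R N by (rule N)
  let ?G = "M \<times>\<times> N" and ?p = "presented_proj R (M \<times>\<times> N) (bilinear_rels R M N)"
  note modules = M.module_axioms N.module_axioms
  note T = tensor_module[OF modules] and B = tens_bilinear[OF modules]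
  have G: "Group.monoid ?G"
    by (rule DirProd_monoid[OF M.monoid_axioms N.monoid_axioms])
  have kill: "free_lift R (tensor R M N) (\<lambda>y. ?p (delta R (x \<otimes>\<^bsub>?G\<^esub> y))) f = \<zero>\<^bsub>tensor R M N\<^esub> \<and>
      free_lift R (tensor R M N) (\<lambda>y. ?p (delta R (y \<otimes>\<^bsub>?G\<^esub> x))) f = \<zero>\<^bsub>tensor R M N\<^esub>"
    if x: "x \<in> carrier ?G" and f: "f \<in> bilinear_rels R M N" for x f
  proof -
    obtain u v where uv: "x = (u, v)" "u \<in> carrier M" "v \<in> carrier N"
      using x by (auto simp: DirProd_def)
    have "(\<lambda>y. ?p (delta R (x \<otimes>\<^bsub>?G\<^esub> y))) = (\<lambda>(a, b). tens R M N (u \<otimes>\<^bsub>M\<^esub> a) (v \<otimes>\<^bsub>N\<^esub> b))"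
      "(\<lambda>y. ?p (delta R (y \<otimes>\<^bsub>?G\<^esub> x))) = (\<lambda>(a, b). tens R M N (a \<otimes>\<^bsub>M\<^esub> u) (b \<otimes>\<^bsub>N\<^esub> v))"
      by (auto simp: fun_eq_iff DirProd_def tens_presented uv(1))
    moreover have "bilinear R M N (tensor R M N) (\<lambda>a b. tens R M N (u \<otimes>\<^bsub>M\<^esub> a) (v \<otimes>\<^bsub>N\<^esub> b))"
      by (intro bilinearI linear_maps_compose[OF M.mult_linear(1)[OF uv(2)] bilinearD(1)[OF B]]
          linear_maps_compose[OF N.mult_linear(1)[OF uv(3)] bilinearD(2)[OF B]] M.m_closed N.m_closed uv)
    moreover have "bilinear R M N (tensor R M N) (\<lambda>a b. tens R M N (a \<otimes>\<^bsub>M\<^esub> u) (b \<otimes>\<^bsub>N\<^esub> v))"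
      by (intro bilinearI linear_maps_compose[OF M.mult_linear(2)[OF uv(2)] bilinearD(1)[OF B]]
          linear_maps_compose[OF N.mult_linear(2)[OF uv(3)] bilinearD(2)[OF B]] M.m_closed N.m_closed uv)
    ultimately show ?thesis using free_lift_bilinear_rels[OF modules T _ f] by simp
  qed
  note P = presented_assoc_algebra[OF M.R.is_cring bilinear_rels_carrier[OF modules] G
      kill[unfolded tensor_presented]]
  show "assoc_algebra R (tensor R M N)"
    unfolding tensor_presented by (rule P(1))
  show "tens R M N x y \<otimes>\<^bsub>tensor R M N\<^esub> tens R M N x' y' =
      tens R M N (x \<otimes>\<^bsub>M\<^esub> x') (y \<otimes>\<^bsub>N\<^esub> y')"
    if "x \<in> carrier M" "y \<in> carrier N" "x' \<in> carrier M" "y' \<in> carrier N"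
    unfolding tensor_presented tens_presented
    by (subst P(2)) (use that in \<open>auto simp: DirProd_def\<close>)
  show "\<one>\<^bsub>tensor R M N\<^esub> = tens R M N \<one>\<^bsub>M\<^esub> \<one>\<^bsub>N\<^esub>"
    unfolding tensor_presented tens_presented by (subst P(3)) (auto simp: DirProd_def)
qed


section \<open>Tensor algebras\<close>

definition multilinear ::
  "('k, 'r) ring_scheme \<Rightarrow> ('k, 'v, 'm) module_scheme \<Rightarrow> ('k, 'w, 'n) module_scheme \<Rightarrow>
   ('v list \<Rightarrow> 'w) \<Rightarrow> bool"
  where "multilinear R V N \<phi> \<longleftrightarrow> \<phi> [] \<in> carrier N \<and>
    (\<forall>xs\<in>lists (carrier V). \<forall>ys\<in>lists (carrier V). (\<lambda>v. \<phi> (xs @ v # ys)) \<in> linear_maps R V N)"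

lemma multilinearI:
  assumes "\<phi> [] \<in> carrier N"
    and "\<And>xs ys. xs \<in> lists (carrier V) \<Longrightarrow> ys \<in> lists (carrier V) \<Longrightarrow>
      (\<lambda>v. \<phi> (xs @ v # ys)) \<in> linear_maps R V N"
  shows "multilinear R V N \<phi>"
  using assms by (auto simp: multilinear_def)

lemma multilinearD:
  assumes "multilinear R V N \<phi>" "xs \<in> lists (carrier V)" "ys \<in> lists (carrier V)"
  shows "(\<lambda>v. \<phi> (xs @ v # ys)) \<in> linear_maps R V N"
  using assms by (auto simp: multilinear_def)

lemma multilinear_closed:
  assumes "multilinear R V N \<phi>" "vs \<in> lists (carrier V)"
  shows "\<phi> vs \<in> carrier N"
proof (cases vs)
  case Nil
  then show ?thesis using assms by (simp add: multilinear_def)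
next
  case (Cons v ws)
  then show ?thesis
    using linear_maps_closed[OF multilinearD[OF assms(1), of "[]" ws]] assms(2) by simp
qed

lemma word_monoid: "Group.monoid (word_monoid S)"
  by (rule monoidI) (auto simp: word_monoid_def)

lemma multilinear_rels_add:
    "\<lbrakk>xs \<in> lists (carrier V); v \<in> carrier V; w \<in> carrier V; ys \<in> lists (carrier V)\<rbrakk> \<Longrightarrow>
      delta R (xs @ (v \<oplus>\<^bsub>V\<^esub> w) # ys) \<ominus>\<^bsub>monoid_algebra R (word_monoid (carrier V))\<^esub>
        (delta R (xs @ v # ys) \<oplus>\<^bsub>monoid_algebra R (word_monoid (carrier V))\<^esub> delta R (xs @ w # ys))
      \<in> multilinear_rels R V"
  and multilinear_rels_smult:
    "\<lbrakk>xs \<in> lists (carrier V); a \<in> carrier R; v \<in> carrier V; ys \<in> lists (carrier V)\<rbrakk> \<Longrightarrow>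
      delta R (xs @ (a \<odot>\<^bsub>V\<^esub> v) # ys) \<ominus>\<^bsub>monoid_algebra R (word_monoid (carrier V))\<^esub>
        a \<odot>\<^bsub>monoid_algebra R (word_monoid (carrier V))\<^esub> delta R (xs @ v # ys) \<in> multilinear_rels R V"
  unfolding multilinear_rels_def Let_def append_Cons append_Nil by blast+

lemma multilinear_rels_cases:
  assumes "f \<in> multilinear_rels R V"
  obtains
    (add) xs v w ys where "xs \<in> lists (carrier V)" "v \<in> carrier V" "w \<in> carrier V" "ys \<in> lists (carrier V)"
      "f = delta R (xs @ (v \<oplus>\<^bsub>V\<^esub> w) # ys) \<ominus>\<^bsub>monoid_algebra R (word_monoid (carrier V))\<^esub>
        (delta R (xs @ v # ys) \<oplus>\<^bsub>monoid_algebra R (word_monoid (carrier V))\<^esub> delta R (xs @ w # ys))"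
  | (smult) xs a v ys where "xs \<in> lists (carrier V)" "a \<in> carrier R" "v \<in> carrier V" "ys \<in> lists (carrier V)"
      "f = delta R (xs @ (a \<odot>\<^bsub>V\<^esub> v) # ys) \<ominus>\<^bsub>monoid_algebra R (word_monoid (carrier V))\<^esub>
        a \<odot>\<^bsub>monoid_algebra R (word_monoid (carrier V))\<^esub> delta R (xs @ v # ys)"
  using assms unfolding multilinear_rels_def Let_def append_Cons append_Nil by blast

lemma tensor_algebra_presented:
  "tensor_algebra R V = presented_algebra R (word_monoid (carrier V)) (multilinear_rels R V)"
  by (simp add: tensor_algebra_def presented_algebra_def Let_def)

lemma word_presented:
  "word R V vs = presented_proj R (word_monoid (carrier V)) (multilinear_rels R V) (delta R vs)"
  by (simp add: word_def presented_proj_def Let_def)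

context
  fixes R :: "('k, 'r) ring_scheme" and V :: "('k, 'v, 'm) module_scheme"
  assumes V: "module R V"
begin

interpretation V: module R V by (rule V)
interpretation F: assoc_algebra R "monoid_algebra R (word_monoid (carrier V))"
  by (rule V.R.monoid_algebra_assoc_algebra[OF word_monoid])

private lemma delta_word:
  "vs \<in> lists (carrier V) \<Longrightarrow> delta R vs \<in> carrier (monoid_algebra R (word_monoid (carrier V)))"
  by (rule V.R.delta_closed) (simp add: word_monoid_def)

private lemma multilinear_rels_carrier:
  "multilinear_rels R V \<subseteq> carrier (monoid_algebra R (word_monoid (carrier V)))"
proof
  fix f assume "f \<in> multilinear_rels R V"
  then show "f \<in> carrier (monoid_algebra R (word_monoid (carrier V)))"
    by (cases rule: multilinear_rels_cases) (simp_all add: delta_word del: monoid_algebra_ops)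
qed

lemma tensor_algebra_module: "module R (tensor_algebra R V)"
  unfolding tensor_algebra_presented by (rule presented_module[OF V.R.is_cring multilinear_rels_carrier])

lemma tensor_algebra_spanned: "spanned R (tensor_algebra R V) (word R V ` lists (carrier V))"
  using presented_spanned[OF V.R.is_cring multilinear_rels_carrier]
  unfolding tensor_algebra_presented word_presented[abs_def] by (simp add: word_monoid_def)

lemma word_multilinear: "multilinear R V (tensor_algebra R V) (word R V)"
proof -
  let ?F = "monoid_algebra R (word_monoid (carrier V))"
  let ?p = "presented_proj R (word_monoid (carrier V)) (multilinear_rels R V)"
  have p: "?p \<in> linear_maps R ?F (tensor_algebra R V)"
    unfolding tensor_algebra_presented
    by (rule presented_proj_linear[OF V.R.is_cring multilinear_rels_carrier])
  note eqI = presented_proj_eqI[OF V.R.is_cring multilinear_rels_carrier]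
  note [simp del] = monoid_algebra_ops
  have cl: "word R V vs \<in> carrier (tensor_algebra R V)" if "vs \<in> lists (carrier V)" for vs
    unfolding word_presented by (rule linear_maps_closed[OF p delta_word[OF that]])
  have "word R V (xs @ (v \<oplus>\<^bsub>V\<^esub> w) # ys) =
      word R V (xs @ v # ys) \<oplus>\<^bsub>tensor_algebra R V\<^esub> word R V (xs @ w # ys)"
    if "xs \<in> lists (carrier V)" "v \<in> carrier V" "w \<in> carrier V" "ys \<in> lists (carrier V)" for xs v w ys
    unfolding word_presented
    by (subst linear_maps_add[OF p, symmetric])
      (use that in \<open>simp_all add: delta_word eqI[OF _ _ multilinear_rels_add]\<close>)
  moreover have "word R V (xs @ (a \<odot>\<^bsub>V\<^esub> v) # ys) =
      a \<odot>\<^bsub>tensor_algebra R V\<^esub> word R V (xs @ v # ys)"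
    if "xs \<in> lists (carrier V)" "a \<in> carrier R" "v \<in> carrier V" "ys \<in> lists (carrier V)" for xs a v ys
    unfolding word_presented
    by (subst linear_maps_smult[OF p, symmetric])
      (use that in \<open>simp_all add: delta_word eqI[OF _ _ multilinear_rels_smult]\<close>)
  ultimately show ?thesis by (intro multilinearI linear_mapsI) (auto intro!: cl)
qed

lemmas word_closed = multilinear_closed[OF word_multilinear]

lemma free_lift_multilinear_rels:
  assumes N: "module R N" and \<phi>: "multilinear R V N \<phi>" and f: "f \<in> multilinear_rels R V"
  shows "free_lift R N \<phi> f = \<zero>\<^bsub>N\<^esub>"
proof -
  interpret N: module R N by (rule N)
  note cl = multilinear_closed[OF \<phi>]
  have L: "free_lift R N \<phi> \<in> linear_maps R (monoid_algebra R (word_monoid (carrier V))) N"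
    by (rule N.free_lift_linear) (use cl in \<open>auto simp: word_monoid_def\<close>)
  have d: "free_lift R N \<phi> (delta R vs) = \<phi> vs" if "vs \<in> lists (carrier V)" for vs
    using N.free_lift_delta[of \<phi> vs] cl[OF that] by simp
  note [simp del] = monoid_algebra_ops
  note rules = linear_maps_minus[OF F.module_axioms N L] linear_maps_add[OF L] linear_maps_smult[OF L]
    delta_word d cl linear_maps_add[OF multilinearD[OF \<phi>]] linear_maps_smult[OF multilinearD[OF \<phi>]]
  from f show ?thesis
    by (cases rule: multilinear_rels_cases) (simp_all add: rules a_minus_def[of N] N.r_neg)
qed

lemma tensor_algebra_lift:
  assumes N: "module R N" and \<phi>: "multilinear R V N \<phi>"
  shows "\<exists>\<psi>\<in>linear_maps R (tensor_algebra R V) N. \<forall>vs\<in>lists (carrier V). \<psi> (word R V vs) = \<phi> vs"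
proof -
  have pi: "\<phi> \<in> carrier (word_monoid (carrier V)) \<rightarrow> carrier N"
    using multilinear_closed[OF \<phi>] by (auto simp: word_monoid_def)
  from presented_lift[OF V.R.is_cring multilinear_rels_carrier N pi free_lift_multilinear_rels[OF N \<phi>]]
  show ?thesis
    unfolding tensor_algebra_presented word_presented by (simp add: word_monoid_def)
qed

lemma
  shows tensor_algebra_assoc_algebra: "assoc_algebra R (tensor_algebra R V)"
    and word_mult: "\<lbrakk>xs \<in> lists (carrier V); ys \<in> lists (carrier V)\<rbrakk> \<Longrightarrow>
      word R V xs \<otimes>\<^bsub>tensor_algebra R V\<^esub> word R V ys = word R V (xs @ ys)"
    and tensor_algebra_one: "\<one>\<^bsub>tensor_algebra R V\<^esub> = word R V []"
proof -
  let ?G = "word_monoid (carrier V)"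
  let ?p = "presented_proj R ?G (multilinear_rels R V)" and ?T = "tensor_algebra R V"
  have kill: "free_lift R ?T (\<lambda>vs. ?p (delta R (us \<otimes>\<^bsub>?G\<^esub> vs))) f = \<zero>\<^bsub>?T\<^esub> \<and>
      free_lift R ?T (\<lambda>vs. ?p (delta R (vs \<otimes>\<^bsub>?G\<^esub> us))) f = \<zero>\<^bsub>?T\<^esub>"
    if "us \<in> carrier ?G" and f: "f \<in> multilinear_rels R V" for us f
  proof -
    have us: "us \<in> lists (carrier V)" using that by (simp add: word_monoid_def)
    note M = multilinearD[OF word_multilinear]
    have "(\<lambda>v. word R V (us @ xs @ v # ys)) \<in> linear_maps R V ?T"
      "(\<lambda>v. word R V ((xs @ v # ys) @ us)) \<in> linear_maps R V ?T"
      if "xs \<in> lists (carrier V)" "ys \<in> lists (carrier V)" for xs ys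
      using M[of "us @ xs" ys] M[of xs "ys @ us"] us that by simp_all
    then have "multilinear R V ?T (\<lambda>vs. word R V (us @ vs))" "multilinear R V ?T (\<lambda>vs. word R V (vs @ us))"
      using word_closed[OF us] by (simp_all add: multilinear_def)
    from this[THEN free_lift_multilinear_rels[OF tensor_algebra_module _ f]] show ?thesis
      by (simp add: word_monoid_def word_presented)
  qed
  note P = presented_assoc_algebra[OF V.R.is_cring multilinear_rels_carrier word_monoid
      kill[unfolded tensor_algebra_presented]]
  show "assoc_algebra R ?T" unfolding tensor_algebra_presented by (rule P(1))
  show "word R V xs \<otimes>\<^bsub>?T\<^esub> word R V ys = word R V (xs @ ys)"
    if "xs \<in> lists (carrier V)" "ys \<in> lists (carrier V)"
    unfolding tensor_algebra_presented word_presented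
    by (subst P(2)) (use that in \<open>auto simp: word_monoid_def\<close>)
  show "\<one>\<^bsub>?T\<^esub> = word R V []"
    unfolding tensor_algebra_presented word_presented by (subst P(3)) (auto simp: word_monoid_def)
qed

text \<open>
  The letters are replaced by elements of the spanning set one by one from the left, the prefix \<open>xs\<close>
  being done already. The length is recorded so that the empty word, which has no letter to replace, can
  be excluded from the words that are known to lie in \<open>H\<close>.
\<close>
lemma word_in_submodule:
  assumes X: "spanned R V X" and H: "submodule H R (tensor_algebra R V)"
    and words: "\<And>zs. length zs = length xs + length vs \<Longrightarrow> zs \<in> lists X \<Longrightarrow> word R V zs \<in> H"
    and "xs \<in> lists X" "vs \<in> lists (carrier V)"
  shows "word R V (xs @ vs) \<in> H"
  using assms(3-)
proof (induction vs arbitrary: xs)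
  case (Cons v vs)
  have "lists X \<subseteq> lists (carrier V)" using spanned_carrier[OF X] by blast
  then have L: "(\<lambda>v. word R V (xs @ v # vs)) \<in> linear_maps R V (tensor_algebra R V)"
    by (intro multilinearD[OF word_multilinear]) (use Cons.prems in auto)
  have "x \<in> {v \<in> carrier V. word R V (xs @ v # vs) \<in> H}" if "x \<in> X" for x
  proof -
    have "word R V ((xs @ [x]) @ vs) \<in> H"
      by (rule Cons.IH) (use Cons.prems that in auto)
    then show ?thesis using that spanned_carrier[OF X] by auto
  qed
  with Cons.prems(3) spannedD[OF X submodule_vimage[OF V tensor_algebra_module L H]] show ?case by auto
qed (use assms in auto)

lemma tensor_algebra_spanned_by:
  assumes X: "spanned R V X"
  shows "spanned R (tensor_algebra R V) (word R V ` lists X)"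
  unfolding spanned_def
proof (intro conjI allI impI)
  show "word R V ` lists X \<subseteq> carrier (tensor_algebra R V)"
    using spanned_carrier[OF X] by (auto intro!: word_closed)
  fix H assume H: "submodule H R (tensor_algebra R V)" "word R V ` lists X \<subseteq> H"
  have "word R V ([] @ vs) \<in> H" if "vs \<in> lists (carrier V)" for vs
    by (rule word_in_submodule[OF X H(1) _ _ that]) (use H(2) in auto)
  then have "word R V ` lists (carrier V) \<subseteq> H" by auto
  then show "carrier (tensor_algebra R V) \<subseteq> H"
    using spannedD[OF tensor_algebra_spanned H(1)] by blast
qed

lemma tensor_algebra_pos_eq: "tensor_algebra_pos R V = (tensor_algebra R V)
    \<lparr>carrier := mod_span R (tensor_algebra R V) (word R V ` (lists (carrier V) - {[]}))\<rparr>"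
proof -
  have "{word R V vs | vs. vs \<in> lists (carrier V) \<and> vs \<noteq> []} = word R V ` (lists (carrier V) - {[]})"
    by auto
  then show ?thesis by (simp add: tensor_algebra_pos_def)
qed

private lemma pos_words: "word R V ` (lists (carrier V) - {[]}) \<subseteq> carrier (tensor_algebra R V)"
  by (auto intro!: word_closed)

lemma tensor_algebra_pos_module: "module R (tensor_algebra_pos R V)"
  unfolding tensor_algebra_pos_eq by (rule module_mod_span[OF tensor_algebra_module pos_words])

lemma tensor_algebra_pos_submodule: "submodule (carrier (tensor_algebra_pos R V)) R (tensor_algebra R V)"
  unfolding tensor_algebra_pos_eq by (simp add: mod_span_submodule[OF tensor_algebra_module pos_words])

lemma tensor_algebra_pos_subset: "carrier (tensor_algebra_pos R V) \<subseteq> carrier (tensor_algebra R V)"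
  by (rule module.submoduleE(1)[OF tensor_algebra_module tensor_algebra_pos_submodule])

lemma tensor_algebra_pos_carrier_update:
  "tensor_algebra_pos R V = (tensor_algebra R V)\<lparr>carrier := carrier (tensor_algebra_pos R V)\<rparr>"
  unfolding tensor_algebra_pos_def by simp

lemma tensor_algebra_pos_spanned:
  "spanned R (tensor_algebra_pos R V) (word R V ` (lists (carrier V) - {[]}))"
  unfolding tensor_algebra_pos_eq by (rule spanned_mod_span[OF tensor_algebra_module pos_words])

lemma word_pos_closed: "vs \<in> lists (carrier V) \<Longrightarrow> vs \<noteq> [] \<Longrightarrow> word R V vs \<in> carrier (tensor_algebra_pos R V)"
  using spanned_carrier[OF tensor_algebra_pos_spanned] by blast

lemma word_pos_linear:
  assumes "xs \<in> lists (carrier V)" "ys \<in> lists (carrier V)"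
  shows "(\<lambda>v. word R V (xs @ v # ys)) \<in> linear_maps R V (tensor_algebra_pos R V)"
proof -
  have "word R V (xs @ v # ys) \<in> carrier (tensor_algebra_pos R V)" if "v \<in> carrier V" for v
    by (rule word_pos_closed) (use assms that in auto)
  with multilinearD[OF word_multilinear assms] show ?thesis
    by (auto simp: linear_maps_def tensor_algebra_pos_def)
qed

lemma tensor_algebra_pos_lift:
  assumes N: "module R N"
    and \<phi>: "\<And>xs ys. xs \<in> lists (carrier V) \<Longrightarrow> ys \<in> lists (carrier V) \<Longrightarrow>
      (\<lambda>v. \<phi> (xs @ v # ys)) \<in> linear_maps R V N"
  shows "\<exists>\<psi>\<in>linear_maps R (tensor_algebra R V) N.
    \<forall>vs\<in>lists (carrier V). vs \<noteq> [] \<longrightarrow> \<psi> (word R V vs) = \<phi> vs"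
proof -
  interpret N: module R N by (rule N)
  have "multilinear R V N (\<lambda>vs. if vs = [] then \<zero>\<^bsub>N\<^esub> else \<phi> vs)"
    using \<phi> by (auto simp: multilinear_def)
  from tensor_algebra_lift[OF N this] obtain \<psi> where
    "\<psi> \<in> linear_maps R (tensor_algebra R V) N"
    "\<forall>vs\<in>lists (carrier V). \<psi> (word R V vs) = (if vs = [] then \<zero>\<^bsub>N\<^esub> else \<phi> vs)"
    by blast
  then show ?thesis by (intro bexI[of _ \<psi>]) auto
qed

lemma linear_maps_pos: "\<psi> \<in> linear_maps R (tensor_algebra R V) N \<Longrightarrow> \<psi> \<in> linear_maps R (tensor_algebra_pos R V) N"
  by (subst tensor_algebra_pos_carrier_update) (rule linear_maps_submodule_domain[OF _ tensor_algebra_pos_subset])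

lemma tensor_algebra_pos_spanned_by:
  assumes X: "spanned R V X"
  shows "spanned R (tensor_algebra_pos R V) (word R V ` (lists X - {[]}))"
  unfolding spanned_def
proof (intro conjI allI impI)
  show "word R V ` (lists X - {[]}) \<subseteq> carrier (tensor_algebra_pos R V)"
    using spanned_carrier[OF X] by (auto intro!: word_pos_closed)
  fix H assume H: "submodule H R (tensor_algebra_pos R V)" "word R V ` (lists X - {[]}) \<subseteq> H"
  have "submodule H R (tensor_algebra R V)"
    by (rule submodule_trans[OF tensor_algebra_module tensor_algebra_pos_submodule])
      (use H(1) in \<open>simp add: tensor_algebra_pos_carrier_update[symmetric]\<close>)
  note sub = this
  have "word R V vs \<in> H" if vs: "vs \<in> lists (carrier V)" "vs \<noteq> []" for vs
  proof -
    have "word R V ([] @ vs) \<in> H"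
    proof (rule word_in_submodule[OF X sub _ _ vs(1)])
      fix zs assume "length zs = length [] + length vs" "zs \<in> lists X"
      then have "zs \<in> lists X - {[]}" using vs(2) by auto
      then show "word R V zs \<in> H" using H(2) by blast
    qed simp
    then show ?thesis by simp
  qed
  then show "carrier (tensor_algebra_pos R V) \<subseteq> H"
    using spannedD[OF tensor_algebra_pos_spanned H(1)] by (auto simp: image_subset_iff)
qed

end


section \<open>Splitting words\<close>

definition lprod :: "('a \<Rightarrow> 'b \<Rightarrow> 'c) \<Rightarrow> 'a list \<Rightarrow> 'b list \<Rightarrow> 'c list"
  where "lprod f xs ys = concat (map (\<lambda>x. map (f x) ys) xs)"

lemma lprod_Nil [simp]: "lprod f [] ys = []"
  and lprod_Cons: "lprod f (x # xs) ys = map (f x) ys @ lprod f xs ys"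
  and lprod_append: "lprod f (xs @ xs') ys = lprod f xs ys @ lprod f xs' ys"
  by (simp_all add: lprod_def)

lemma lprod_Nil_right [simp]: "lprod f xs [] = []"
  by (induction xs) (auto simp: lprod_Cons)

lemma set_lprod: "set (lprod f xs ys) = {f x y | x y. x \<in> set xs \<and> y \<in> set ys}"
  by (auto simp: lprod_def)

lemma mset_lprod: "mset (lprod f xs ys) = (\<Sum>x\<in>#mset xs. image_mset (f x) (mset ys))"
  by (induction xs) (auto simp: lprod_Cons)

lemma mset_lprod_cong:
  "mset xs = mset xs' \<Longrightarrow> mset ys = mset ys' \<Longrightarrow> mset (lprod f xs ys) = mset (lprod f xs' ys')"
  by (simp add: mset_lprod)

lemma mset_lprod_append_right: "mset (lprod f xs (ys @ zs)) = mset (lprod f xs ys) + mset (lprod f xs zs)"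
  by (induction xs) (auto simp: lprod_Cons)

lemma lprod_map: "lprod f (map g xs) (map h ys) = lprod (\<lambda>x y. f (g x) (h y)) xs ys"
  by (simp add: lprod_def comp_def)

lemma map_lprod: "map g (lprod f xs ys) = lprod (\<lambda>x y. g (f x y)) xs ys"
  by (simp add: lprod_def map_concat comp_def)

lemma filter_lprod:
  assumes "\<And>x y. x \<in> set xs \<Longrightarrow> y \<in> set ys \<Longrightarrow> P (f x y) \<longleftrightarrow> Q x \<and> Q' y"
  shows "filter P (lprod f xs ys) = lprod f (filter Q xs) (filter Q' ys)"
  using assms
proof (induction xs)
  case (Cons x xs)
  have "filter P (map (f x) ys) = (if Q x then map (f x) (filter Q' ys) else [])"
    using Cons.prems by (auto simp: filter_map comp_def intro!: arg_cong[where f = "map (f x)"] filter_cong)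
  then show ?case using Cons by (auto simp: lprod_Cons)
qed simp

text \<open>
  The left side lists the terms by entries of the product, the right side by terms of the first
  expansion. The order differs, which is why multisets are compared throughout.
\<close>
lemma mset_expand_lprod:
  assumes "\<And>p q. p \<in> set ps \<Longrightarrow> q \<in> set qs \<Longrightarrow> e (m p q) = lprod t (e1 p) (e2 q)"
  shows "mset (concat (map e (lprod m ps qs))) =
    mset (lprod t (concat (map e1 ps)) (concat (map e2 qs)))"
  using assms
proof (induction ps)
  case (Cons p ps)
  have "mset (concat (map (\<lambda>q. e (m p q)) qs)) = mset (lprod t (e1 p) (concat (map e2 qs)))"
    using Cons.prems by (induction qs) (auto simp: mset_lprod_append_right)
  then show ?case using Cons by (auto simp: lprod_Cons lprod_append comp_def)
qed simp


fun cons_hd :: "'a \<Rightarrow> 'a list list \<Rightarrow> 'a list list" where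
  "cons_hd a [] = [[a]]"
| "cons_hd a (w # ws) = (a # w) # ws"

text \<open>
  All ways to select letters from a word. A selection is recorded as the selected subword together
  with the list of all gaps before, between and after the selected letters. Empty gaps are kept, which
  makes every operation below a structural recursion; the runs of the complement of the selection are
  the nonempty gaps.
\<close>
fun splits :: "'a list \<Rightarrow> ('a list \<times> 'a list list) list" where
  "splits [] = [([], [[]])]"
| "splits (a # w) = map (\<lambda>p. (a # fst p, [] # snd p)) (splits w) @
    map (\<lambda>p. (fst p, cons_hd a (snd p))) (splits w)"

text \<open>The argument \<open>h\<close> says whether the first letter may be selected and whether it may be left out.\<close>
fun half_splits :: "(bool \<Rightarrow> bool) \<Rightarrow> 'a list \<Rightarrow> ('a list \<times> 'a list list) list" where
  "half_splits h [] = [([], [[]])]"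
| "half_splits h (a # w) = (if h True then map (\<lambda>p. (a # fst p, [] # snd p)) (splits w) else []) @
    (if h False then map (\<lambda>p. (fst p, cons_hd a (snd p))) (splits w) else [])"

lemma half_splits_True: "half_splits (\<lambda>_. True) w = splits w"
  by (cases w) auto

definition join_split :: "'a list \<times> 'a list list \<Rightarrow> 'a list list \<times> 'a list list \<Rightarrow> 'a list list \<times> 'a list list"
  where "join_split p q = (fst p # fst q, snd p @ snd q)"

fun splits_list :: "'a list list \<Rightarrow> ('a list list \<times> 'a list list) list" where
  "splits_list [] = [([], [])]"
| "splits_list (w # ws) = lprod join_split (splits w) (splits_list ws)"

text \<open>
  Only the first letter of the first word is constrained, as in the definition of \<open>\<Delta>\<^sup>+\<close> on bar words.
\<close>
fun half_splits_list :: "(bool \<Rightarrow> bool) \<Rightarrow> 'a list list \<Rightarrow> ('a list list \<times> 'a list list) list" where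
  "half_splits_list h [] = []"
| "half_splits_list h (w # ws) = lprod join_split (half_splits h w) (splits_list ws)"

lemma half_splits_list_True: "ws \<noteq> [] \<Longrightarrow> half_splits_list (\<lambda>_. True) ws = splits_list ws"
  by (cases ws) (auto simp: half_splits_True)

lemma cons_hd_nonempty [simp]: "cons_hd a ws \<noteq> []"
  by (cases ws) auto

lemma cons_hd_append: "ws \<noteq> [] \<Longrightarrow> cons_hd a ws @ vs = cons_hd a (ws @ vs)"
  by (cases ws) auto

lemma not_all_empty_cons_hd: "\<not> (\<forall>xs\<in>set (cons_hd a ws). xs = [])"
  by (cases ws) auto

lemma splits_gaps_nonempty: "p \<in> set (splits w) \<Longrightarrow> snd p \<noteq> []"
  by (induction w arbitrary: p) auto

lemma half_splits_gaps_nonempty: "p \<in> set (half_splits h w) \<Longrightarrow> snd p \<noteq> []"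
  by (cases w) (auto dest: splits_gaps_nonempty split: if_splits)

lemma hd_snd_half_splits_Not:
  "p \<in> set (half_splits Not (a # w)) \<Longrightarrow> hd (snd p) \<noteq> []"
  by (auto, metis cons_hd.elims list.distinct(1) list.sel(1))

lemma lprod_join_split_append:
  "lprod join_split ps (lprod (\<lambda>p q. (fst p @ fst q, snd p @ snd q)) qs rs) =
    lprod (\<lambda>p q. (fst p @ fst q, snd p @ snd q)) (lprod join_split ps qs) rs"
proof (induction ps)
  case (Cons p ps)
  have "map (join_split p) (lprod (\<lambda>p q. (fst p @ fst q, snd p @ snd q)) qs rs) =
      lprod (\<lambda>p q. (fst p @ fst q, snd p @ snd q)) (map (join_split p) qs) rs"
    by (simp add: lprod_def map_concat comp_def join_split_def[abs_def])
  then show ?case using Cons by (simp add: lprod_Cons lprod_append)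
qed simp

lemma splits_list_append: "splits_list (us @ vs) =
    lprod (\<lambda>p q. (fst p @ fst q, snd p @ snd q)) (splits_list us) (splits_list vs)"
  by (induction us) (simp_all add: lprod_Cons lprod_join_split_append)

lemma half_splits_list_append: "us \<noteq> [] \<Longrightarrow> half_splits_list h (us @ vs) =
    lprod (\<lambda>p q. (fst p @ fst q, snd p @ snd q)) (half_splits_list h us) (splits_list vs)"
  by (cases us) (simp_all add: splits_list_append lprod_join_split_append)


definition expand_left :: "('u \<Rightarrow> ('x \<times> 'y) list) \<Rightarrow> ('u \<times> 'v) list \<Rightarrow> ('x \<times> 'y \<times> 'v) list"
  where "expand_left S ps = concat (map (\<lambda>p. map (\<lambda>q. (fst q, snd q, snd p)) (S (fst p))) ps)"

definition expand_right :: "('v \<Rightarrow> ('x \<times> 'y) list) \<Rightarrow> ('u \<times> 'v) list \<Rightarrow> ('u \<times> 'x \<times> 'y) list"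
  where "expand_right S ps = concat (map (\<lambda>p. map (\<lambda>q. (fst p, fst q, snd q)) (S (snd p))) ps)"

lemma expand_append:
  "expand_left S (ps @ qs) = expand_left S ps @ expand_left S qs"
  "expand_right S' (ps' @ qs') = expand_right S' ps' @ expand_right S' qs'"
  by (simp_all add: expand_left_def expand_right_def)

text \<open>
  In a twofold selection each letter takes one of three roles: selected twice, selected once, never
  selected. These maps add a letter with the given role in front.
\<close>
definition role1 :: "'a \<Rightarrow> 'a list \<times> 'a list list \<times> 'a list list \<Rightarrow> 'a list \<times> 'a list list \<times> 'a list list"
  where "role1 a t = (a # fst t, [] # fst (snd t), [] # snd (snd t))"

definition role2 :: "'a \<Rightarrow> 'a list \<times> 'a list list \<times> 'a list list \<Rightarrow> 'a list \<times> 'a list list \<times> 'a list list"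
  where "role2 a t = (fst t, cons_hd a (fst (snd t)), [] # snd (snd t))"

definition role3 :: "'a \<Rightarrow> 'a list \<times> 'a list list \<times> 'a list list \<Rightarrow> 'a list \<times> 'a list list \<times> 'a list list"
  where "role3 a t = (fst t, fst (snd t), cons_hd a (snd (snd t)))"

lemma expand_left_roles:
  "expand_left (half_splits id) (half_splits id (a # w)) = map (role1 a) (expand_left splits (splits w))"
  "expand_left (half_splits Not) (half_splits id (a # w)) = map (role2 a) (expand_left splits (splits w))"
  "expand_left splits (half_splits Not (a # w)) = map (role3 a) (expand_left splits (splits w))"
  by (simp_all add: expand_left_def role1_def role2_def role3_def map_concat comp_def)

text \<open>
  A letter that is left out joins the first gap. When letters are selected in the gaps, it is the first
  letter of the first gap, which is what the half coproducts on the second factor look at.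
\<close>
lemma splits_list_cons_hd:
  assumes "v \<noteq> []"
  shows "half_splits_list id (cons_hd a v) = map (\<lambda>p. (cons_hd a (fst p), [] # snd p)) (splits_list v)"
    and "half_splits_list Not (cons_hd a v) = map (\<lambda>p. (fst p, cons_hd a (snd p))) (splits_list v)"
proof -
  obtain h t where v: "v = h # t" using assms by (cases v) auto
  show "half_splits_list id (cons_hd a v) = map (\<lambda>p. (cons_hd a (fst p), [] # snd p)) (splits_list v)"
    by (simp add: v lprod_def map_concat comp_def join_split_def[abs_def])
  have "cons_hd a (snd p) @ us = cons_hd a (snd p @ us)" if "p \<in> set (splits h)" for p us
    using splits_gaps_nonempty[OF that] by (simp add: cons_hd_append)
  then show "half_splits_list Not (cons_hd a v) = map (\<lambda>p. (fst p, cons_hd a (snd p))) (splits_list v)"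
    by (auto simp: v lprod_def map_concat comp_def join_split_def[abs_def] intro!: arg_cong[where f = concat])
qed

lemma expand_right_roles:
  "expand_right splits_list (half_splits id (a # w)) = map (role1 a) (expand_right splits_list (splits w))"
  "expand_right (half_splits_list id) (half_splits Not (a # w)) =
    map (role2 a) (expand_right splits_list (splits w))"
  "expand_right (half_splits_list Not) (half_splits Not (a # w)) =
    map (role3 a) (expand_right splits_list (splits w))"
proof -
  show "expand_right splits_list (half_splits id (a # w)) = map (role1 a) (expand_right splits_list (splits w))"
    by (simp add: expand_right_def role1_def map_concat comp_def lprod_def join_split_def[abs_def])
  show "expand_right (half_splits_list id) (half_splits Not (a # w)) =
      map (role2 a) (expand_right splits_list (splits w))"
    using splits_gaps_nonempty[of _ w]
    by (auto simp: expand_right_def role2_def map_concat comp_def splits_list_cons_hd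
        intro!: arg_cong[where f = concat])
  show "expand_right (half_splits_list Not) (half_splits Not (a # w)) =
      map (role3 a) (expand_right splits_list (splits w))"
    using splits_gaps_nonempty[of _ w]
    by (auto simp: expand_right_def role3_def map_concat comp_def splits_list_cons_hd
        intro!: arg_cong[where f = concat])
qed

lemma splits_eq_halves: "splits (a # w) = half_splits id (a # w) @ half_splits Not (a # w)"
  by simp

lemma splits_list_eq_halves:
  assumes "ws \<noteq> []" "hd ws \<noteq> []"
  shows "splits_list ws = half_splits_list id ws @ half_splits_list Not ws"
  using assms by (cases ws; cases "hd ws") (auto simp: lprod_append)

lemma mset_expand_left_append:
  assumes "\<And>p. p \<in> set ps \<Longrightarrow> S (fst p) = S1 (fst p) @ S2 (fst p)"
  shows "mset (expand_left S ps) = mset (expand_left S1 ps) + mset (expand_left S2 ps)"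
  using assms by (induction ps) (auto simp: expand_left_def)

lemma mset_expand_right_append:
  assumes "\<And>p. p \<in> set ps \<Longrightarrow> S (snd p) = S1 (snd p) @ S2 (snd p)"
  shows "mset (expand_right S ps) = mset (expand_right S1 ps) + mset (expand_right S2 ps)"
  using assms by (induction ps) (auto simp: expand_right_def)

text \<open>
  Both sides are built by the same three maps when a letter is prepended.
\<close>
lemma splits_coassoc: "mset (expand_left splits (splits w)) = mset (expand_right splits_list (splits w))"
proof (induction w)
  case Nil
  show ?case by (simp add: expand_left_def expand_right_def lprod_Cons join_split_def)
next
  case (Cons a w)
  have l: "mset (expand_left splits (half_splits id (a # w))) =
    mset (expand_left (half_splits id) (half_splits id (a # w))) +
    mset (expand_left (half_splits Not) (half_splits id (a # w)))"
    by (rule mset_expand_left_append) auto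
  have r: "mset (expand_right splits_list (half_splits Not (a # w))) =
    mset (expand_right (half_splits_list id) (half_splits Not (a # w))) +
    mset (expand_right (half_splits_list Not) (half_splits Not (a # w)))"
    by (rule mset_expand_right_append)
      (use half_splits_gaps_nonempty[of _ Not "a # w"] hd_snd_half_splits_Not[of _ a w] in
        \<open>auto intro!: splits_list_eq_halves simp del: half_splits.simps\<close>)
  show ?case
    unfolding splits_eq_halves expand_append mset_append l r expand_left_roles expand_right_roles
    using Cons by (simp add: add.assoc)
qed

text \<open>
  The first letter is selected twice, once, or never; each of these cases is already an identity.
\<close>
lemma half_splits_coassoc:
  "mset (expand_left (half_splits id) (half_splits id (a # w))) =
    mset (expand_right splits_list (half_splits id (a # w)))"
  "mset (expand_left (half_splits Not) (half_splits id (a # w))) =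
    mset (expand_right (half_splits_list id) (half_splits Not (a # w)))"
  "mset (expand_left splits (half_splits Not (a # w))) =
    mset (expand_right (half_splits_list Not) (half_splits Not (a # w)))"
  unfolding expand_left_roles expand_right_roles by (simp_all add: splits_coassoc)

definition join_triple :: "'a list \<times> 'a list list \<times> 'a list list \<Rightarrow>
    'a list list \<times> 'a list list \<times> 'a list list \<Rightarrow> 'a list list \<times> 'a list list \<times> 'a list list"
  where "join_triple s t = (fst s # fst t, fst (snd s) @ fst (snd t), snd (snd s) @ snd (snd t))"

lemma expand_left_lprod:
  assumes "\<And>p us. p \<in> set ps \<Longrightarrow> S' (fst p # us) = lprod join_split (S (fst p)) (splits_list us)"
  shows "mset (expand_left S' (lprod join_split ps qs)) =
    mset (lprod join_triple (expand_left S ps) (expand_left splits_list qs))"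
  unfolding expand_left_def
  by (rule mset_expand_lprod)
    (simp add: join_split_def join_triple_def assms lprod_map map_lprod)

lemma expand_right_lprod:
  assumes "\<And>p vs. p \<in> set ps \<Longrightarrow> S' (snd p @ vs) =
    lprod (\<lambda>p q. (fst p @ fst q, snd p @ snd q)) (S (snd p)) (splits_list vs)"
  shows "mset (expand_right S' (lprod join_split ps qs)) =
    mset (lprod join_triple (expand_right S ps) (expand_right splits_list qs))"
  unfolding expand_right_def
  by (rule mset_expand_lprod)
    (simp add: join_split_def join_triple_def assms lprod_map map_lprod)

lemma splits_list_coassoc:
  "mset (expand_left splits_list (splits_list ws)) = mset (expand_right splits_list (splits_list ws))"
proof (induction ws)
  case Nil
  show ?case by (simp add: expand_left_def expand_right_def)
next
  case (Cons w ws)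
  have "mset (expand_left splits_list (splits_list (w # ws))) =
      mset (lprod join_triple (expand_left splits (splits w)) (expand_left splits_list (splits_list ws)))"
    by (simp add: expand_left_lprod)
  also have "\<dots> = mset (lprod join_triple (expand_right splits_list (splits w))
      (expand_right splits_list (splits_list ws)))"
    by (rule mset_lprod_cong[OF splits_coassoc Cons])
  also have "\<dots> = mset (expand_right splits_list (splits_list (w # ws)))"
    by (simp add: expand_right_lprod splits_list_append)
  finally show ?case .
qed

lemma half_splits_list_coassoc:
  assumes "ws \<noteq> []" "hd ws \<noteq> []"
  shows "mset (expand_left (half_splits_list id) (half_splits_list id ws)) =
      mset (expand_right splits_list (half_splits_list id ws))"
    and "mset (expand_left (half_splits_list Not) (half_splits_list id ws)) =
      mset (expand_right (half_splits_list id) (half_splits_list Not ws))"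
    and "mset (expand_left splits_list (half_splits_list Not ws)) =
      mset (expand_right (half_splits_list Not) (half_splits_list Not ws))"
proof -
  obtain a w ws' where ws: "ws = (a # w) # ws'" using assms by (cases ws; cases "hd ws") auto
  note c = mset_lprod_cong[OF _ splits_list_coassoc]
  have l: "mset (expand_left (half_splits_list h) (half_splits_list h' ws)) =
      mset (lprod join_triple (expand_left (half_splits h) (half_splits h' (a # w)))
        (expand_left splits_list (splits_list ws')))" for h h'
    unfolding ws half_splits_list.simps(2) by (rule expand_left_lprod) simp
  have l': "mset (expand_left splits_list (half_splits_list h' ws)) =
      mset (lprod join_triple (expand_left splits (half_splits h' (a # w)))
        (expand_left splits_list (splits_list ws')))" for h'
    unfolding ws half_splits_list.simps(2) by (rule expand_left_lprod) simp
  have r: "mset (expand_right (half_splits_list h) (half_splits_list h' ws)) =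
      mset (lprod join_triple (expand_right (half_splits_list h) (half_splits h' (a # w)))
        (expand_right splits_list (splits_list ws')))" for h h'
    unfolding ws half_splits_list.simps(2)
    by (rule expand_right_lprod) (rule half_splits_list_append[OF half_splits_gaps_nonempty])
  have r': "mset (expand_right splits_list (half_splits_list h' ws)) =
      mset (lprod join_triple (expand_right splits_list (half_splits h' (a # w)))
        (expand_right splits_list (splits_list ws')))" for h'
    unfolding ws half_splits_list.simps(2)
    by (rule expand_right_lprod) (rule splits_list_append)
  show "mset (expand_left (half_splits_list id) (half_splits_list id ws)) =
      mset (expand_right splits_list (half_splits_list id ws))"
    unfolding l r' by (rule c[OF half_splits_coassoc(1)])
  show "mset (expand_left (half_splits_list Not) (half_splits_list id ws)) =
      mset (expand_right (half_splits_list id) (half_splits_list Not ws))"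
    unfolding l r by (rule c[OF half_splits_coassoc(2)])
  show "mset (expand_left splits_list (half_splits_list Not ws)) =
      mset (expand_right (half_splits_list Not) (half_splits_list Not ws))"
    unfolding l' r by (rule c[OF half_splits_coassoc(3)])
qed

lemma hd_fst_half_splits_list_id:
  assumes "p \<in> set (half_splits_list id ws)" "ws \<noteq> []" "hd ws \<noteq> []"
  shows "fst p \<noteq> [] \<and> hd (fst p) \<noteq> []"
  using assms by (cases ws; cases "hd ws") (auto simp: set_lprod join_split_def)

lemma hd_snd_half_splits_list_Not:
  assumes "p \<in> set (half_splits_list Not ws)" "ws \<noteq> []" "hd ws \<noteq> []"
  shows "snd p \<noteq> [] \<and> hd (snd p) \<noteq> []"
proof -
  obtain a w ws' where ws: "ws = (a # w) # ws'" using assms by (cases ws; cases "hd ws") auto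
  obtain q r where "p = join_split q r" "q \<in> set (half_splits Not (a # w))"
    using assms(1) by (auto simp: ws set_lprod simp del: half_splits.simps)
  then show ?thesis
    using hd_snd_half_splits_Not[of q a w] half_splits_gaps_nonempty[of q Not "a # w"]
    by (auto simp: join_split_def simp del: half_splits.simps)
qed

text \<open>
  Counitality: selecting nothing leaves the whole word as a single gap, and leaving no gap means
  selecting everything.
\<close>
lemma filter_splits_empty_selection: "filter (\<lambda>p. fst p = []) (splits w) = [([], [w])]"
  by (induction w) (auto simp: filter_map comp_def)

lemma filter_splits_empty_gaps: "\<exists>v. filter (\<lambda>p. concat (snd p) = []) (splits w) = [(w, v)]"
  by (induction w) (auto simp: filter_map comp_def not_all_empty_cons_hd)

lemma filter_half_splits_empty_gaps:
  "h True \<Longrightarrow> \<exists>v. filter (\<lambda>p. concat (snd p) = []) (half_splits h w) = [(w, v)]"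
proof (cases w)
  case (Cons a w')
  obtain v where "filter (\<lambda>p. concat (snd p) = []) (splits w') = [(w', v)]"
    using filter_splits_empty_gaps by blast
  then show "h True \<Longrightarrow> ?thesis" by (simp add: Cons filter_map comp_def not_all_empty_cons_hd)
qed simp

lemma filter_half_splits_empty_selection:
  "h False \<Longrightarrow> filter (\<lambda>p. fst p = []) (half_splits h w) = [([], [w])]"
  by (cases w) (auto simp: filter_map comp_def filter_splits_empty_selection)

lemma filter_join_empty_selection: "filter (\<lambda>p. concat (fst p) = []) (lprod join_split ps qs) =
    lprod join_split (filter (\<lambda>p. fst p = []) ps) (filter (\<lambda>p. concat (fst p) = []) qs)"
  by (rule filter_lprod) (simp add: join_split_def)

lemma filter_join_empty_gaps: "filter (\<lambda>p. concat (snd p) = []) (lprod join_split ps qs) =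
    lprod join_split (filter (\<lambda>p. concat (snd p) = []) ps) (filter (\<lambda>p. concat (snd p) = []) qs)"
  by (rule filter_lprod) (auto simp: join_split_def)

lemma filter_splits_list_empty_selection:
  "\<exists>u. filter (\<lambda>p. concat (fst p) = []) (splits_list ws) = [(u, ws)]"
proof (induction ws)
  case (Cons w ws)
  then show ?case unfolding splits_list.simps filter_join_empty_selection
    by (auto simp: filter_splits_empty_selection lprod_Cons join_split_def)
qed simp

lemma filter_splits_list_empty_gaps:
  "\<exists>v. filter (\<lambda>p. concat (snd p) = []) (splits_list ws) = [(ws, v)]"
proof (induction ws)
  case (Cons w ws)
  then show ?case unfolding splits_list.simps filter_join_empty_gaps
    using filter_splits_empty_gaps[of w] by (auto simp: lprod_Cons join_split_def)
qed simp

lemma filter_half_splits_list_empty_selection: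
  assumes "h False" "ws \<noteq> []"
  shows "\<exists>u. filter (\<lambda>p. concat (fst p) = []) (half_splits_list h ws) = [(u, ws)]"
proof -
  obtain w ws' where ws: "ws = w # ws'" using assms(2) by (cases ws) auto
  show ?thesis unfolding ws half_splits_list.simps filter_join_empty_selection
      filter_half_splits_empty_selection[of h, OF assms(1)]
    using filter_splits_list_empty_selection[of ws'] by (auto simp: lprod_Cons join_split_def)
qed

lemma filter_half_splits_list_empty_gaps:
  assumes "h True" "ws \<noteq> []"
  shows "\<exists>v. filter (\<lambda>p. concat (snd p) = []) (half_splits_list h ws) = [(ws, v)]"
proof -
  obtain w ws' where ws: "ws = w # ws'" using assms(2) by (cases ws) auto
  show ?thesis unfolding ws half_splits_list.simps filter_join_empty_gaps
    using filter_splits_list_empty_gaps[of ws'] filter_half_splits_empty_gaps[of h w, OF assms(1)]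
    by (auto simp: lprod_Cons join_split_def)
qed


lemma splits_letters:
  assumes "w \<in> lists S" "p \<in> set (splits w)"
  shows "fst p \<in> lists S \<and> snd p \<in> lists (lists S)"
proof -
  have c: "a \<in> S \<Longrightarrow> v \<in> lists (lists S) \<Longrightarrow> cons_hd a v \<in> lists (lists S)" for a v
    by (cases v) auto
  show ?thesis using assms
  proof (induction w arbitrary: p)
    case (Cons a w)
    then obtain q where q: "q \<in> set (splits w)"
      "p = (a # fst q, [] # snd q) \<or> p = (fst q, cons_hd a (snd q))"
      by auto
    have "fst q \<in> lists S" "snd q \<in> lists (lists S)" "a \<in> S"
      using Cons.IH[of q] q(1) Cons.hyps by auto
    with q(2) c[of a "snd q"] show ?case by auto
  qed simp
qed

lemma set_half_splits: "set (half_splits h w) \<subseteq> set (splits w)"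
  by (cases w) auto

lemma splits_list_letters:
  assumes "ws \<in> lists (lists S)" "p \<in> set (splits_list ws)"
  shows "fst p \<in> lists (lists S) \<and> snd p \<in> lists (lists S)"
  using assms
proof (induction ws arbitrary: p)
  case (Cons w ws)
  then show ?case using splits_letters[of w S]
    by (fastforce simp: set_lprod join_split_def simp del: in_lists_conv_set)
qed simp

lemma set_half_splits_list: "set (half_splits_list h ws) \<subseteq> set (splits_list ws)"
  using set_half_splits by (cases ws) (fastforce simp: set_lprod)+

text \<open>
  Each letter of a word lands in exactly one place of a split, and this place does not depend on the
  letter: this is the reason why sums over splits are multilinear.
\<close>
definition letter_context :: "'a set \<Rightarrow> ('a \<Rightarrow> 'a list \<times> 'a list list) \<Rightarrow> bool"
  where "letter_context S c \<longleftrightarrow>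
    (\<exists>u1\<in>lists S. \<exists>u2\<in>lists S. \<exists>v\<in>lists (lists S). c = (\<lambda>a. (u1 @ a # u2, v))) \<or>
    (\<exists>u\<in>lists S. \<exists>v1\<in>lists (lists S). \<exists>v2\<in>lists (lists S). \<exists>w1\<in>lists S. \<exists>w2\<in>lists S.
       c = (\<lambda>a. (u, v1 @ (w1 @ a # w2) # v2)))"

lemma letter_context_Cons:
  assumes "letter_context S c" "b \<in> S"
  shows "letter_context S (\<lambda>a. (b # fst (c a), [] # snd (c a)))"
    and "letter_context S (\<lambda>a. (fst (c a), cons_hd b (snd (c a))))"
proof -
  consider u1 u2 v where "u1 \<in> lists S" "u2 \<in> lists S" "v \<in> lists (lists S)" "c = (\<lambda>a. (u1 @ a # u2, v))"
    | u v1 v2 w1 w2 where "u \<in> lists S" "v1 \<in> lists (lists S)" "v2 \<in> lists (lists S)"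
        "w1 \<in> lists S" "w2 \<in> lists S" "c = (\<lambda>a. (u, v1 @ (w1 @ a # w2) # v2))"
    using assms(1) unfolding letter_context_def by blast
  note cases = this
  show "letter_context S (\<lambda>a. (b # fst (c a), [] # snd (c a)))"
  proof (cases rule: cases)
    case 1
    then show ?thesis unfolding letter_context_def using assms(2)
      by (intro disjI1 bexI[of _ "b # u1"] bexI[of _ u2] bexI[of _ "[] # v"]) auto
  next
    case 2
    then show ?thesis unfolding letter_context_def using assms(2)
      by (intro disjI2 bexI[of _ "b # u"] bexI[of _ "[] # v1"] bexI[of _ v2] bexI[of _ w1] bexI[of _ w2]) auto
  qed
  show "letter_context S (\<lambda>a. (fst (c a), cons_hd b (snd (c a))))"
  proof (cases rule: cases)
    case 1
    have "cons_hd b v \<in> lists (lists S)" using 1(3) assms(2) by (cases v) auto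
    then show ?thesis unfolding letter_context_def using assms(2) 1
      by (intro disjI1 bexI[of _ u1] bexI[of _ u2] bexI[of _ "cons_hd b v"]) auto
  next
    case 2
    show ?thesis
    proof (cases v1)
      case Nil
      then show ?thesis unfolding letter_context_def using assms(2) 2
        by (intro disjI2 bexI[of _ u] bexI[of _ "[]"] bexI[of _ v2] bexI[of _ "b # w1"] bexI[of _ w2]) auto
    next
      case (Cons v v1')
      then show ?thesis unfolding letter_context_def using assms(2) 2
        by (intro disjI2 bexI[of _ u] bexI[of _ "(b # v) # v1'"] bexI[of _ v2] bexI[of _ w1] bexI[of _ w2]) auto
    qed
  qed
qed

lemma splits_hd_contexts:
  assumes "ys \<in> lists S"
  shows "p \<in> set (splits ys) \<Longrightarrow> letter_context S (\<lambda>a. (a # fst p, [] # snd p))"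
    and "p \<in> set (splits ys) \<Longrightarrow> letter_context S (\<lambda>a. (fst p, cons_hd a (snd p)))"
proof -
  assume p: "p \<in> set (splits ys)"
  note L = splits_letters[OF assms p]
  show "letter_context S (\<lambda>a. (a # fst p, [] # snd p))"
    unfolding letter_context_def using L
    by (intro disjI1 bexI[of _ "[]"] bexI[of _ "fst p"] bexI[of _ "[] # snd p"]) auto
  obtain h t where ht: "snd p = h # t" using splits_gaps_nonempty[OF p] by (cases "snd p") auto
  show "letter_context S (\<lambda>a. (fst p, cons_hd a (snd p)))"
    unfolding letter_context_def using L
    by (intro disjI2 bexI[of _ "fst p"] bexI[of _ "[]"] bexI[of _ t] bexI[of _ "[]"] bexI[of _ h])
      (auto simp: ht)
qed

lemma splits_contexts:
  assumes "xs \<in> lists S" "ys \<in> lists S"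
  shows "\<exists>cs. (\<forall>a. splits (xs @ a # ys) = map (\<lambda>c. c a) cs) \<and> (\<forall>c\<in>set cs. letter_context S c)"
  using assms(1)
proof (induction xs)
  case Nil
  let ?cs = "map (\<lambda>p a. (a # fst p, [] # snd p)) (splits ys) @ map (\<lambda>p a. (fst p, cons_hd a (snd p))) (splits ys)"
  show ?case
    by (rule exI[of _ ?cs]) (use splits_hd_contexts[OF assms(2)] in \<open>auto simp: comp_def\<close>)
next
  case (Cons b xs)
  then obtain cs where cs: "\<And>a. splits (xs @ a # ys) = map (\<lambda>c. c a) cs" "\<forall>c\<in>set cs. letter_context S c"
    by auto
  let ?cs = "map (\<lambda>c a. (b # fst (c a), [] # snd (c a))) cs @ map (\<lambda>c a. (fst (c a), cons_hd b (snd (c a)))) cs"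
  show ?case
    by (rule exI[of _ ?cs])
      (use cs Cons.hyps in \<open>auto simp: comp_def intro!: letter_context_Cons\<close>)
qed

lemma half_splits_contexts:
  assumes "xs \<in> lists S" "ys \<in> lists S"
  shows "\<exists>cs. (\<forall>a. half_splits h (xs @ a # ys) = map (\<lambda>c. c a) cs) \<and> (\<forall>c\<in>set cs. letter_context S c)"
proof (cases xs)
  case Nil
  let ?cs = "(if h True then map (\<lambda>p a. (a # fst p, [] # snd p)) (splits ys) else []) @
    (if h False then map (\<lambda>p a. (fst p, cons_hd a (snd p))) (splits ys) else [])"
  show ?thesis
    by (rule exI[of _ ?cs]) (use splits_hd_contexts[OF assms(2)] Nil in \<open>auto simp: comp_def\<close>)
next
  case (Cons b xs')
  then have xs': "xs' \<in> lists S" and b: "b \<in> S" using assms(1) by auto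
  obtain cs where cs: "\<And>a. splits (xs' @ a # ys) = map (\<lambda>c. c a) cs" "\<forall>c\<in>set cs. letter_context S c"
    using splits_contexts[OF xs' assms(2)] by blast
  let ?cs = "(if h True then map (\<lambda>c a. (b # fst (c a), [] # snd (c a))) cs else []) @
    (if h False then map (\<lambda>c a. (fst (c a), cons_hd b (snd (c a)))) cs else [])"
  show ?thesis
    by (rule exI[of _ ?cs]) (use cs b Cons in \<open>auto simp: comp_def intro!: letter_context_Cons\<close>)
qed


section \<open>Subsets of positions and their complementary runs\<close>

text \<open>
  Selections given by sets of positions, counted from 0; the gaps are those of the corresponding split.
\<close>
fun gaps :: "'a list \<Rightarrow> nat set \<Rightarrow> 'a list list" where
  "gaps [] N = [[]]"
| "gaps (a # w) N =
    (if 0 \<in> N then [] # gaps w {i. Suc i \<in> N} else cons_hd a (gaps w {i. Suc i \<in> N}))"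

lemma Pow_lessThan_Suc:
  "{N. N \<subseteq> {..<Suc n} \<and> h (0 \<in> N)} =
    (if h True then (\<lambda>N. insert 0 (Suc ` N)) ` Pow {..<n} else {}) \<union>
    (if h False then (\<lambda>N. Suc ` N) ` Pow {..<n} else {})"
proof -
  have "N = Suc ` {i. Suc i \<in> N}" "{i. Suc i \<in> N} \<subseteq> {..<n}" if "N \<subseteq> {..<Suc n}" "0 \<notin> N" for N
  proof -
    show "N = Suc ` {i. Suc i \<in> N}"
      using that(2) by (auto simp: image_iff) (metis not0_implies_Suc)
    show "{i. Suc i \<in> N} \<subseteq> {..<n}" using that(1) by auto
  qed
  note 0 = this
  have "N = insert 0 (Suc ` {i. Suc i \<in> N})" "{i. Suc i \<in> N} \<subseteq> {..<n}" if "N \<subseteq> {..<Suc n}" "0 \<in> N" for N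
  proof -
    show "N = insert 0 (Suc ` {i. Suc i \<in> N})"
      using that(2) by (auto simp: image_iff) (metis not0_implies_Suc)
    show "{i. Suc i \<in> N} \<subseteq> {..<n}" using that(1) by auto
  qed
  note 1 = this
  show ?thesis
  proof (intro equalityI subsetI)
    fix N assume N: "N \<in> {N. N \<subseteq> {..<Suc n} \<and> h (0 \<in> N)}"
    show "N \<in> (if h True then (\<lambda>N. insert 0 (Suc ` N)) ` Pow {..<n} else {}) \<union>
      (if h False then (\<lambda>N. Suc ` N) ` Pow {..<n} else {})"
      by (cases "0 \<in> N") (use N 0[of N] 1[of N] in \<open>auto simp: image_iff\<close>)
  qed (auto split: if_splits)
qed

lemma mset_half_splits_step:
  fixes w :: "'a list"
  assumes "image_mset (\<lambda>N. (nths w N, gaps w N)) (mset_set (Pow {..<length w})) = mset (splits w)"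
  shows "image_mset (\<lambda>N. (nths (a # w) N, gaps (a # w) N))
      (mset_set {N. N \<subseteq> {..<length (a # w)} \<and> h (0 \<in> N)}) = mset (half_splits h (a # w))"
proof -
  let ?P = "Pow {..<length w}" and ?f = "\<lambda>N. (nths (a # w) N, gaps (a # w) N)"
  let ?i1 = "\<lambda>N. insert 0 (Suc ` N)" and ?i0 = "\<lambda>N. Suc ` N"
  have inj: "inj_on ?i1 ?P" "inj_on ?i0 ?P"
    by (auto intro!: inj_onI simp: set_eq_iff)
  have s0: "{i. Suc i \<in> Suc ` N} = N" for N
    by auto
  have e1: "image_mset ?f (mset_set (?i1 ` ?P)) = mset (map (\<lambda>p. (a # fst p, [] # snd p)) (splits w))"
    unfolding image_mset_mset_set[OF inj(1), symmetric] multiset.map_comp mset_map assms[symmetric]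
    by (intro image_mset_cong) (simp add: nths_Cons s0)
  have e0: "image_mset ?f (mset_set (?i0 ` ?P)) = mset (map (\<lambda>p. (fst p, cons_hd a (snd p))) (splits w))"
    unfolding image_mset_mset_set[OF inj(2), symmetric] multiset.map_comp mset_map assms[symmetric]
    by (intro image_mset_cong) (simp add: nths_Cons s0 image_iff)
  have disj: "?i1 ` ?P \<inter> ?i0 ` ?P = {}" by auto
  show ?thesis
    unfolding list.size(4) add_Suc_right add_0_right Pow_lessThan_Suc
    using disj e1 e0 by (auto simp: mset_set_Union)
qed

lemma mset_splits_subsets:
  "image_mset (\<lambda>N. (nths w N, gaps w N)) (mset_set (Pow {..<length w})) = mset (splits w)"
proof (induction w)
  case (Cons a w)
  have "Pow {..<length (a # w)} = {N. N \<subseteq> {..<length (a # w)} \<and> (\<lambda>_. True) (0 \<in> N)}" by auto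
  then show ?case
    using mset_half_splits_step[OF Cons, of a "\<lambda>_. True"]
    by (simp only: half_splits_True)
qed simp

lemma mset_half_splits_subsets:
  assumes "w \<noteq> []"
  shows "image_mset (\<lambda>N. (nths w N, gaps w N)) (mset_set {N. N \<subseteq> {..<length w} \<and> h (0 \<in> N)}) =
    mset (half_splits h w)"
proof -
  obtain a v where "w = a # v" using assms by (cases w) auto
  then show ?thesis by (simp only: mset_half_splits_step[OF mset_splits_subsets])
qed


lemma run_Suc:
  assumes "0 \<notin> K"
  shows "{j. Suc i \<le> j \<and> {Suc i..j} \<subseteq> Suc ` K} = Suc ` {j. i \<le> j \<and> {i..j} \<subseteq> K}"
proof -
  have "{Suc i..Suc j} \<subseteq> Suc ` K \<longleftrightarrow> {i..j} \<subseteq> K" for j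
    by (metis image_Suc_atLeastAtMost inj_image_subset_iff inj_Suc)
  note * = this
  show ?thesis
  proof (intro equalityI subsetI)
    fix j assume j: "j \<in> {j. Suc i \<le> j \<and> {Suc i..j} \<subseteq> Suc ` K}"
    then obtain j' where "j = Suc j'" using Suc_le_D by blast
    then show "j \<in> Suc ` {j. i \<le> j \<and> {i..j} \<subseteq> K}" using j *[of j'] by simp
  next
    fix j assume "j \<in> Suc ` {j. i \<le> j \<and> {i..j} \<subseteq> K}"
    then show "j \<in> {j. Suc i \<le> j \<and> {Suc i..j} \<subseteq> Suc ` K}" using * by blast
  qed
qed

lemma run_insert_Suc:
  assumes "1 \<le> i"
  shows "{j. Suc i \<le> j \<and> {Suc i..j} \<subseteq> insert 1 (Suc ` K)} = {j. Suc i \<le> j \<and> {Suc i..j} \<subseteq> Suc ` K}"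
  using assms by auto

lemma run_insert_1:
  assumes "0 \<notin> K"
  shows "{j. 1 \<le> j \<and> {1..j} \<subseteq> insert 1 (Suc ` K)} = insert 1 (Suc ` {j. 1 \<le> j \<and> {1..j} \<subseteq> K})"
proof -
  have "insert 1 (Suc ` X) \<subseteq> insert 1 (Suc ` K) \<longleftrightarrow> X \<subseteq> K" if "0 \<notin> X" for X
    using that by auto
  moreover have "{1..Suc j} = insert 1 (Suc ` {1..j})" for j by auto
  ultimately have "{1..Suc j} \<subseteq> insert 1 (Suc ` K) \<longleftrightarrow> {1..j} \<subseteq> K" for j
    by (metis atLeastAtMost_iff not_one_le_zero)
  note * = this
  show ?thesis
  proof (intro equalityI subsetI)
    fix j assume j: "j \<in> {j. 1 \<le> j \<and> {1..j} \<subseteq> insert 1 (Suc ` K)}"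
    then obtain j' where j': "j = Suc j'" by (cases j) auto
    then show "j \<in> insert 1 (Suc ` {j. 1 \<le> j \<and> {1..j} \<subseteq> K})"
      using j *[of j'] by (cases j') auto
  next
    fix j assume "j \<in> insert 1 (Suc ` {j. 1 \<le> j \<and> {1..j} \<subseteq> K})"
    then show "j \<in> {j. 1 \<le> j \<and> {1..j} \<subseteq> insert 1 (Suc ` K)}"
      using * by auto
  qed
qed

lemma sorted_list_of_set_Suc:
  assumes "finite K"
  shows "sorted_list_of_set (Suc ` K) = map Suc (sorted_list_of_set K)"
    and "0 \<notin> K \<Longrightarrow> sorted_list_of_set (insert 1 (Suc ` K)) = 1 # map Suc (sorted_list_of_set K)"
proof -
  let ?xs = "map Suc (sorted_list_of_set K)"
  have xs: "set ?xs = Suc ` K" using assms by simp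
  have sorted: "sorted ?xs" "distinct ?xs" by (auto simp: distinct_map sorted_map)
  then show "sorted_list_of_set (Suc ` K) = ?xs"
    using sorted_list_of_set.idem_if_sorted_distinct[of ?xs] xs by simp
  assume "0 \<notin> K"
  then have "sorted (1 # ?xs)" "distinct (1 # ?xs)" using sorted assms by auto
  then show "sorted_list_of_set (insert 1 (Suc ` K)) = 1 # ?xs"
    using sorted_list_of_set.idem_if_sorted_distinct[of "1 # ?xs"] assms by simp
qed

lemma runs_Suc:
  assumes "finite K" "0 \<notin> K"
  shows "runs (Suc ` K) = map ((`) Suc) (runs K)"
proof -
  have "{i \<in> Suc ` K. i - 1 \<notin> Suc ` K} = Suc ` {i \<in> K. i - 1 \<notin> K}"
    using assms(2) by (auto simp: image_iff) (metis Suc_pred bot_nat_0.not_eq_extremum)+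
  then show ?thesis
    using assms by (simp add: runs_def sorted_list_of_set_Suc run_Suc)
qed

lemma runs_insert:
  assumes "finite K" "0 \<notin> K"
  shows "runs (insert 1 (Suc ` K)) =
    (if 1 \<in> K then insert 1 (Suc ` hd (runs K)) # map ((`) Suc) (tl (runs K))
     else {1} # map ((`) Suc) (runs K))"
    and "1 \<in> K \<Longrightarrow> runs K \<noteq> []"
proof -
  let ?S = "{i \<in> K. i - 1 \<notin> K}"
  let ?run = "\<lambda>i. {j. i \<le> j \<and> {i..j} \<subseteq> K}"
  let ?rest = "sorted_list_of_set (?S - {1})"
  \<comment> \<open>a run of \<open>K\<close> that starts at 1 is absorbed into the run that now starts at 1\<close>
  have starts: "{i \<in> insert 1 (Suc ` K). i - 1 \<notin> insert 1 (Suc ` K)} = insert 1 (Suc ` (?S - {1}))"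
    using assms(2) by (auto simp: image_iff) (metis Suc_pred bot_nat_0.not_eq_extremum)+
  have fin: "finite (?S - {1})" "0 \<notin> ?S - {1}" using assms by auto
  have run1: "{j. Suc 0 \<le> j \<and> {Suc 0..j} \<subseteq> insert (Suc 0) (Suc ` K)} = insert (Suc 0) (Suc ` ?run 1)"
    using run_insert_1[OF assms(2)] by simp
  have "{j. Suc i \<le> j \<and> {Suc i..j} \<subseteq> insert 1 (Suc ` K)} = Suc ` ?run i" if "i \<in> ?S - {1}" for i
  proof -
    have "1 \<le> i" using that assms(2) by (cases i) auto
    then show ?thesis using run_insert_Suc[of i K] run_Suc[OF assms(2)] by simp
  qed
  then have L: "runs (insert 1 (Suc ` K)) = insert 1 (Suc ` ?run 1) # map (\<lambda>i. Suc ` ?run i) ?rest"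
    unfolding runs_def starts sorted_list_of_set_Suc(2)[OF fin] list.map
    using fin run1 by (simp add: comp_def)
  have R: "runs K = (if 1 \<in> K then [?run 1] else []) @ map ?run ?rest"
  proof (cases "1 \<in> K")
    case True
    have "?S = insert 1 (?S - {1})" using True assms(2) by auto
    moreover have "sorted_list_of_set (insert 1 (?S - {1})) = 1 # ?rest"
    proof -
      have "1 \<le> i" if "i \<in> ?S - {1}" for i using that assms(2) by (cases i) auto
      then have "sorted (1 # ?rest)" "distinct (1 # ?rest)" using fin(1) by auto
      then show ?thesis
        using sorted_list_of_set.idem_if_sorted_distinct[of "1 # ?rest"] fin(1) by simp
    qed
    ultimately have "sorted_list_of_set ?S = 1 # ?rest" by simp
    then show ?thesis using True by (simp add: runs_def)
  next
    case False
    then have "?S - {1} = ?S" by auto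
    then show ?thesis using False by (simp add: runs_def)
  qed
  show "runs (insert 1 (Suc ` K)) =
    (if 1 \<in> K then insert 1 (Suc ` hd (runs K)) # map ((`) Suc) (tl (runs K))
     else {1} # map ((`) Suc) (runs K))"
  proof (cases "1 \<in> K")
    case True
    then show ?thesis unfolding L R by (simp add: comp_def)
  next
    case False
    have run1: "insert 1 (Suc ` ?run 1) = {1}" using False by force
    show ?thesis unfolding L R run1 using False by (simp add: comp_def)
  qed
  show "1 \<in> K \<Longrightarrow> runs K \<noteq> []" unfolding R by simp
qed

lemma runs_zero: "0 \<notin> K \<Longrightarrow> J \<in> set (runs K) \<Longrightarrow> 0 \<notin> J"
  by (cases "finite {i \<in> K. i - 1 \<notin> K}") (auto simp: runs_def)

lemma subword_Suc: "0 \<notin> J \<Longrightarrow> subword (a # w) (Suc ` J) = subword w J"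
proof -
  assume "0 \<notin> J"
  moreover have "{i. Suc i \<in> Suc ` J} = J" by auto
  ultimately show ?thesis by (simp add: subword_def nths_Cons)
qed

lemma subword_insert: "subword (a # w) (insert 1 (Suc ` J)) = a # subword w J"
proof -
  have "{i. Suc i \<in> insert 1 (Suc ` J)} = insert 0 J" by auto
  then show ?thesis by (simp add: subword_def nths_Cons)
qed

lemma hd_gaps: "hd (gaps w N) = [] \<longleftrightarrow> w = [] \<or> 0 \<in> N"
  by (cases w; cases "gaps (tl w) {i. Suc i \<in> N}") auto

lemma gaps_nonempty: "gaps w N \<noteq> []"
  by (cases w) auto

lemma runs_empty: "runs {} = []"
  by (simp add: runs_def)

text \<open>
  Prepending a letter shifts all positions by one. A letter that is left out extends the first run if
  the next letter is left out as well, and forms a new run otherwise; correspondingly it is added to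
  a nonempty or to an empty first gap.
\<close>
lemma filter_gaps_runs:
  "filter (\<lambda>v. v \<noteq> []) (gaps w N) = map (subword w) (runs (Suc ` ({..<length w} - N)))"
proof (induction w arbitrary: N)
  case Nil
  show ?case by (simp add: runs_empty)
next
  case (Cons a w)
  define N' where "N' = {i. Suc i \<in> N}"
  define K where "K = Suc ` ({..<length w} - N')"
  have K: "finite K" "0 \<notin> K" by (auto simp: K_def)
  have K1: "1 \<in> K \<longleftrightarrow> w \<noteq> [] \<and> 0 \<notin> N'" by (auto simp: K_def)
  have compl: "Suc ` ({..<Suc (length w)} - N) = (if 0 \<in> N then Suc ` K else insert 1 (Suc ` K))"
    by (auto simp: K_def N'_def image_iff) (metis lessThan_iff less_Suc_eq_0_disj DiffI mem_Collect_eq)+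
  have IH: "filter (\<lambda>v. v \<noteq> []) (gaps w N') = map (subword w) (runs K)"
    unfolding K_def by (rule Cons)
  have sub: "map (subword (a # w)) (map ((`) Suc) Js) = map (subword w) Js" if "set Js \<subseteq> set (runs K)" for Js
    using that runs_zero[OF K(2)] by (auto simp: subword_Suc)
  show ?case
  proof (cases "0 \<in> N")
    case True
    then show ?thesis
      using IH sub[of "runs K"] by (simp add: compl runs_Suc[OF K] N'_def[symmetric])
  next
    case False
    obtain h t where ht: "gaps w N' = h # t" using gaps_nonempty by (cases "gaps w N'") auto
    show ?thesis
    proof (cases "1 \<in> K")
      case True
      then obtain J Js where J: "runs K = J # Js" using runs_insert(2)[OF K] by (cases "runs K") auto
      have "h \<noteq> []" using True K1 hd_gaps[of w N'] ht by simp
      then have "h = subword w J" "filter (\<lambda>v. v \<noteq> []) t = map (subword w) Js"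
        using IH ht J by auto
      moreover have "set Js \<subseteq> set (runs K)" using J by auto
      ultimately show ?thesis
        using False True sub[of Js] subword_insert[of a w J]
        by (simp add: compl runs_insert[OF K] N'_def[symmetric] ht J del: One_nat_def)
    next
      case f: False
      have "h = []" using f K1 hd_gaps[of w N'] ht by simp
      then show ?thesis
        using False f sub[of "runs K"] subword_insert[of a w "{}"] IH
        by (simp add: compl runs_insert[OF K] N'_def[symmetric] ht subword_def del: One_nat_def)
    qed
  qed
qed


section \<open>The coproducts as sums over splits\<close>

lemma (in ring) lsum_lprod_mult:
  assumes "\<And>x. x \<in> set xs \<Longrightarrow> f x \<in> carrier R" "\<And>y. y \<in> set ys \<Longrightarrow> g y \<in> carrier R"
    and "\<And>x y. x \<in> set xs \<Longrightarrow> y \<in> set ys \<Longrightarrow> h (m x y) = f x \<otimes> g y"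
  shows "lsum R h (lprod m xs ys) = lsum R f xs \<otimes> lsum R g ys"
  using assms
proof (induction xs)
  case (Cons x xs)
  have "lsum R h (map (m x) ys) = f x \<otimes> lsum R g ys"
    using Cons.prems(2,3) Cons.prems(1)[of x] by (induction ys) (auto simp: r_distr)
  moreover have "lsum R h (lprod m (x # xs) ys) = lsum R h (map (m x) ys) \<oplus> lsum R h (lprod m xs ys)"
    unfolding lprod_Cons by (rule lsum_append) (use Cons.prems in \<open>auto simp: set_lprod\<close>)
  ultimately show ?case using Cons by (simp add: l_distr)
qed simp

lemma (in abelian_monoid) finsum_eq_lsum:
  assumes "finite I" "\<And>x. x \<in> I \<Longrightarrow> F (g x) \<in> carrier G" "image_mset g (mset_set I) = mset zs"
  shows "finsum G (\<lambda>x. F (g x)) I = lsum G F zs"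
proof -
  obtain xs where xs: "set xs = I" "distinct xs" using finite_distinct_list[OF assms(1)] by blast
  have "finsum G (\<lambda>x. F (g x)) (set xs) = lsum G (\<lambda>x. F (g x)) xs"
    using xs(2) assms(2) unfolding xs(1)[symmetric] by (induction xs) auto
  also have "\<dots> = lsum G F (map g xs)" by (simp add: lsum_map)
  also have "\<dots> = lsum G F zs"
    by (rule lsum_mset_cong) (use assms(2,3) xs mset_set_set[OF xs(2)] in auto)
  finally show ?thesis using xs(1) by simp
qed

locale double_tensor_algebra =
  fixes R :: "('k, 'r) ring_scheme" and A :: "('k, 'a, 'm) module_scheme"
  assumes A_module: "module R A"
begin

abbreviation "TA \<equiv> T R A"
abbreviation "D \<equiv> TTbar R A"
abbreviation "D2 \<equiv> tensor R D D"
abbreviation "D3 \<equiv> tensor R D D2"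
abbreviation "C \<equiv> carrier (TT R A)"
abbreviation "L \<equiv> lists (lists (carrier A))"

lemma T_module: "module R TA"
  unfolding T_def by (rule tensor_algebra_pos_module[OF A_module])

lemma D_algebra: "assoc_algebra R D"
  unfolding TTbar_def by (rule tensor_algebra_assoc_algebra[OF T_module])

lemma D2_algebra: "assoc_algebra R D2"
  by (rule tensor_assoc_algebra[OF D_algebra D_algebra])

lemmas D_module = assoc_algebra.axioms(1)[OF D_algebra]
lemmas D2_module = assoc_algebra.axioms(1)[OF D2_algebra]
lemmas D3_module = tensor_module[OF D_module D2_module]

sublocale D: assoc_algebra R D by (rule D_algebra)
sublocale D2: assoc_algebra R D2 by (rule D2_algebra)
sublocale D3: module R D3 by (rule D3_module)

lemma C_submodule: "submodule C R D"
  unfolding TT_def TTbar_def by (rule tensor_algebra_pos_submodule[OF T_module])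

lemma C_subset: "C \<subseteq> carrier D"
  unfolding TT_def TTbar_def by (rule tensor_algebra_pos_subset[OF T_module])

lemma TT_carrier_update: "TT R A = D\<lparr>carrier := C\<rparr>"
  unfolding TT_def TTbar_def by (rule tensor_algebra_pos_carrier_update[OF T_module])

lemma TT_module: "module R (TT R A)"
  unfolding TT_def by (rule tensor_algebra_pos_module[OF T_module])

lemma tens_D_closed: "x \<in> carrier D \<Longrightarrow> y \<in> carrier D \<Longrightarrow> tens R D D x y \<in> carrier D2"
  by (rule tens_closed[OF D_module D_module])

lemmas tens_D_bilinear = tens_bilinear[OF D_module D_module]

lemma word_D_closed: "xs \<in> lists (carrier TA) \<Longrightarrow> word R TA xs \<in> carrier D"
  unfolding TTbar_def by (rule word_closed[OF T_module])

lemma word_C_closed: "xs \<in> lists (carrier TA) \<Longrightarrow> xs \<noteq> [] \<Longrightarrow> word R TA xs \<in> C"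
  unfolding TT_def by (rule word_pos_closed[OF T_module])

lemma word_T_closed: "as \<in> lists (carrier A) \<Longrightarrow> as \<noteq> [] \<Longrightarrow> word R A as \<in> carrier TA"
  unfolding T_def by (rule word_pos_closed[OF A_module])

lemma D_one: "\<one>\<^bsub>D\<^esub> = word R TA []"
  unfolding TTbar_def by (rule tensor_algebra_one[OF T_module])

lemma D_word_mult: "xs \<in> lists (carrier TA) \<Longrightarrow> ys \<in> lists (carrier TA) \<Longrightarrow>
    word R TA xs \<otimes>\<^bsub>D\<^esub> word R TA ys = word R TA (xs @ ys)"
  unfolding TTbar_def by (rule word_mult[OF T_module])

lemma D_word_spanned: "spanned R D (word R TA ` lists (carrier TA))"
  unfolding TTbar_def by (rule tensor_algebra_spanned[OF T_module])

lemma TT_word_spanned: "spanned R (TT R A) (word R TA ` (lists (carrier TA) - {[]}))"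
  unfolding TT_def by (rule tensor_algebra_pos_spanned[OF T_module])

text \<open>The bar word of a list of words, in which empty words count as the unit.\<close>
definition "bword ws = bar_word R A (filter (\<lambda>w. w \<noteq> []) ws)"

lemma bword_eq: "bword ws = word R TA (map (word R A) (filter (\<lambda>w. w \<noteq> []) ws))"
  by (simp add: bword_def bar_word_def)

lemma map_word_closed:
  "ws \<in> L \<Longrightarrow> map (word R A) (filter (\<lambda>w. w \<noteq> []) ws) \<in> lists (carrier TA)"
proof -
  assume "ws \<in> L"
  then have "word R A w \<in> carrier TA" if "w \<in> set ws" "w \<noteq> []" for w
    using that word_T_closed[of w] in_listsD[of ws "lists (carrier A)"] by blast
  then show ?thesis unfolding lists_eq_set by auto
qed

lemma bword_closed [simp]: "ws \<in> L \<Longrightarrow> bword ws \<in> carrier D"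
  unfolding bword_eq by (rule word_D_closed[OF map_word_closed])

lemma bword_append: "us \<in> L \<Longrightarrow> vs \<in> L \<Longrightarrow> bword (us @ vs) = bword us \<otimes>\<^bsub>D\<^esub> bword vs"
  unfolding bword_eq by (simp add: D_word_mult map_word_closed)

lemma bword_concat_Nil: "concat ws = [] \<Longrightarrow> bword ws = \<one>\<^bsub>D\<^esub>"
  by (simp add: bword_eq D_one)

lemma bword_Cons_Nil: "bword ([] # ws) = bword ws"
  by (simp add: bword_eq)

lemma bword_C: "ws \<in> L \<Longrightarrow> concat ws \<noteq> [] \<Longrightarrow> bword ws \<in> C"
  unfolding bword_eq by (rule word_C_closed[OF map_word_closed]) (auto simp: filter_empty_conv)

lemma T_spanned: "spanned R TA (word R A ` (lists (carrier A) - {[]}))"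
  unfolding T_def by (rule tensor_algebra_pos_spanned[OF A_module])

lemma bar_words_of_words:
  "word R TA ` lists (word R A ` (lists (carrier A) - {[]})) = bword ` lists (lists (carrier A) - {[]})"
proof -
  have "bword ws = word R TA (map (word R A) ws)" if "ws \<in> lists (lists (carrier A) - {[]})" for ws
  proof -
    have "filter (\<lambda>w. w \<noteq> []) ws = ws" using that by (auto intro: filter_True)
    then show ?thesis by (simp add: bword_eq)
  qed
  then show ?thesis unfolding lists_image image_image by (intro image_cong) auto
qed

lemma D_spanned: "spanned R D (bword ` L)"
proof -
  have "spanned R D (bword ` lists (lists (carrier A) - {[]}))"
    using tensor_algebra_spanned_by[OF T_module T_spanned]
    unfolding bar_words_of_words TTbar_def .
  moreover have "bword ` lists (lists (carrier A) - {[]}) \<subseteq> bword ` L" by blast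
  moreover have "bword ` L \<subseteq> carrier D" by (intro image_subsetI bword_closed)
  ultimately show ?thesis by (rule spanned_mono)
qed

lemma TT_spanned: "spanned R (TT R A) (bword ` {ws \<in> L. ws \<noteq> [] \<and> hd ws \<noteq> []})"
proof -
  let ?X = "word R A ` (lists (carrier A) - {[]})"
  let ?W = "{ws \<in> L. ws \<noteq> [] \<and> hd ws \<noteq> []}"
  have sp: "spanned R (TT R A) (word R TA ` (lists ?X - {[]}))"
    using tensor_algebra_pos_spanned_by[OF T_module T_spanned] unfolding TT_def .
  have "word R TA ` (lists ?X - {[]}) \<subseteq> bword ` ?W"
  proof
    fix y assume "y \<in> word R TA ` (lists ?X - {[]})"
    then obtain ws where ws: "ws \<in> lists (lists (carrier A) - {[]})" "ws \<noteq> []"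
      and y: "y = word R TA (map (word R A) ws)"
      unfolding lists_image by auto
    have "filter (\<lambda>w. w \<noteq> []) ws = ws" using ws(1) by (auto intro: filter_True)
    then have "y = bword ws" by (simp add: y bword_eq)
    moreover have "ws \<in> ?W" using ws by (cases ws) auto
    ultimately show "y \<in> bword ` ?W" by blast
  qed
  moreover have "bword ` ?W \<subseteq> C"
  proof
    fix y assume "y \<in> bword ` ?W"
    then obtain ws where "ws \<in> L" "ws \<noteq> []" "hd ws \<noteq> []" "y = bword ws" by auto
    moreover from this have "concat ws \<noteq> []" by (cases ws) auto
    ultimately show "y \<in> C" using bword_C by simp
  qed
  ultimately show ?thesis by (rule spanned_mono[OF sp])
qed

definition "pure \<beta> p = tens R D D (\<beta> (fst p)) (\<beta> (snd p))"

text \<open>The tensor of a split of a single word, whose selected part is one word and not a list of words.\<close>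
definition "split_tens p = pure bword ([fst p], snd p)"

lemma pure_closed: "(\<And>ws. ws \<in> L \<Longrightarrow> \<beta> ws \<in> carrier D) \<Longrightarrow> fst p \<in> L \<Longrightarrow> snd p \<in> L \<Longrightarrow>
    pure \<beta> p \<in> carrier D2"
  unfolding pure_def by (rule tens_D_closed) blast+

lemma split_tens_closed:
  "as \<in> lists (carrier A) \<Longrightarrow> p \<in> set (half_splits h as) \<Longrightarrow> split_tens p \<in> carrier D2"
  unfolding split_tens_def
  by (rule pure_closed) (use splits_letters[of as "carrier A" p] set_half_splits[of h as] in auto)

text \<open>
  A single letter varies inside a word that in turn varies inside a bar word, so multilinearity is used
  on both levels.
\<close>
lemma bword_letter_linear:
  assumes "v1 \<in> L" "v2 \<in> L" "w1 \<in> lists (carrier A)" "w2 \<in> lists (carrier A)"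
  shows "(\<lambda>a. bword (v1 @ (w1 @ a # w2) # v2)) \<in> linear_maps R A D"
proof -
  have 1: "(\<lambda>a. word R A (w1 @ a # w2)) \<in> linear_maps R A TA"
    unfolding T_def by (rule word_pos_linear[OF A_module assms(3,4)])
  have 2: "(\<lambda>x. word R TA (map (word R A) (filter (\<lambda>w. w \<noteq> []) v1) @ x #
      map (word R A) (filter (\<lambda>w. w \<noteq> []) v2))) \<in> linear_maps R TA D"
    unfolding TTbar_def
    by (rule multilinearD[OF word_multilinear[OF T_module]]) (rule map_word_closed assms)+
  from linear_maps_compose[OF 1 2] show ?thesis by (simp add: bword_eq)
qed

lemma letter_context_linear:
  assumes "letter_context (carrier A) c"
  shows "(\<lambda>a. split_tens (c a)) \<in> linear_maps R A D2"
proof -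
  consider u1 u2 v where "u1 \<in> lists (carrier A)" "u2 \<in> lists (carrier A)" "v \<in> L" "c = (\<lambda>a. (u1 @ a # u2, v))"
    | u v1 v2 w1 w2 where "u \<in> lists (carrier A)" "v1 \<in> L" "v2 \<in> L"
        "w1 \<in> lists (carrier A)" "w2 \<in> lists (carrier A)" "c = (\<lambda>a. (u, v1 @ (w1 @ a # w2) # v2))"
    using assms unfolding letter_context_def by blast
  then show ?thesis
  proof cases
    case 1
    have "(\<lambda>a. bword ([] @ (u1 @ a # u2) # [])) \<in> linear_maps R A D"
      by (rule bword_letter_linear) (use 1 in auto)
    from linear_maps_compose[OF this bilinearD(1)[OF tens_D_bilinear bword_closed[OF 1(3)]]]
    show ?thesis by (simp add: split_tens_def pure_def 1(4))
  next
    case 2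
    have "bword [u] \<in> carrier D" using 2(1) by simp
    from linear_maps_compose[OF bword_letter_linear[OF 2(2-5)] bilinearD(2)[OF tens_D_bilinear this]]
    show ?thesis by (simp add: split_tens_def pure_def 2(6))
  qed
qed

lemma coproduct_letters_eq:
  assumes as: "as \<in> lists (carrier A)" "as \<noteq> []"
  shows "coproduct_letters R A (\<lambda>S. h (1 \<in> S)) as = lsum D2 split_tens (half_splits h as)"
proof -
  let ?n = "length as"
  let ?N = "{N. N \<subseteq> {..<?n} \<and> h (0 \<in> N)}"
  let ?f = "\<lambda>S. tens R D D (bar_word R A (if S = {} then [] else [subword as S]))
         (bar_word R A (map (subword as) (runs ({1..?n} - S))))"
  have sets: "{S. S \<subseteq> {1..?n} \<and> h (1 \<in> S)} = (`) Suc ` ?N"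
  proof (intro equalityI subsetI)
    fix S assume S: "S \<in> {S. S \<subseteq> {1..?n} \<and> h (1 \<in> S)}"
    have "S = Suc ` {i. Suc i \<in> S}"
      using S by (auto simp: image_iff) (metis Suc_le_D atLeastAtMost_iff subsetD One_nat_def)
    moreover have "{i. Suc i \<in> S} \<in> ?N" using S by auto
    ultimately show "S \<in> (`) Suc ` ?N" by blast
  qed (auto simp: image_iff)
  have f: "?f (Suc ` N) = split_tens (nths as N, gaps as N)" if N: "N \<subseteq> {..<?n}" for N
  proof -
    have "{i. Suc i \<in> Suc ` N} = N" by auto
    then have sub: "subword as (Suc ` N) = nths as N" by (simp add: subword_def)
    have "nths as N = [] \<longleftrightarrow> N = {}"
    proof
      assume "nths as N = []"
      then have "set (nths as N) = {}" by simp
      then show "N = {}" using N by (auto simp: set_nths)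
    qed simp
    then have "bar_word R A (if Suc ` N = {} then [] else [subword as (Suc ` N)]) = bword [nths as N]"
      by (simp add: sub bword_def)
    moreover have "{1..?n} - Suc ` N = Suc ` ({..<?n} - N)"
      by (auto simp: image_iff) (metis Suc_le_D lessThan_iff less_eq_Suc_le DiffI)
    then have "bar_word R A (map (subword as) (runs ({1..?n} - Suc ` N))) = bword (gaps as N)"
      by (simp add: bword_def filter_gaps_runs)
    ultimately show ?thesis by (simp add: split_tens_def pure_def)
  qed
  have m: "image_mset (\<lambda>N. (nths as N, gaps as N)) (mset_set ?N) = mset (half_splits h as)"
    by (rule mset_half_splits_subsets[OF as(2)])
  have fin: "finite ?N" by (rule finite_subset[of _ "Pow {..<?n}"]) auto
  have cl: "split_tens (nths as N, gaps as N) \<in> carrier D2" if "N \<in> ?N" for N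
  proof -
    have "(nths as N, gaps as N) \<in># mset (half_splits h as)"
      unfolding m[symmetric] using that fin by simp
    then show ?thesis using split_tens_closed[OF as(1)] by simp
  qed
  have "coproduct_letters R A (\<lambda>S. h (1 \<in> S)) as = finsum D2 ?f ((`) Suc ` ?N)"
    unfolding coproduct_letters_def sets ..
  also have "\<dots> = finsum D2 (\<lambda>N. ?f (Suc ` N)) ?N"
    by (rule D2.finsum_reindex) (use cl f in \<open>auto intro!: inj_onI simp: inj_image_eq_iff\<close>)
  also have "\<dots> = finsum D2 (\<lambda>N. split_tens (nths as N, gaps as N)) ?N"
    by (rule D2.finsum_cong') (use cl f in auto)
  also have "\<dots> = lsum D2 split_tens (half_splits h as)"
    by (rule D2.finsum_eq_lsum[OF fin _ m]) (rule cl)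
  finally show ?thesis .
qed

text \<open>
  The splits of a word with a varying letter are enumerated by places for that letter, and the tensor
  of each of them is linear in the letter.
\<close>
lemma half_splits_sum_linear:
  assumes "xs \<in> lists (carrier A)" "ys \<in> lists (carrier A)"
  shows "(\<lambda>a. lsum D2 split_tens (half_splits h (xs @ a # ys))) \<in> linear_maps R A D2"
proof -
  obtain cs where cs: "\<And>a. half_splits h (xs @ a # ys) = map (\<lambda>c. c a) cs"
    "\<forall>c\<in>set cs. letter_context (carrier A) c"
    using half_splits_contexts[OF assms] by metis
  have "(\<lambda>a. lsum D2 (\<lambda>c. split_tens (c a)) cs) \<in> linear_maps R A D2"
    by (rule linear_maps_lsum_fun[OF D2_module, of cs "\<lambda>c a. split_tens (c a)"])
      (rule letter_context_linear[OF bspec[OF cs(2)]])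
  then show ?thesis unfolding cs(1) lsum_map .
qed

abbreviation "coprod_word h \<equiv> coproduct_T R A (\<lambda>S. h (1 \<in> S))"

lemma
  shows coprod_word_linear: "coprod_word h \<in> linear_maps R TA D2"
    and coprod_word_word: "as \<in> lists (carrier A) \<Longrightarrow> as \<noteq> [] \<Longrightarrow>
      coprod_word h (word R A as) = lsum D2 split_tens (half_splits h as)"
proof -
  have I: "{as. as \<in> lists (carrier A) \<and> as \<noteq> []} = lists (carrier A) - {[]}" by auto
  obtain \<psi> where \<psi>: "\<psi> \<in> linear_maps R (tensor_algebra R A) D2"
    "\<And>as. as \<in> lists (carrier A) \<Longrightarrow> as \<noteq> [] \<Longrightarrow> \<psi> (word R A as) = lsum D2 split_tens (half_splits h as)"
    using tensor_algebra_pos_lift[OF A_module D2_module,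
        of "\<lambda>as. lsum D2 split_tens (half_splits h as)", OF half_splits_sum_linear[of _ _ h]]
    by metis
  have \<psi>T: "\<psi> \<in> linear_maps R TA D2"
    unfolding T_def by (rule linear_maps_pos[OF A_module \<psi>(1)])
  have val: "\<psi> (word R A as) = coproduct_letters R A (\<lambda>S. h (1 \<in> S)) as"
    if "as \<in> lists (carrier A) - {[]}" for as
  proof -
    have as: "as \<in> lists (carrier A)" "as \<noteq> []" using that by auto
    show ?thesis unfolding \<psi>(2)[OF as] coproduct_letters_eq[OF as] ..
  qed
  have eq: "coprod_word h x = \<psi> x" if "x \<in> carrier TA" for x
    unfolding coproduct_T_def I
    by (rule linear_extension_eq[OF T_module D2_module T_spanned \<psi>T val that])
  show "coprod_word h \<in> linear_maps R TA D2"
    by (rule iffD2[OF linear_maps_cong[OF T_module eq] \<psi>T])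
  show "coprod_word h (word R A as) = lsum D2 split_tens (half_splits h as)"
    if "as \<in> lists (carrier A)" "as \<noteq> []"
    unfolding eq[OF word_T_closed[OF that]] by (rule \<psi>(2)[OF that])
qed

lemma coproduct_list_Nil [simp]: "coproduct_list R A [] = \<one>\<^bsub>D2\<^esub>"
  and coproduct_list_Cons [simp]:
    "coproduct_list R A (w # ws) = coprod_word (\<lambda>_. True) w \<otimes>\<^bsub>D2\<^esub> coproduct_list R A ws"
  by (simp_all add: coproduct_list_def)

lemma coproduct_list_closed [simp]: "ws \<in> lists (carrier TA) \<Longrightarrow> coproduct_list R A ws \<in> carrier D2"
  by (induction ws) (auto intro!: linear_maps_closed[OF coprod_word_linear])

lemma coproduct_list_append:
  "xs \<in> lists (carrier TA) \<Longrightarrow> ys \<in> lists (carrier TA) \<Longrightarrow>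
    coproduct_list R A (xs @ ys) = coproduct_list R A xs \<otimes>\<^bsub>D2\<^esub> coproduct_list R A ys"
proof (induction xs)
  case (Cons x xs)
  have "coprod_word (\<lambda>_. True) x \<in> carrier D2"
    by (rule linear_maps_closed[OF coprod_word_linear]) (use Cons in auto)
  then show ?case using Cons by (simp add: D2.m_assoc del: in_lists_conv_set)
qed simp

lemma coproduct_list_linear:
  assumes "xs \<in> lists (carrier TA)" "ys \<in> lists (carrier TA)"
  shows "(\<lambda>w. coproduct_list R A (xs @ w # ys)) \<in> linear_maps R TA D2"
proof -
  have "(\<lambda>w. coproduct_list R A xs \<otimes>\<^bsub>D2\<^esub>
      (coprod_word (\<lambda>_. True) w \<otimes>\<^bsub>D2\<^esub> coproduct_list R A ys)) \<in> linear_maps R TA D2"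
    by (rule linear_maps_compose[OF linear_maps_compose[OF coprod_word_linear
          D2.mult_linear(2)] D2.mult_linear(1)]) (use assms in simp_all)
  then show ?thesis
    by (rule iffD1[OF linear_maps_cong[OF T_module], rotated])
      (use assms in \<open>simp add: coproduct_list_append\<close>)
qed

lemma
  shows coproduct_linear: "coproduct R A \<in> linear_maps R D D2"
    and coproduct_word: "ws \<in> lists (carrier TA) \<Longrightarrow> coproduct R A (word R TA ws) = coproduct_list R A ws"
proof -
  have "multilinear R TA D2 (coproduct_list R A)"
    by (intro multilinearI coproduct_list_linear) simp_all
  from tensor_algebra_lift[OF T_module D2_module this] obtain \<psi> where
    \<psi>: "\<psi> \<in> linear_maps R D D2" "\<And>ws. ws \<in> lists (carrier TA) \<Longrightarrow> \<psi> (word R TA ws) = coproduct_list R A ws"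
    unfolding TTbar_def by metis
  have eq: "coproduct R A x = \<psi> x" if "x \<in> carrier D" for x
    unfolding coproduct_def
    by (rule linear_extension_eq[OF D_module D2_module D_word_spanned \<psi> that])
  show "coproduct R A \<in> linear_maps R D D2"
    by (rule iffD2[OF linear_maps_cong[OF D_module eq] \<psi>(1)])
  show "coproduct R A (word R TA ws) = coproduct_list R A ws" if "ws \<in> lists (carrier TA)"
    unfolding eq[OF word_D_closed[OF that]] by (rule \<psi>(2)[OF that])
qed

text \<open>A linear extension of \<open>\<Delta>\<^sup>+\<close> to the whole bialgebra, with an arbitrary value at the unit.\<close>
definition "half_ext h = (SOME H. H \<in> linear_maps R D D2 \<and>
    (\<forall>w\<in>carrier TA. \<forall>ws\<in>lists (carrier TA).
      H (word R TA (w # ws)) = coprod_word h w \<otimes>\<^bsub>D2\<^esub> coproduct_list R A ws))"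

lemma
  shows half_ext_linear: "half_ext h \<in> linear_maps R D D2"
    and half_ext_word: "w \<in> carrier TA \<Longrightarrow> ws \<in> lists (carrier TA) \<Longrightarrow>
      half_ext h (word R TA (w # ws)) = coprod_word h w \<otimes>\<^bsub>D2\<^esub> coproduct_list R A ws"
proof -
  let ?\<phi> = "\<lambda>ws. coprod_word h (hd ws) \<otimes>\<^bsub>D2\<^esub> coproduct_list R A (tl ws)"
  have lin: "(\<lambda>w. ?\<phi> (xs @ w # ys)) \<in> linear_maps R TA D2"
    if xs: "xs \<in> lists (carrier TA)" and ys: "ys \<in> lists (carrier TA)" for xs ys
  proof (cases xs)
    case Nil
    then show ?thesis
      using linear_maps_compose[OF coprod_word_linear D2.mult_linear(2)[OF coproduct_list_closed[OF ys]]]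
      by simp
  next
    case (Cons x xs')
    have "coprod_word h x \<in> carrier D2"
      by (rule linear_maps_closed[OF coprod_word_linear]) (use Cons xs in auto)
    from linear_maps_compose[OF coproduct_list_linear[of xs' ys] D2.mult_linear(1)[OF this]]
    show ?thesis using xs ys by (simp add: Cons)
  qed
  have "\<exists>H. H \<in> linear_maps R D D2 \<and>
    (\<forall>w\<in>carrier TA. \<forall>ws\<in>lists (carrier TA).
      H (word R TA (w # ws)) = coprod_word h w \<otimes>\<^bsub>D2\<^esub> coproduct_list R A ws)"
  proof -
    obtain H where H: "H \<in> linear_maps R D D2"
      and Hw: "\<And>ws. ws \<in> lists (carrier TA) \<Longrightarrow> ws \<noteq> [] \<Longrightarrow> H (word R TA ws) = ?\<phi> ws"
      using tensor_algebra_pos_lift[OF T_module D2_module, of ?\<phi>, OF lin] unfolding TTbar_def by metis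
    have "H (word R TA (w # ws)) = coprod_word h w \<otimes>\<^bsub>D2\<^esub> coproduct_list R A ws"
      if "w \<in> carrier TA" "ws \<in> lists (carrier TA)" for w ws
    proof -
      have "w # ws \<in> lists (carrier TA)" using that by simp
      from Hw[OF this] show ?thesis by simp
    qed
    with H show ?thesis by blast
  qed
  from someI_ex[OF this] have *: "half_ext h \<in> linear_maps R D D2 \<and>
    (\<forall>w\<in>carrier TA. \<forall>ws\<in>lists (carrier TA).
      half_ext h (word R TA (w # ws)) = coprod_word h w \<otimes>\<^bsub>D2\<^esub> coproduct_list R A ws)"
    unfolding half_ext_def[symmetric] .
  then show "half_ext h \<in> linear_maps R D D2"
    "w \<in> carrier TA \<Longrightarrow> ws \<in> lists (carrier TA) \<Longrightarrow>
      half_ext h (word R TA (w # ws)) = coprod_word h w \<otimes>\<^bsub>D2\<^esub> coproduct_list R A ws"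
    by blast+
qed

lemma half_ext_eq:
  assumes "c \<in> C"
  shows "half_coproduct_plus R A (\<lambda>S. h (1 \<in> S)) c = half_ext h c"
proof -
  have I: "{ws. ws \<in> lists (carrier TA) \<and> ws \<noteq> []} = lists (carrier TA) - {[]}" by auto
  have lin: "half_ext h \<in> linear_maps R (TT R A) D2"
    using linear_maps_submodule_domain[OF half_ext_linear C_subset] TT_carrier_update by simp
  show ?thesis
    unfolding half_coproduct_plus_def I
  proof (rule linear_extension_eq[OF TT_module D2_module TT_word_spanned lin _ assms])
    fix ws assume "ws \<in> lists (carrier TA) - {[]}"
    then obtain v vs where "ws = v # vs" "v \<in> carrier TA" "vs \<in> lists (carrier TA)"
      by (cases ws) auto
    then show "half_ext h (word R TA ws) = coprod_word h (hd ws) \<otimes>\<^bsub>D2\<^esub> coproduct_list R A (tl ws)"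
      by (simp add: half_ext_word del: in_lists_conv_set One_nat_def)
  qed
qed

lemma coproduct_mult:
  assumes "x \<in> carrier D" "y \<in> carrier D"
  shows "coproduct R A (x \<otimes>\<^bsub>D\<^esub> y) = coproduct R A x \<otimes>\<^bsub>D2\<^esub> coproduct R A y"
proof -
  note \<Delta> = coproduct_linear
  note cl = linear_maps_closed[OF \<Delta>]
  have 1: "coproduct R A (word R TA xs \<otimes>\<^bsub>D\<^esub> y) = coproduct R A (word R TA xs) \<otimes>\<^bsub>D2\<^esub> coproduct R A y"
    if "xs \<in> lists (carrier TA)" "y \<in> carrier D" for xs y
    by (rule linear_maps_eq_on_spanned[OF D_module D2_module
          linear_maps_compose[OF D.mult_linear(1)[OF word_D_closed[OF that(1)]] \<Delta>]
          linear_maps_compose[OF \<Delta> D2.mult_linear(1)[OF cl[OF word_D_closed[OF that(1)]]]]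
          D_word_spanned _ that(2)])
      (elim imageE, use that in \<open>simp add: D_word_mult coproduct_word coproduct_list_append\<close>)
  show ?thesis
    by (rule linear_maps_eq_on_spanned[OF D_module D2_module
          linear_maps_compose[OF D.mult_linear(2)[OF assms(2)] \<Delta>]
          linear_maps_compose[OF \<Delta> D2.mult_linear(2)[OF cl[OF assms(2)]]]
          D_word_spanned _ assms(1)])
      (use 1 assms in blast)
qed

lemma coproduct_one: "coproduct R A \<one>\<^bsub>D\<^esub> = \<one>\<^bsub>D2\<^esub>"
  unfolding D_one by (simp add: coproduct_word)

lemma half_ext_mult:
  assumes "c \<in> C" "d \<in> carrier D"
  shows "half_ext h (c \<otimes>\<^bsub>D\<^esub> d) = half_ext h c \<otimes>\<^bsub>D2\<^esub> coproduct R A d"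
proof -
  note H = half_ext_linear[of h] and \<Delta> = coproduct_linear
  have 1: "half_ext h (word R TA ws \<otimes>\<^bsub>D\<^esub> d) = half_ext h (word R TA ws) \<otimes>\<^bsub>D2\<^esub> coproduct R A d"
    if ws: "ws \<in> lists (carrier TA)" "ws \<noteq> []" and "d \<in> carrier D" for ws d
  proof (rule linear_maps_eq_on_spanned[OF D_module D2_module
          linear_maps_compose[OF D.mult_linear(1)[OF word_D_closed[OF ws(1)]] H]
          linear_maps_compose[OF \<Delta> D2.mult_linear(1)[OF linear_maps_closed[OF H word_D_closed[OF ws(1)]]]]
          D_word_spanned _ that(3)])
    fix y assume "y \<in> word R TA ` lists (carrier TA)"
    then obtain ys where y: "y = word R TA ys" "ys \<in> lists (carrier TA)" by blast
    obtain x xs where x: "ws = x # xs" "x \<in> carrier TA" "xs \<in> lists (carrier TA)"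
      using ws by (cases ws) auto
    have "coprod_word h x \<in> carrier D2" by (rule linear_maps_closed[OF coprod_word_linear x(2)])
    moreover have "xs @ ys \<in> lists (carrier TA)" using x y by simp
    ultimately show "half_ext h (word R TA ws \<otimes>\<^bsub>D\<^esub> y) = half_ext h (word R TA ws) \<otimes>\<^bsub>D2\<^esub> coproduct R A y"
      using x y ws(1)
      by (simp add: D_word_mult half_ext_word coproduct_word coproduct_list_append D2.m_assoc
          del: in_lists_conv_set One_nat_def)
  qed
  have T: "f \<in> linear_maps R (TT R A) D2" if "f \<in> linear_maps R D D2" for f
    using linear_maps_submodule_domain[OF that C_subset] TT_carrier_update by simp
  show ?thesis
    by (rule linear_maps_eq_on_spanned[OF TT_module D2_module
          T[OF linear_maps_compose[OF D.mult_linear(2)[OF assms(2)] H]]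
          T[OF linear_maps_compose[OF H D2.mult_linear(2)[OF linear_maps_closed[OF \<Delta> assms(2)]]]]
          TT_word_spanned _ assms(1)])
      (use 1 assms(2) in auto)
qed

lemma pure_join_split:
  assumes "fst p \<in> lists (carrier A)" "snd p \<in> L" "fst q \<in> L" "snd q \<in> L"
  shows "pure bword (join_split p q) = split_tens p \<otimes>\<^bsub>D2\<^esub> pure bword q"
proof -
  have "bword (fst p # fst q) = bword [fst p] \<otimes>\<^bsub>D\<^esub> bword (fst q)"
    using bword_append[of "[fst p]" "fst q"] assms by simp
  then show ?thesis
    using assms by (simp add: split_tens_def pure_def join_split_def bword_append
        tens_mult[OF D_algebra D_algebra])
qed

lemma L_splits_list:
  assumes "ws \<in> L" "p \<in> set (splits_list ws)"
  shows "fst p \<in> L" "snd p \<in> L"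
  using splits_list_letters[OF assms] by auto

lemma L_half_splits_list:
  assumes "ws \<in> L" "p \<in> set (half_splits_list h ws)"
  shows "fst p \<in> L" "snd p \<in> L"
  by (rule L_splits_list[OF assms(1) subsetD[OF set_half_splits_list assms(2)]])+

lemma half_splits_list_sum:
  assumes "w \<in> lists (carrier A)" "ws \<in> L"
  shows "lsum D2 (pure bword) (half_splits_list h (w # ws)) =
    lsum D2 split_tens (half_splits h w) \<otimes>\<^bsub>D2\<^esub> lsum D2 (pure bword) (splits_list ws)"
  unfolding half_splits_list.simps
proof (rule D2.lsum_lprod_mult)
  fix p q assume p: "p \<in> set (half_splits h w)" and q: "q \<in> set (splits_list ws)"
  show "pure bword (join_split p q) = split_tens p \<otimes>\<^bsub>D2\<^esub> pure bword q"
    using splits_letters[OF assms(1), of p] p set_half_splits[of h w] L_splits_list[OF assms(2) q]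
    by (intro pure_join_split) auto
next
  show "split_tens p \<in> carrier D2" if "p \<in> set (half_splits h w)" for p
    by (rule split_tens_closed[OF assms(1) that])
  show "pure bword q \<in> carrier D2" if "q \<in> set (splits_list ws)" for q
    by (rule pure_closed[OF bword_closed L_splits_list[OF assms(2) that]])
qed

lemma word_single:
  assumes "w \<in> lists (carrier A)" "w \<noteq> []"
  shows "bword (w # ws) = word R TA (word R A w # map (word R A) (filter (\<lambda>w. w \<noteq> []) ws))"
  using assms by (simp add: bword_eq)

text \<open>
  The list may contain empty words: such a word has a single split, with nothing selected and one empty
  gap. Both factors of a split contain empty words in general, so this is what allows \<open>\<Delta>\<close> to be applied
  to them again.
\<close>
lemma coproduct_bword:
  assumes "ws \<in> L"
  shows "coproduct R A (bword ws) = lsum D2 (pure bword) (splits_list ws)"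
  using assms
proof (induction ws)
  case Nil
  have "bword [] = \<one>\<^bsub>D\<^esub>" by (simp add: bword_concat_Nil)
  then show ?case
    using tensor_one[OF D_algebra D_algebra] D2.r_zero[OF D2.one_closed]
    by (simp add: coproduct_one pure_def)
next
  case (Cons w ws)
  then have w: "w \<in> lists (carrier A)" and ws: "ws \<in> L" by auto
  note IH = Cons.IH
  show ?case
  proof (cases "w = []")
    case True
    have "splits_list (w # ws) = map (join_split ([], [[]])) (splits_list ws)"
      by (simp add: True lprod_Cons)
    moreover have "pure bword (join_split ([], [[]]) p) = pure bword p" for p
      by (simp add: pure_def join_split_def bword_Cons_Nil)
    ultimately show ?thesis using IH by (simp add: True bword_Cons_Nil lsum_map)
  next
    case False
    let ?vs = "map (word R A) (filter (\<lambda>w. w \<noteq> []) ws)"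
    have vs: "?vs \<in> lists (carrier TA)" by (rule map_word_closed[OF ws])
    have wT: "word R A w \<in> carrier TA" by (rule word_T_closed[OF w False])
    have "coproduct R A (bword (w # ws)) = coprod_word (\<lambda>_. True) (word R A w) \<otimes>\<^bsub>D2\<^esub> coproduct_list R A ?vs"
      unfolding word_single[OF w False] using vs wT by (subst coproduct_word) auto
    also have "coproduct_list R A ?vs = lsum D2 (pure bword) (splits_list ws)"
      using IH coproduct_word[OF vs] bword_eq[of ws] by simp
    also have "coprod_word (\<lambda>_. True) (word R A w) = lsum D2 split_tens (half_splits (\<lambda>_. True) w)"
      by (rule coprod_word_word[OF w False, of "\<lambda>_. True"])
    finally show ?thesis
      using half_splits_list_sum[OF w ws, of "\<lambda>_. True"] half_splits_list_True[of "w # ws"] by simp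
  qed
qed

text \<open>
  If the first word were empty, the first letter of the bar word would belong to a later word.
\<close>
lemma half_ext_bword:
  assumes "ws \<in> L" "ws \<noteq> []" "hd ws \<noteq> []"
  shows "half_ext h (bword ws) = lsum D2 (pure bword) (half_splits_list h ws)"
proof -
  obtain w vs where ws: "ws = w # vs" "w \<in> lists (carrier A)" "w \<noteq> []" "vs \<in> L"
    using assms by (cases ws) auto
  let ?vs = "map (word R A) (filter (\<lambda>w. w \<noteq> []) vs)"
  have vs: "?vs \<in> lists (carrier TA)" by (rule map_word_closed[OF ws(4)])
  have wT: "word R A w \<in> carrier TA" by (rule word_T_closed[OF ws(2,3)])
  have "half_ext h (bword ws) = coprod_word h (word R A w) \<otimes>\<^bsub>D2\<^esub> coproduct_list R A ?vs"
    unfolding ws(1) word_single[OF ws(2,3)] by (rule half_ext_word[OF wT vs])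
  also have "coproduct_list R A ?vs = lsum D2 (pure bword) (splits_list vs)"
    using coproduct_bword[OF ws(4)] coproduct_word[OF vs] bword_eq[of vs] by simp
  also have "coprod_word h (word R A w) = lsum D2 split_tens (half_splits h w)"
    by (rule coprod_word_word[OF ws(2,3)])
  finally show ?thesis unfolding ws(1) half_splits_list_sum[OF ws(2,4)] .
qed

end


section \<open>The counit and the projection onto the augmentation ideal\<close>

lemma regular_module_simps [simp]:
  "carrier (regular_module R) = carrier R"
  "\<zero>\<^bsub>regular_module R\<^esub> = \<zero>\<^bsub>R\<^esub>"
  "x \<oplus>\<^bsub>regular_module R\<^esub> y = x \<oplus>\<^bsub>R\<^esub> y"
  "x \<odot>\<^bsub>regular_module R\<^esub> y = x \<otimes>\<^bsub>R\<^esub> y"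
  by (simp_all add: regular_module_def)

lemma (in cring) regular_module: "module R (regular_module R)"
proof (rule moduleI)
  show "abelian_group (regular_module R)"
  proof (rule abelian_groupI)
    fix x assume "x \<in> carrier (regular_module R)"
    then show "\<exists>y\<in>carrier (regular_module R). y \<oplus>\<^bsub>regular_module R\<^esub> x = \<zero>\<^bsub>regular_module R\<^esub>"
      by (intro bexI[of _ "\<ominus> x"]) (auto simp: l_neg)
  qed (auto simp: a_assoc a_comm a_lcomm)
qed (auto simp: is_cring l_distr r_distr m_assoc)

context double_tensor_algebra
begin

abbreviation "\<epsilon> \<equiv> augmentation R TA"
abbreviation "\<Delta> \<equiv> coproduct R A"

lemma regular: "module R (regular_module R)"
  by (rule D.regular_module)

lemma
  shows counit_linear: "\<epsilon> \<in> linear_maps R D (regular_module R)"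
    and counit_word: "ws \<in> lists (carrier TA) \<Longrightarrow> \<epsilon> (word R TA ws) = (if ws = [] then \<one>\<^bsub>R\<^esub> else \<zero>\<^bsub>R\<^esub>)"
proof -
  have "multilinear R TA (regular_module R) (\<lambda>ws. if ws = [] then \<one>\<^bsub>R\<^esub> else \<zero>\<^bsub>R\<^esub>)"
    using linear_maps_zero_fun[OF regular, of TA] by (auto simp: multilinear_def)
  from tensor_algebra_lift[OF T_module regular this] obtain \<psi> where
    \<psi>: "\<psi> \<in> linear_maps R D (regular_module R)"
      "\<And>ws. ws \<in> lists (carrier TA) \<Longrightarrow> \<psi> (word R TA ws) = (if ws = [] then \<one>\<^bsub>R\<^esub> else \<zero>\<^bsub>R\<^esub>)"
    unfolding TTbar_def by metis
  have eq: "\<epsilon> x = \<psi> x" if "x \<in> carrier D" for x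
    unfolding augmentation_def TTbar_def[symmetric]
    by (rule linear_extension_eq[OF D_module regular D_word_spanned \<psi> that])
  show "\<epsilon> \<in> linear_maps R D (regular_module R)"
    by (rule iffD2[OF linear_maps_cong[OF D_module eq] \<psi>(1)])
  show "\<epsilon> (word R TA ws) = (if ws = [] then \<one>\<^bsub>R\<^esub> else \<zero>\<^bsub>R\<^esub>)" if "ws \<in> lists (carrier TA)"
    unfolding eq[OF word_D_closed[OF that]] by (rule \<psi>(2)[OF that])
qed

lemma counit_closed [simp]: "x \<in> carrier D \<Longrightarrow> \<epsilon> x \<in> carrier R"
  using linear_maps_closed[OF counit_linear] by simp

lemma counit_add: "x \<in> carrier D \<Longrightarrow> y \<in> carrier D \<Longrightarrow> \<epsilon> (x \<oplus>\<^bsub>D\<^esub> y) = \<epsilon> x \<oplus>\<^bsub>R\<^esub> \<epsilon> y"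
  using linear_maps_add[OF counit_linear] by simp

lemma counit_smult: "a \<in> carrier R \<Longrightarrow> x \<in> carrier D \<Longrightarrow> \<epsilon> (a \<odot>\<^bsub>D\<^esub> x) = a \<otimes>\<^bsub>R\<^esub> \<epsilon> x"
  using linear_maps_smult[OF counit_linear] by simp

lemma counit_one: "\<epsilon> \<one>\<^bsub>D\<^esub> = \<one>\<^bsub>R\<^esub>"
  unfolding D_one by (subst counit_word) auto

lemma counit_bword:
  assumes "ws \<in> L"
  shows "\<epsilon> (bword ws) = (if concat ws = [] then \<one>\<^bsub>R\<^esub> else \<zero>\<^bsub>R\<^esub>)"
proof -
  have "map (word R A) (filter (\<lambda>w. w \<noteq> []) ws) = [] \<longleftrightarrow> concat ws = []"
    by (auto simp: filter_empty_conv)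
  then show ?thesis unfolding bword_eq counit_word[OF map_word_closed[OF assms]] by simp
qed

lemma counit_mult:
  assumes "x \<in> carrier D" "y \<in> carrier D"
  shows "\<epsilon> (x \<otimes>\<^bsub>D\<^esub> y) = \<epsilon> x \<otimes>\<^bsub>R\<^esub> \<epsilon> y"
proof -
  have lin: "(\<lambda>y. a \<otimes>\<^bsub>R\<^esub> \<epsilon> y) \<in> linear_maps R D (regular_module R)" if "a \<in> carrier R" for a
    using linear_maps_smult_fun[OF regular counit_linear that] by simp
  have lin': "(\<lambda>x. \<epsilon> x \<otimes>\<^bsub>R\<^esub> a) \<in> linear_maps R D (regular_module R)" if "a \<in> carrier R" for a
    by (rule iffD2[OF linear_maps_cong[OF D_module] lin[OF that]])
      (use that in \<open>simp add: D.R.m_comm\<close>)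
  have 1: "\<epsilon> (word R TA xs \<otimes>\<^bsub>D\<^esub> y) = \<epsilon> (word R TA xs) \<otimes>\<^bsub>R\<^esub> \<epsilon> y"
    if xs: "xs \<in> lists (carrier TA)" and y: "y \<in> carrier D" for xs y
    by (rule linear_maps_eq_on_spanned[OF D_module regular
          linear_maps_compose[OF D.mult_linear(1)[OF word_D_closed[OF xs]] counit_linear]
          lin[OF counit_closed[OF word_D_closed[OF xs]]] D_word_spanned _ y])
      (elim imageE, use xs in \<open>simp add: D_word_mult counit_word\<close>)
  show ?thesis
    by (rule linear_maps_eq_on_spanned[OF D_module regular
          linear_maps_compose[OF D.mult_linear(2)[OF assms(2)] counit_linear]
          lin'[OF counit_closed[OF assms(2)]] D_word_spanned _ assms(1)])
      (elim imageE, use 1 assms(2) in simp)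
qed

text \<open>
  The projection \<open>\<pi>\<close> onto the augmentation ideal along the unit.
\<close>
definition "proj x = x \<ominus>\<^bsub>D\<^esub> \<epsilon> x \<odot>\<^bsub>D\<^esub> \<one>\<^bsub>D\<^esub>"

lemma proj_linear: "proj \<in> linear_maps R D D"
proof -
  have "(\<lambda>x. \<epsilon> x \<odot>\<^bsub>D\<^esub> \<one>\<^bsub>D\<^esub>) \<in> linear_maps R D D"
    by (rule linear_mapsI) (simp_all add: counit_add counit_smult D.smult_l_distr D.smult_assoc1)
  from linear_maps_minus_fun[OF D_module D_module linear_maps_id this] show ?thesis
    by (simp add: proj_def[abs_def])
qed

lemmas proj_closed [simp] = linear_maps_closed[OF proj_linear]

lemma proj_one: "proj \<one>\<^bsub>D\<^esub> = \<zero>\<^bsub>D\<^esub>"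
  by (simp add: proj_def counit_one a_minus_def D.r_neg)

lemma counit_C:
  assumes "c \<in> C"
  shows "\<epsilon> c = \<zero>\<^bsub>R\<^esub>"
proof -
  have "\<epsilon> \<in> linear_maps R (TT R A) (regular_module R)"
    using linear_maps_submodule_domain[OF counit_linear C_subset] TT_carrier_update by simp
  then show ?thesis
    by (rule linear_maps_eq_on_spanned[OF TT_module regular _ linear_maps_zero_fun[OF regular]
          TT_word_spanned _ assms, simplified])
      (elim imageE, simp add: counit_word)
qed

lemma proj_C:
  assumes "c \<in> C"
  shows "proj c = c"
  using assms C_subset by (auto simp: proj_def counit_C a_minus_def)

lemma proj_in_C:
  assumes "x \<in> carrier D"
  shows "proj x \<in> C"
proof -
  have "proj (word R TA ws) \<in> C" if ws: "ws \<in> lists (carrier TA)" for ws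
  proof (cases "ws = []")
    case True
    then show ?thesis
      using proj_one D_one subgroup.one_closed[OF submodule.axioms(1)[OF C_submodule]] by simp
  next
    case False
    from word_C_closed[OF ws this] show ?thesis by (simp add: proj_C)
  qed
  then have "word R TA ` lists (carrier TA) \<subseteq> {x \<in> carrier D. proj x \<in> C}"
    using word_D_closed by blast
  from spannedD[OF D_word_spanned submodule_vimage[OF D_module D_module proj_linear C_submodule] this assms]
  show ?thesis by simp
qed

lemma proj_decomposition: "x \<in> carrier D \<Longrightarrow> x = proj x \<oplus>\<^bsub>D\<^esub> \<epsilon> x \<odot>\<^bsub>D\<^esub> \<one>\<^bsub>D\<^esub>"
  by (simp add: proj_def a_minus_def D.a_assoc D.l_neg)

lemma C_iff:
  assumes "x \<in> carrier D"
  shows "x \<in> C \<longleftrightarrow> \<epsilon> x = \<zero>\<^bsub>R\<^esub>"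
proof
  assume "\<epsilon> x = \<zero>\<^bsub>R\<^esub>"
  then have "proj x = x" using assms by (simp add: proj_def a_minus_def)
  with proj_in_C[OF assms] show "x \<in> C" by simp
qed (rule counit_C)

lemma C_mult:
  assumes "a \<in> C" "b \<in> C"
  shows "a \<otimes>\<^bsub>D\<^esub> b \<in> C"
proof -
  have "a \<in> carrier D" "b \<in> carrier D" using assms C_subset by auto
  then show ?thesis using assms by (simp add: C_iff counit_mult counit_C)
qed

abbreviation "pbword ws \<equiv> proj (bword ws)"

definition "proj2 = tensor_map_full R D D D D proj proj"

lemma proj2_linear: "proj2 \<in> linear_maps R D2 D2"
  unfolding proj2_def by (rule tensor_map_full_linear[OF D_module D_module D_module D_module proj_linear proj_linear])

lemma proj2_tens: "x \<in> carrier D \<Longrightarrow> y \<in> carrier D \<Longrightarrow> proj2 (tens R D D x y) = tens R D D (proj x) (proj y)"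
  unfolding proj2_def by (rule tensor_map_full_tens[OF D_module D_module D_module D_module proj_linear proj_linear])

lemma proj2_in_sub:
  assumes "t \<in> carrier D2"
  shows "proj2 t \<in> carrier (tensor_sub R D D C C)"
proof -
  let ?G = "(\<lambda>(u, v). tens R D D u v) ` (C \<times> C)"
  have G: "?G \<subseteq> carrier D2" using C_subset by (auto intro!: tens_D_closed)
  have eq: "{tens R D D u v | u v. u \<in> C \<and> v \<in> C} = ?G" by auto
  have sub: "submodule (carrier (tensor_sub R D D C C)) R D2"
    unfolding tensor_sub_def eq using mod_span_submodule[OF D2_module G] by simp
  have "tens R D D u v \<in> carrier (tensor_sub R D D C C)" if "u \<in> C" "v \<in> C" for u v
    using mod_span_superset[of ?G R D2] that unfolding tensor_sub_def eq by auto
  then have "(\<lambda>(x, y). tens R D D x y) ` (carrier D \<times> carrier D) \<subseteq>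
      {t \<in> carrier D2. proj2 t \<in> carrier (tensor_sub R D D C C)}"
    by (auto simp: proj2_tens proj_in_C intro!: tens_D_closed)
  from spannedD[OF tensor_spanned[OF D_module D_module]
      submodule_vimage[OF D2_module D2_module proj2_linear sub] this assms]
  show ?thesis by simp
qed

lemma proj2_sum:
  assumes "\<And>p. p \<in> set ps \<Longrightarrow> fst p \<in> L \<and> snd p \<in> L"
  shows "proj2 (lsum D2 (pure bword) ps) = lsum D2 (pure pbword) ps"
proof -
  have "proj2 (lsum D2 (pure bword) ps) = lsum D2 (\<lambda>p. proj2 (pure bword p)) ps"
    by (rule linear_maps_lsum[OF D2_module D2_module proj2_linear pure_closed[OF bword_closed]])
      (use assms in blast)+
  also have "\<dots> = lsum D2 (pure pbword) ps"
    by (rule lsum_cong) (use assms in \<open>simp_all add: pure_def proj2_tens\<close>)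
  finally show ?thesis .
qed

text \<open>
  On the augmentation ideal this is, for \<open>f = \<Delta>\<close>, the reduced coproduct \<open>\<Delta> a - a \<otimes> 1 - 1 \<otimes> a\<close>,
  and for \<open>f = \<Delta>\<^sup>+\<close> the corresponding half coproduct.
\<close>
definition "reduced f x = proj2 (f x)"

lemma reduced_linear: "f \<in> linear_maps R D D2 \<Longrightarrow> reduced f \<in> linear_maps R D D2"
  unfolding reduced_def[abs_def] by (rule linear_maps_compose[OF _ proj2_linear])

lemma L_splits: "ws \<in> L \<Longrightarrow> p \<in> set (splits_list ws) \<Longrightarrow> fst p \<in> L \<and> snd p \<in> L"
  using L_splits_list[of ws p] by fast

lemma L_half_splits: "ws \<in> L \<Longrightarrow> p \<in> set (half_splits_list h ws) \<Longrightarrow> fst p \<in> L \<and> snd p \<in> L"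
  using L_half_splits_list[of ws p h] by fast

lemma reduced_coproduct_bword:
  assumes "ws \<in> L"
  shows "reduced \<Delta> (bword ws) = lsum D2 (pure pbword) (splits_list ws)"
  unfolding reduced_def coproduct_bword[OF assms] by (rule proj2_sum[OF L_splits[OF assms]])

lemma reduced_half_bword:
  assumes "ws \<in> L" "ws \<noteq> []" "hd ws \<noteq> []"
  shows "reduced (half_ext h) (bword ws) = lsum D2 (pure pbword) (half_splits_list h ws)"
  unfolding reduced_def half_ext_bword[OF assms] by (rule proj2_sum[OF L_half_splits[OF assms(1)]])


section \<open>Coassociativity and the unshuffle relations\<close>

text \<open>
  The term that belongs to a twofold selection. The map \<open>\<beta>\<close> is \<open>bword\<close> for coassociativity and its
  projection for the unshuffle relations.
\<close>
definition "triple \<beta> t = tens R D D2 (\<beta> (fst t)) (tens R D D (\<beta> (fst (snd t))) (\<beta> (snd (snd t))))"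

lemma triple_closed:
  "(\<And>ws. ws \<in> L \<Longrightarrow> \<beta> ws \<in> carrier D) \<Longrightarrow> x \<in> L \<Longrightarrow> y \<in> L \<Longrightarrow> z \<in> L \<Longrightarrow> triple \<beta> (x, y, z) \<in> carrier D3"
  unfolding triple_def by (simp add: tens_closed[OF D_module D2_module] tens_D_closed)

text \<open>
  The maps \<open>f \<otimes> I\<close> and \<open>I \<otimes> f\<close>, both with values in \<open>D \<otimes> (D \<otimes> D)\<close>.
\<close>
definition "apply_left f t = tensor_assoc R D (tensor_map_full R D D D2 D f (\<lambda>x. x) t)"

definition "apply_right f t = tensor_map_full R D D D D2 (\<lambda>x. x) f t"

lemma apply_left:
  assumes f: "f \<in> linear_maps R D D2"
  shows apply_left_linear: "apply_left f \<in> linear_maps R D2 D3"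
    and apply_left_tens: "x \<in> carrier D \<Longrightarrow> y \<in> carrier D \<Longrightarrow>
      apply_left f (tens R D D x y) = tensor_assoc R D (tens R D2 D (f x) y)"
  unfolding apply_left_def[abs_def]
  by (rule linear_maps_compose[OF
        tensor_map_full_linear[OF D_module D_module D2_module D_module f linear_maps_id]
        tensor_assoc_linear[OF D_module]])
    (simp add: tensor_map_full_tens[OF D_module D_module D2_module D_module f linear_maps_id])

lemma apply_right:
  assumes f: "f \<in> linear_maps R D D2"
  shows apply_right_linear: "apply_right f \<in> linear_maps R D2 D3"
    and apply_right_tens: "x \<in> carrier D \<Longrightarrow> y \<in> carrier D \<Longrightarrow>
      apply_right f (tens R D D x y) = tens R D D2 x (f y)"
  unfolding apply_right_def[abs_def]
  by (rule tensor_map_full_linear[OF D_module D_module D_module D2_module linear_maps_id f])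
    (simp add: tensor_map_full_tens[OF D_module D_module D_module D2_module linear_maps_id f])

lemma apply_left_sum:
  assumes f: "f \<in> linear_maps R D D2" and \<beta>: "\<And>ws. ws \<in> L \<Longrightarrow> \<beta> ws \<in> carrier D"
    and ps: "\<And>p. p \<in> set ps \<Longrightarrow> fst p \<in> L \<and> snd p \<in> L"
    and S: "\<And>p q. p \<in> set ps \<Longrightarrow> q \<in> set (S (fst p)) \<Longrightarrow> fst q \<in> L \<and> snd q \<in> L"
    and fS: "\<And>p. p \<in> set ps \<Longrightarrow> f (\<beta> (fst p)) = lsum D2 (pure \<beta>) (S (fst p))"
  shows "apply_left f (lsum D2 (pure \<beta>) ps) = lsum D3 (triple \<beta>) (expand_left S ps)"
proof -
  have "apply_left f (lsum D2 (pure \<beta>) ps) = lsum D3 (\<lambda>p. apply_left f (pure \<beta> p)) ps"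
    by (rule linear_maps_lsum[OF D2_module D3_module apply_left_linear[OF f] pure_closed[OF \<beta>]])
      (use ps in blast)+
  also have "\<dots> = lsum D3 (\<lambda>p. lsum D3 (triple \<beta>) (map (\<lambda>q. (fst q, snd q, snd p)) (S (fst p)))) ps"
  proof (rule lsum_cong[OF refl])
    fix p assume p: "p \<in> set ps"
    have z: "\<beta> (snd p) \<in> carrier D" using ps[OF p] \<beta> by blast
    have lin: "(\<lambda>t. tensor_assoc R D (tens R D2 D t (\<beta> (snd p)))) \<in> linear_maps R D2 D3"
      by (rule linear_maps_compose[OF bilinearD(1)[OF tens_bilinear[OF D2_module D_module] z]
            tensor_assoc_linear[OF D_module]])
    have "apply_left f (pure \<beta> p) =
        tensor_assoc R D (tens R D2 D (lsum D2 (pure \<beta>) (S (fst p))) (\<beta> (snd p)))"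
      unfolding pure_def[of \<beta> p] fS[OF p, symmetric]
      by (rule apply_left_tens[OF f]) (use ps[OF p] \<beta> in blast)+
    also have "\<dots> = lsum D3 (\<lambda>q. tensor_assoc R D (tens R D2 D (pure \<beta> q) (\<beta> (snd p)))) (S (fst p))"
      by (rule linear_maps_lsum[OF D2_module D3_module lin pure_closed[OF \<beta>]])
        (use S[OF p] in blast)+
    also have "\<dots> = lsum D3 (triple \<beta>) (map (\<lambda>q. (fst q, snd q, snd p)) (S (fst p)))"
      unfolding lsum_map
    proof (rule lsum_cong[OF refl])
      fix q assume "q \<in> set (S (fst p))"
      then have "\<beta> (fst q) \<in> carrier D" "\<beta> (snd q) \<in> carrier D" using S[OF p] \<beta> by blast+
      then show "tensor_assoc R D (tens R D2 D (pure \<beta> q) (\<beta> (snd p))) = triple \<beta> (fst q, snd q, snd p)"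
        using z by (simp add: pure_def triple_def tensor_assoc_tens[OF D_module])
    qed
    finally show "apply_left f (pure \<beta> p) = \<dots>" .
  qed
  also have "\<dots> = lsum D3 (triple \<beta>) (expand_left S ps)"
    unfolding expand_left_def
    by (rule D3.lsum_concat_map[symmetric]) (use ps S in \<open>force intro!: triple_closed[OF \<beta>]\<close>)
  finally show ?thesis .
qed

lemma apply_right_sum:
  assumes f: "f \<in> linear_maps R D D2" and \<beta>: "\<And>ws. ws \<in> L \<Longrightarrow> \<beta> ws \<in> carrier D"
    and ps: "\<And>p. p \<in> set ps \<Longrightarrow> fst p \<in> L \<and> snd p \<in> L"
    and S: "\<And>p q. p \<in> set ps \<Longrightarrow> q \<in> set (S (snd p)) \<Longrightarrow> fst q \<in> L \<and> snd q \<in> L"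
    and fS: "\<And>p. p \<in> set ps \<Longrightarrow> f (\<beta> (snd p)) = lsum D2 (pure \<beta>) (S (snd p))"
  shows "apply_right f (lsum D2 (pure \<beta>) ps) = lsum D3 (triple \<beta>) (expand_right S ps)"
proof -
  have "apply_right f (lsum D2 (pure \<beta>) ps) = lsum D3 (\<lambda>p. apply_right f (pure \<beta> p)) ps"
    by (rule linear_maps_lsum[OF D2_module D3_module apply_right_linear[OF f] pure_closed[OF \<beta>]])
      (use ps in blast)+
  also have "\<dots> = lsum D3 (\<lambda>p. lsum D3 (triple \<beta>) (map (\<lambda>q. (fst p, fst q, snd q)) (S (snd p)))) ps"
  proof (rule lsum_cong[OF refl])
    fix p assume p: "p \<in> set ps"
    have x: "\<beta> (fst p) \<in> carrier D" using ps[OF p] \<beta> by blast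
    have "apply_right f (pure \<beta> p) = tens R D D2 (\<beta> (fst p)) (lsum D2 (pure \<beta>) (S (snd p)))"
      unfolding pure_def[of \<beta> p] fS[OF p, symmetric]
      by (rule apply_right_tens[OF f]) (use ps[OF p] \<beta> in blast)+
    also have "\<dots> = lsum D3 (\<lambda>q. tens R D D2 (\<beta> (fst p)) (pure \<beta> q)) (S (snd p))"
      by (rule linear_maps_lsum[OF D2_module D3_module bilinearD(2)[OF tens_bilinear[OF D_module D2_module] x]
            pure_closed[OF \<beta>]])
        (use S[OF p] in blast)+
    also have "\<dots> = lsum D3 (triple \<beta>) (map (\<lambda>q. (fst p, fst q, snd q)) (S (snd p)))"
      unfolding lsum_map by (simp add: pure_def triple_def)
    finally show "apply_right f (pure \<beta> p) = \<dots>" .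
  qed
  also have "\<dots> = lsum D3 (triple \<beta>) (expand_right S ps)"
    unfolding expand_right_def
    by (rule D3.lsum_concat_map[symmetric]) (use ps S in \<open>force intro!: triple_closed[OF \<beta>]\<close>)
  finally show ?thesis .
qed

text \<open>
  Identities between \<open>(f \<otimes> I)\<close> and \<open>(I \<otimes> g)\<close> thereby reduce to equalities of multisets of twofold
  selections.
\<close>
lemma coassoc_transfer:
  assumes f: "f \<in> linear_maps R D D2" and g: "g \<in> linear_maps R D D2"
    and \<beta>: "\<And>ws. ws \<in> L \<Longrightarrow> \<beta> ws \<in> carrier D"
    and ps: "\<And>p. p \<in> set ps \<Longrightarrow> fst p \<in> L \<and> snd p \<in> L"
    and qs: "\<And>p. p \<in> set qs \<Longrightarrow> fst p \<in> L \<and> snd p \<in> L"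
    and S: "\<And>ws p. ws \<in> L \<Longrightarrow> p \<in> set (S ws) \<Longrightarrow> fst p \<in> L \<and> snd p \<in> L"
    and S': "\<And>ws p. ws \<in> L \<Longrightarrow> p \<in> set (S' ws) \<Longrightarrow> fst p \<in> L \<and> snd p \<in> L"
    and fS: "\<And>p. p \<in> set ps \<Longrightarrow> f (\<beta> (fst p)) = lsum D2 (pure \<beta>) (S (fst p))"
    and gS: "\<And>p. p \<in> set qs \<Longrightarrow> g (\<beta> (snd p)) = lsum D2 (pure \<beta>) (S' (snd p))"
    and eq: "mset (expand_left S ps) = mset (expand_right S' qs)"
  shows "apply_left f (lsum D2 (pure \<beta>) ps) = apply_right g (lsum D2 (pure \<beta>) qs)"
proof -
  have Sp: "fst q \<in> L \<and> snd q \<in> L" if "p \<in> set ps" "q \<in> set (S (fst p))" for p q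
    by (rule S[OF conjunct1[OF ps[OF that(1)]] that(2)])
  have Sq: "fst q \<in> L \<and> snd q \<in> L" if "p \<in> set qs" "q \<in> set (S' (snd p))" for p q
    by (rule S'[OF conjunct2[OF qs[OF that(1)]] that(2)])
  have cl: "triple \<beta> t \<in> carrier D3" if t: "t \<in> set (expand_left S ps)" for t
  proof -
    obtain p q where "p \<in> set ps" "q \<in> set (S (fst p))" "t = (fst q, snd q, snd p)"
      using t unfolding expand_left_def by auto
    then show ?thesis using ps[of p] Sp[of p q] by (simp only: triple_closed[OF \<beta>] simp_thms)
  qed
  have "apply_left f (lsum D2 (pure \<beta>) ps) = lsum D3 (triple \<beta>) (expand_left S ps)"
    by (rule apply_left_sum[OF f \<beta> ps Sp fS])
  also have "\<dots> = lsum D3 (triple \<beta>) (expand_right S' qs)"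
    by (rule D3.lsum_mset_cong[OF eq cl])
  also have "\<dots> = apply_right g (lsum D2 (pure \<beta>) qs)"
    by (rule apply_right_sum[OF g \<beta> qs Sq gS, symmetric])
  finally show ?thesis .
qed

lemma coproduct_coassoc:
  assumes "x \<in> carrier D"
  shows "apply_left \<Delta> (\<Delta> x) = apply_right \<Delta> (\<Delta> x)"
proof (rule linear_maps_eq_on_spanned[OF D_module D3_module
      linear_maps_compose[OF coproduct_linear apply_left_linear[OF coproduct_linear]]
      linear_maps_compose[OF coproduct_linear apply_right_linear[OF coproduct_linear]]
      D_spanned _ assms])
  fix x assume "x \<in> bword ` L"
  then obtain ws where ws: "ws \<in> L" "x = bword ws" by blast
  show "apply_left \<Delta> (\<Delta> x) = apply_right \<Delta> (\<Delta> x)"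
    unfolding ws(2) coproduct_bword[OF ws(1)]
    by (rule coassoc_transfer[OF coproduct_linear coproduct_linear bword_closed
          L_splits[OF ws(1)] L_splits[OF ws(1)] L_splits L_splits _ _ splits_list_coassoc])
      (use L_splits[OF ws(1)] in \<open>fast intro!: coproduct_bword\<close>)+
qed

abbreviation "red_prec \<equiv> reduced (half_ext id)"
abbreviation "red_succ \<equiv> reduced (half_ext Not)"
abbreviation "red_coproduct \<equiv> reduced \<Delta>"

lemmas red_prec_linear = reduced_linear[OF half_ext_linear[of id]]
lemmas red_succ_linear = reduced_linear[OF half_ext_linear[of Not]]
lemmas red_coproduct_linear = reduced_linear[OF coproduct_linear]

text \<open>
  If all words of \<open>ws\<close> are empty, then the left side is zero because the projection kills the unit, and
  the right side because the reduced coproduct does.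
\<close>
lemma reduced_coproduct_pbword:
  assumes "ws \<in> L"
  shows "red_coproduct (pbword ws) = lsum D2 (pure pbword) (splits_list ws)"
proof (cases "concat ws = []")
  case True
  have "red_coproduct \<one>\<^bsub>D\<^esub> = tens R D D \<zero>\<^bsub>D\<^esub> \<zero>\<^bsub>D\<^esub>"
    by (simp add: reduced_def coproduct_one tensor_one[OF D_algebra D_algebra] proj2_tens proj_one)
  also have "\<dots> = \<zero>\<^bsub>D2\<^esub>"
    using linear_maps_zero[OF D_module D2_module bilinearD(1)[OF tens_D_bilinear D.zero_closed]] .
  also have "\<dots> = red_coproduct \<zero>\<^bsub>D\<^esub>"
    using linear_maps_zero[OF D_module D2_module red_coproduct_linear] by simp
  finally show ?thesis
    using reduced_coproduct_bword[OF assms] bword_concat_Nil[OF True] by (simp add: proj_one)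
next
  case False
  then show ?thesis
    unfolding proj_C[OF bword_C[OF assms False]] by (intro reduced_coproduct_bword assms)
qed

lemma reduced_half_pbword:
  assumes "ws \<in> L" "ws \<noteq> [] \<and> hd ws \<noteq> []"
  shows "reduced (half_ext h) (pbword ws) = lsum D2 (pure pbword) (half_splits_list h ws)"
proof -
  have "concat ws \<noteq> []" using assms(2) by (cases ws) auto
  then show ?thesis
    unfolding proj_C[OF bword_C[OF assms(1) \<open>concat ws \<noteq> []\<close>]]
    using assms by (intro reduced_half_bword) blast+
qed

lemma TT_linear: "f \<in> linear_maps R D N \<Longrightarrow> f \<in> linear_maps R (TT R A) N"
  using linear_maps_submodule_domain[OF _ C_subset] TT_carrier_update by simp

lemma pbword_closed: "ws \<in> L \<Longrightarrow> pbword ws \<in> carrier D"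
  by simp

text \<open>
  The first letter is selected twice, once, or never.
\<close>
lemma reduced_unshuffle:
  assumes "c \<in> C"
  shows "apply_left red_prec (red_prec c) = apply_right red_coproduct (red_prec c)"
    and "apply_left red_succ (red_prec c) = apply_right red_prec (red_succ c)"
    and "apply_left red_coproduct (red_succ c) = apply_right red_succ (red_succ c)"
proof -
  have *: "apply_left f (g c) = apply_right f' (g' c)"
    if lin: "f \<in> linear_maps R D D2" "g \<in> linear_maps R D D2" "f' \<in> linear_maps R D D2" "g' \<in> linear_maps R D D2"
      and gen: "\<And>ws. ws \<in> L \<Longrightarrow> ws \<noteq> [] \<Longrightarrow> hd ws \<noteq> [] \<Longrightarrow>
        apply_left f (g (bword ws)) = apply_right f' (g' (bword ws))" for f g f' g'
    by (rule linear_maps_eq_on_spanned[OF TT_module D3_module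
          TT_linear[OF linear_maps_compose[OF lin(2) apply_left_linear[OF lin(1)]]]
          TT_linear[OF linear_maps_compose[OF lin(4) apply_right_linear[OF lin(3)]]]
          TT_spanned _ assms]) (use gen in blast)
  show "apply_left red_prec (red_prec c) = apply_right red_coproduct (red_prec c)"
  proof (rule *[OF red_prec_linear red_prec_linear red_coproduct_linear red_prec_linear])
    fix ws assume ws: "ws \<in> L" "ws \<noteq> []" "hd ws \<noteq> []"
    note LW = L_half_splits[OF ws(1)]
    show "apply_left red_prec (red_prec (bword ws)) = apply_right red_coproduct (red_prec (bword ws))"
      unfolding reduced_half_bword[OF ws]
    proof (rule coassoc_transfer[OF red_prec_linear red_coproduct_linear pbword_closed LW LW
          L_half_splits L_splits _ _ half_splits_list_coassoc(1)[OF ws(2,3)]])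
      show "red_prec (pbword (fst p)) = lsum D2 (pure pbword) (half_splits_list id (fst p))"
        if "p \<in> set (half_splits_list id ws)" for p
        by (rule reduced_half_pbword[OF conjunct1[OF LW[OF that]] hd_fst_half_splits_list_id[OF that ws(2,3)]])
      show "red_coproduct (pbword (snd p)) = lsum D2 (pure pbword) (splits_list (snd p))"
        if "p \<in> set (half_splits_list id ws)" for p
        by (rule reduced_coproduct_pbword[OF conjunct2[OF LW[OF that]]])
    qed
  qed
  show "apply_left red_succ (red_prec c) = apply_right red_prec (red_succ c)"
  proof (rule *[OF red_succ_linear red_prec_linear red_prec_linear red_succ_linear])
    fix ws assume ws: "ws \<in> L" "ws \<noteq> []" "hd ws \<noteq> []"
    note LW = L_half_splits[OF ws(1)]
    show "apply_left red_succ (red_prec (bword ws)) = apply_right red_prec (red_succ (bword ws))"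
      unfolding reduced_half_bword[OF ws]
    proof (rule coassoc_transfer[OF red_succ_linear red_prec_linear pbword_closed LW LW
          L_half_splits L_half_splits _ _ half_splits_list_coassoc(2)[OF ws(2,3)]])
      show "red_succ (pbword (fst p)) = lsum D2 (pure pbword) (half_splits_list Not (fst p))"
        if "p \<in> set (half_splits_list id ws)" for p
        by (rule reduced_half_pbword[OF conjunct1[OF LW[OF that]] hd_fst_half_splits_list_id[OF that ws(2,3)]])
      show "red_prec (pbword (snd p)) = lsum D2 (pure pbword) (half_splits_list id (snd p))"
        if "p \<in> set (half_splits_list Not ws)" for p
        by (rule reduced_half_pbword[OF conjunct2[OF LW[OF that]] hd_snd_half_splits_list_Not[OF that ws(2,3)]])
    qed
  qed
  show "apply_left red_coproduct (red_succ c) = apply_right red_succ (red_succ c)"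
  proof (rule *[OF red_coproduct_linear red_succ_linear red_succ_linear red_succ_linear])
    fix ws assume ws: "ws \<in> L" "ws \<noteq> []" "hd ws \<noteq> []"
    note LW = L_half_splits[OF ws(1)]
    show "apply_left red_coproduct (red_succ (bword ws)) = apply_right red_succ (red_succ (bword ws))"
      unfolding reduced_half_bword[OF ws]
    proof (rule coassoc_transfer[OF red_coproduct_linear red_succ_linear pbword_closed LW LW
          L_splits L_half_splits _ _ half_splits_list_coassoc(3)[OF ws(2,3)]])
      show "red_coproduct (pbword (fst p)) = lsum D2 (pure pbword) (splits_list (fst p))"
        if "p \<in> set (half_splits_list Not ws)" for p
        by (rule reduced_coproduct_pbword[OF conjunct1[OF LW[OF that]]])
      show "red_succ (pbword (snd p)) = lsum D2 (pure pbword) (half_splits_list Not (snd p))"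
        if "p \<in> set (half_splits_list Not ws)" for p
        by (rule reduced_half_pbword[OF conjunct2[OF LW[OF that]] hd_snd_half_splits_list_Not[OF that ws(2,3)]])
    qed
  qed
qed

end


section \<open>The unshuffle bialgebra\<close>

context double_tensor_algebra
begin

text \<open>
  A split with something selected differs from its projection only if nothing is left out, and
  symmetrically.
\<close>
lemma pure_eq_projected:
  assumes "fst p \<in> L" "snd p \<in> L"
  shows "concat (fst p) \<noteq> [] \<Longrightarrow> pure bword p = pure pbword p \<oplus>\<^bsub>D2\<^esub>
      (if concat (snd p) = [] then tens R D D (bword (fst p)) \<one>\<^bsub>D\<^esub> else \<zero>\<^bsub>D2\<^esub>)"
    and "concat (snd p) \<noteq> [] \<Longrightarrow> pure bword p = pure pbword p \<oplus>\<^bsub>D2\<^esub>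
      (if concat (fst p) = [] then tens R D D \<one>\<^bsub>D\<^esub> (bword (snd p)) else \<zero>\<^bsub>D2\<^esub>)"
proof -
  note b = bword_closed[OF assms(1)] bword_closed[OF assms(2)]
  have 0: "tens R D D (bword (fst p)) \<zero>\<^bsub>D\<^esub> = \<zero>\<^bsub>D2\<^esub>" "tens R D D \<zero>\<^bsub>D\<^esub> (bword (snd p)) = \<zero>\<^bsub>D2\<^esub>"
    using linear_maps_zero[OF D_module D2_module] bilinearD[OF tens_D_bilinear] b by blast+
  have pb: "pbword ws = (if concat ws = [] then \<zero>\<^bsub>D\<^esub> else bword ws)" if "ws \<in> L" for ws
    using bword_concat_Nil[of ws] proj_one proj_C[OF bword_C[OF that]] by simp
  show "concat (fst p) \<noteq> [] \<Longrightarrow> pure bword p = pure pbword p \<oplus>\<^bsub>D2\<^esub>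
      (if concat (snd p) = [] then tens R D D (bword (fst p)) \<one>\<^bsub>D\<^esub> else \<zero>\<^bsub>D2\<^esub>)"
    using 0 b tens_D_closed bword_concat_Nil[of "snd p"]
    unfolding pure_def pb[OF assms(1)] pb[OF assms(2)] by (simp del: concat_eq_Nil_conv)
  show "concat (snd p) \<noteq> [] \<Longrightarrow> pure bword p = pure pbword p \<oplus>\<^bsub>D2\<^esub>
      (if concat (fst p) = [] then tens R D D \<one>\<^bsub>D\<^esub> (bword (snd p)) else \<zero>\<^bsub>D2\<^esub>)"
    using 0 b tens_D_closed bword_concat_Nil[of "fst p"]
    unfolding pure_def pb[OF assms(1)] pb[OF assms(2)] by (simp del: concat_eq_Nil_conv)
qed

text \<open>
  Used with \<open>Q\<close> singling out the split that leaves nothing out, or the one that selects nothing: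
  projecting the factors removes only this term from the sum.
\<close>
lemma sum_eq_projected:
  assumes ps: "\<And>p. p \<in> set ps \<Longrightarrow> fst p \<in> L \<and> snd p \<in> L"
    and f: "\<And>p. p \<in> set ps \<Longrightarrow> f p \<in> carrier D2"
    and eq: "\<And>p. p \<in> set ps \<Longrightarrow> pure bword p = pure pbword p \<oplus>\<^bsub>D2\<^esub> (if Q p then f p else \<zero>\<^bsub>D2\<^esub>)"
    and Q: "filter Q ps = [q]"
  shows "lsum D2 (pure bword) ps = lsum D2 (pure pbword) ps \<oplus>\<^bsub>D2\<^esub> f q"
proof -
  have g: "pure pbword p \<in> carrier D2" if "p \<in> set ps" for p
    by (rule pure_closed[OF pbword_closed conjunct1[OF ps[OF that]] conjunct2[OF ps[OF that]]])
  have q: "q \<in> set ps" using Q by (metis filter_is_subset list.set_intros(1) subsetD)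
  have "lsum D2 (pure bword) ps = lsum D2 (\<lambda>p. pure pbword p \<oplus>\<^bsub>D2\<^esub> (if Q p then f p else \<zero>\<^bsub>D2\<^esub>)) ps"
    by (rule lsum_cong[OF refl eq])
  also have "\<dots> = lsum D2 (pure pbword) ps \<oplus>\<^bsub>D2\<^esub> lsum D2 (\<lambda>p. if Q p then f p else \<zero>\<^bsub>D2\<^esub>) ps"
    by (rule D2.lsum_add[OF g]) (use f in simp_all)
  also have "lsum D2 (\<lambda>p. if Q p then f p else \<zero>\<^bsub>D2\<^esub>) ps = lsum D2 f (filter Q ps)"
    by (rule D2.lsum_filter) (rule f)
  finally show ?thesis using f[OF q] by (simp add: Q)
qed

text \<open>
  If the first letter is selected, the only term with a unit factor is \<open>c \<otimes> 1\<close>.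
\<close>
lemma half_ext_id_reduced:
  assumes "c \<in> C"
  shows "half_ext id c = red_prec c \<oplus>\<^bsub>D2\<^esub> tens R D D c \<one>\<^bsub>D\<^esub>"
proof (rule linear_maps_eq_on_spanned[OF TT_module D2_module TT_linear[OF half_ext_linear]
      TT_linear[OF linear_maps_add_fun[OF D2_module red_prec_linear bilinearD(1)[OF tens_D_bilinear D.one_closed]]]
      TT_spanned _ assms])
  fix x assume "x \<in> bword ` {ws \<in> L. ws \<noteq> [] \<and> hd ws \<noteq> []}"
  then obtain ws where ws: "ws \<in> L" "ws \<noteq> []" "hd ws \<noteq> []" and x: "x = bword ws" by blast
  note LW = L_half_splits[OF ws(1)]
  obtain v where v: "filter (\<lambda>p. concat (snd p) = []) (half_splits_list id ws) = [(ws, v)]"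
    using filter_half_splits_list_empty_gaps[of id ws] ws(2) by auto
  have "concat (fst p) \<noteq> []" if "p \<in> set (half_splits_list id ws)" for p
    using hd_fst_half_splits_list_id[OF that ws(2,3)] by (cases "fst p") auto
  then have "lsum D2 (pure bword) (half_splits_list id ws) =
      lsum D2 (pure pbword) (half_splits_list id ws) \<oplus>\<^bsub>D2\<^esub> tens R D D (bword (fst (ws, v))) \<one>\<^bsub>D\<^esub>"
    using LW by (intro sum_eq_projected[OF LW _ pure_eq_projected(1) v] tens_D_closed bword_closed D.one_closed) blast+
  then show "half_ext id x = red_prec x \<oplus>\<^bsub>D2\<^esub> tens R D D x \<one>\<^bsub>D\<^esub>"
    unfolding x half_ext_bword[OF ws] reduced_half_bword[OF ws] fst_conv .
qed

text \<open>
  If the first letter is left out, the only term with a unit factor is \<open>1 \<otimes> c\<close>.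
\<close>
lemma half_ext_Not_reduced:
  assumes "c \<in> C"
  shows "half_ext Not c = red_succ c \<oplus>\<^bsub>D2\<^esub> tens R D D \<one>\<^bsub>D\<^esub> c"
proof (rule linear_maps_eq_on_spanned[OF TT_module D2_module TT_linear[OF half_ext_linear]
      TT_linear[OF linear_maps_add_fun[OF D2_module red_succ_linear bilinearD(2)[OF tens_D_bilinear D.one_closed]]]
      TT_spanned _ assms])
  fix x assume "x \<in> bword ` {ws \<in> L. ws \<noteq> [] \<and> hd ws \<noteq> []}"
  then obtain ws where ws: "ws \<in> L" "ws \<noteq> []" "hd ws \<noteq> []" and x: "x = bword ws" by blast
  note LW = L_half_splits[OF ws(1)]
  obtain u where u: "filter (\<lambda>p. concat (fst p) = []) (half_splits_list Not ws) = [(u, ws)]"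
    using filter_half_splits_list_empty_selection[of Not ws] ws(2) by auto
  have "concat (snd p) \<noteq> []" if "p \<in> set (half_splits_list Not ws)" for p
    using hd_snd_half_splits_list_Not[OF that ws(2,3)] by (cases "snd p") auto
  then have "lsum D2 (pure bword) (half_splits_list Not ws) =
      lsum D2 (pure pbword) (half_splits_list Not ws) \<oplus>\<^bsub>D2\<^esub> tens R D D \<one>\<^bsub>D\<^esub> (bword (snd (u, ws)))"
    using LW by (intro sum_eq_projected[OF LW _ pure_eq_projected(2) u] tens_D_closed bword_closed D.one_closed) blast+
  then show "half_ext Not x = red_succ x \<oplus>\<^bsub>D2\<^esub> tens R D D \<one>\<^bsub>D\<^esub> x"
    unfolding x half_ext_bword[OF ws] reduced_half_bword[OF ws] snd_conv .
qed

lemma prec_eq: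
  assumes "c \<in> C"
  shows "coproduct_prec R A c = red_prec c"
    and "coproduct_prec R A c \<oplus>\<^bsub>D2\<^esub> tens R D D c \<one>\<^bsub>D\<^esub> = half_ext id c"
proof -
  have c: "c \<in> carrier D" using assms C_subset by blast
  have cl: "red_prec c \<in> carrier D2" "tens R D D c \<one>\<^bsub>D\<^esub> \<in> carrier D2"
    using linear_maps_closed[OF red_prec_linear c] tens_D_closed[OF c D.one_closed] by auto
  have "coproduct_prec R A c = half_ext id c \<ominus>\<^bsub>D2\<^esub> tens R D D c \<one>\<^bsub>D\<^esub>"
    using half_ext_eq[OF assms, of id] by (simp add: coproduct_prec_def)
  then show eq: "coproduct_prec R A c = red_prec c"
    using cl by (simp add: half_ext_id_reduced[OF assms] a_minus_def D2.a_assoc D2.r_neg)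
  show "coproduct_prec R A c \<oplus>\<^bsub>D2\<^esub> tens R D D c \<one>\<^bsub>D\<^esub> = half_ext id c"
    unfolding eq half_ext_id_reduced[OF assms] ..
qed

lemma succ_eq:
  assumes "c \<in> C"
  shows "coproduct_succ R A c = red_succ c"
    and "coproduct_succ R A c \<oplus>\<^bsub>D2\<^esub> tens R D D \<one>\<^bsub>D\<^esub> c = half_ext Not c"
proof -
  have c: "c \<in> carrier D" using assms C_subset by blast
  have cl: "red_succ c \<in> carrier D2" "tens R D D \<one>\<^bsub>D\<^esub> c \<in> carrier D2"
    using linear_maps_closed[OF red_succ_linear c] tens_D_closed[OF D.one_closed c] by auto
  have "coproduct_succ R A c = half_ext Not c \<ominus>\<^bsub>D2\<^esub> tens R D D \<one>\<^bsub>D\<^esub> c"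
    unfolding coproduct_succ_def half_ext_eq[OF assms, of Not] ..
  then show eq: "coproduct_succ R A c = red_succ c"
    using cl by (simp add: half_ext_Not_reduced[OF assms] a_minus_def D2.a_assoc D2.r_neg)
  show "coproduct_succ R A c \<oplus>\<^bsub>D2\<^esub> tens R D D \<one>\<^bsub>D\<^esub> c = half_ext Not c"
    unfolding eq half_ext_Not_reduced[OF assms] ..
qed

lemma coproduct_eq_halves:
  assumes "c \<in> C"
  shows "\<Delta> c = half_ext id c \<oplus>\<^bsub>D2\<^esub> half_ext Not c"
proof (rule linear_maps_eq_on_spanned[OF TT_module D2_module TT_linear[OF coproduct_linear]
      TT_linear[OF linear_maps_add_fun[OF D2_module half_ext_linear half_ext_linear]] TT_spanned _ assms])
  fix x assume "x \<in> bword ` {ws \<in> L. ws \<noteq> [] \<and> hd ws \<noteq> []}"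
  then obtain ws where ws: "ws \<in> L" "ws \<noteq> []" "hd ws \<noteq> []" and x: "x = bword ws" by blast
  have cl: "pure bword p \<in> carrier D2"
    if "p \<in> set (half_splits_list id ws) \<union> set (half_splits_list Not ws)" for p
    using that by (auto intro!: pure_closed[OF bword_closed] dest: L_half_splits[OF ws(1)] del: in_listsI)
  show "\<Delta> x = half_ext id x \<oplus>\<^bsub>D2\<^esub> half_ext Not x"
    unfolding x coproduct_bword[OF ws(1)] half_ext_bword[OF ws] splits_list_eq_halves[OF ws(2,3)]
    by (rule D2.lsum_append[OF cl])
qed

lemma reduced_coproduct_eq:
  assumes "c \<in> C"
  shows "coproduct_prec R A c \<oplus>\<^bsub>D2\<^esub> coproduct_succ R A c = red_coproduct c"
proof -
  have c: "c \<in> carrier D" using assms C_subset by blast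
  show ?thesis
    unfolding prec_eq(1)[OF assms] succ_eq(1)[OF assms] reduced_def coproduct_eq_halves[OF assms]
    by (rule linear_maps_add[OF proj2_linear, symmetric]; rule linear_maps_closed[OF half_ext_linear c])
qed

text \<open>
  A counit law evaluates all but one split to zero.
\<close>
lemma eval_sum:
  assumes E: "E \<in> linear_maps R D2 D" and ps: "\<And>p. p \<in> set ps \<Longrightarrow> fst p \<in> L \<and> snd p \<in> L"
    and b: "\<And>p. p \<in> set ps \<Longrightarrow> b p \<in> L"
    and eq: "\<And>p. p \<in> set ps \<Longrightarrow> E (pure bword p) = (if Q p then \<one>\<^bsub>R\<^esub> else \<zero>\<^bsub>R\<^esub>) \<odot>\<^bsub>D\<^esub> bword (b p)"
    and Q: "filter Q ps = [q]"
  shows "E (lsum D2 (pure bword) ps) = bword (b q)"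
proof -
  have q: "q \<in> set ps" using Q by (metis filter_is_subset list.set_intros(1) subsetD)
  have "E (lsum D2 (pure bword) ps) = lsum D (\<lambda>p. E (pure bword p)) ps"
    by (rule linear_maps_lsum[OF D2_module D_module E pure_closed[OF bword_closed]]) (use ps in blast)+
  also have "\<dots> = lsum D (\<lambda>p. if Q p then bword (b p) else \<zero>\<^bsub>D\<^esub>) ps"
    by (rule lsum_cong[OF refl]) (use eq bword_closed[OF b] in simp)
  also have "\<dots> = lsum D (\<lambda>p. bword (b p)) (filter Q ps)"
    by (rule D.lsum_filter) (rule bword_closed[OF b])
  finally show ?thesis using bword_closed[OF b[OF q]] by (simp add: Q)
qed

lemma counit_laws:
  assumes x: "x \<in> carrier D"
  shows "linear_extension R D2 D (carrier D \<times> carrier D) (\<lambda>(x, y). tens R D D x y)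
      (\<lambda>(x, y). \<epsilon> x \<odot>\<^bsub>D\<^esub> y) (\<Delta> x) = x"
    and "linear_extension R D2 D (carrier D \<times> carrier D) (\<lambda>(x, y). tens R D D x y)
      (\<lambda>(x, y). \<epsilon> y \<odot>\<^bsub>D\<^esub> x) (\<Delta> x) = x"
proof -
  note \<Delta>x = linear_maps_closed[OF coproduct_linear x]
  have lin1: "(\<lambda>y. \<epsilon> x \<odot>\<^bsub>D\<^esub> y) \<in> linear_maps R D D" if "x \<in> carrier D" for x
    by (rule linear_maps_smult_fun[OF D_module linear_maps_id counit_closed[OF that]])
  have lin2: "(\<lambda>x. \<epsilon> x \<odot>\<^bsub>D\<^esub> y) \<in> linear_maps R D D" if "y \<in> carrier D" for y
    by (rule linear_mapsI) (use that in \<open>simp_all add: counit_add counit_smult D.smult_l_distr D.smult_assoc1\<close>)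
  have *: "linear_extension R D2 D (carrier D \<times> carrier D) (\<lambda>(x, y). tens R D D x y)
      (\<lambda>(x, y). \<phi> x y) (\<Delta> x) = x"
    if \<phi>: "bilinear R D D D \<phi>" and b: "\<And>ws p. ws \<in> L \<Longrightarrow> p \<in> set (splits_list ws) \<Longrightarrow> b p \<in> L \<and>
        \<phi> (bword (fst p)) (bword (snd p)) = (if Q p then \<one>\<^bsub>R\<^esub> else \<zero>\<^bsub>R\<^esub>) \<odot>\<^bsub>D\<^esub> bword (b p)"
      and Q: "\<And>ws. \<exists>q. filter Q (splits_list ws) = [q] \<and> b q = ws" for \<phi> b Q
  proof -
    obtain E where E: "E \<in> linear_maps R D2 D"
      and Ev: "\<And>x y. x \<in> carrier D \<Longrightarrow> y \<in> carrier D \<Longrightarrow> E (tens R D D x y) = \<phi> x y"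
      using tensor_lift[OF D_module D_module D_module \<phi>] by blast
    have "E (\<Delta> x) = x"
    proof (rule linear_maps_eq_on_spanned[OF D_module D_module linear_maps_compose[OF coproduct_linear E]
          linear_maps_id D_spanned _ x])
      fix x assume "x \<in> bword ` L"
      then obtain ws where ws: "ws \<in> L" "x = bword ws" by blast
      note LW = L_splits[OF ws(1)]
      obtain q where q: "filter Q (splits_list ws) = [q]" "b q = ws" using Q by blast
      have "E (pure bword p) = (if Q p then \<one>\<^bsub>R\<^esub> else \<zero>\<^bsub>R\<^esub>) \<odot>\<^bsub>D\<^esub> bword (b p)"
        if "p \<in> set (splits_list ws)" for p
        unfolding pure_def Ev[OF bword_closed[OF conjunct1[OF LW[OF that]]] bword_closed[OF conjunct2[OF LW[OF that]]]]
        using b[OF ws(1) that] by blast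
      from eval_sum[OF E LW conjunct1[OF b[OF ws(1)]] this q(1)] show "E (\<Delta> x) = x"
        unfolding ws(2) coproduct_bword[OF ws(1)] q(2) by blast
    qed
    moreover have "linear_extension R D2 D (carrier D \<times> carrier D) (\<lambda>(x, y). tens R D D x y)
        (\<lambda>(x, y). \<phi> x y) (\<Delta> x) = E (\<Delta> x)"
      by (rule linear_extension_eq[OF D2_module D_module tensor_spanned[OF D_module D_module] E _ \<Delta>x])
        (auto simp: Ev)
    ultimately show ?thesis by simp
  qed
  show "linear_extension R D2 D (carrier D \<times> carrier D) (\<lambda>(x, y). tens R D D x y)
      (\<lambda>(x, y). \<epsilon> x \<odot>\<^bsub>D\<^esub> y) (\<Delta> x) = x"
  proof (rule *[of "\<lambda>x y. \<epsilon> x \<odot>\<^bsub>D\<^esub> y" snd "\<lambda>p. concat (fst p) = []", OF bilinearI[OF lin2 lin1]])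
    show "\<exists>q. filter (\<lambda>p. concat (fst p) = []) (splits_list ws) = [q] \<and> snd q = ws" for ws :: "'a list list"
      using filter_splits_list_empty_selection[of ws] by force
    show "snd p \<in> L \<and> \<epsilon> (bword (fst p)) \<odot>\<^bsub>D\<^esub> bword (snd p) =
        (if concat (fst p) = [] then \<one>\<^bsub>R\<^esub> else \<zero>\<^bsub>R\<^esub>) \<odot>\<^bsub>D\<^esub> bword (snd p)"
      if "ws \<in> L" "p \<in> set (splits_list ws)" for ws p
      unfolding counit_bword[OF conjunct1[OF L_splits[OF that]]] using L_splits[OF that] by blast
  qed
  show "linear_extension R D2 D (carrier D \<times> carrier D) (\<lambda>(x, y). tens R D D x y)
      (\<lambda>(x, y). \<epsilon> y \<odot>\<^bsub>D\<^esub> x) (\<Delta> x) = x"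
  proof (rule *[of "\<lambda>x y. \<epsilon> y \<odot>\<^bsub>D\<^esub> x" fst "\<lambda>p. concat (snd p) = []", OF bilinearI[OF lin1 lin2]])
    show "\<exists>q. filter (\<lambda>p. concat (snd p) = []) (splits_list ws) = [q] \<and> fst q = ws" for ws :: "'a list list"
      using filter_splits_list_empty_gaps[of ws] by force
    show "fst p \<in> L \<and> \<epsilon> (bword (snd p)) \<odot>\<^bsub>D\<^esub> bword (fst p) =
        (if concat (snd p) = [] then \<one>\<^bsub>R\<^esub> else \<zero>\<^bsub>R\<^esub>) \<odot>\<^bsub>D\<^esub> bword (fst p)"
      if "ws \<in> L" "p \<in> set (splits_list ws)" for ws p
      unfolding counit_bword[OF conjunct2[OF L_splits[OF that]]] using L_splits[OF that] by blast
  qed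
qed

lemma coalgebra: "is_coalgebra R D \<Delta> \<epsilon>"
  unfolding is_coalgebra_def
proof (intro conjI ballI)
  show "tensor_assoc R D (tensor_map_full R D D D2 D \<Delta> (\<lambda>x. x) (\<Delta> c)) =
      tensor_map_full R D D D D2 (\<lambda>x. x) \<Delta> (\<Delta> c)" if "c \<in> carrier D" for c
    using coproduct_coassoc[OF that] unfolding apply_left_def apply_right_def .
qed (rule D_module coproduct_linear counit_linear counit_laws; assumption?)+

lemma bialgebra: "is_bialgebra R D \<Delta> \<epsilon>"
  unfolding is_bialgebra_def
proof (intro conjI D_algebra coalgebra)
  show "\<Delta> \<in> ring_hom D D2"
    by (rule ring_hom_memI)
      (simp_all add: coproduct_mult coproduct_one linear_maps_closed[OF coproduct_linear]
        linear_maps_add[OF coproduct_linear])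
  show "\<epsilon> \<in> ring_hom D R"
    by (rule ring_hom_memI) (simp_all add: counit_mult counit_one counit_add)
qed

lemma coaugmented: "is_coaugmented_coalgebra R D \<Delta> \<epsilon> \<one>\<^bsub>D\<^esub> C"
  unfolding is_coaugmented_coalgebra_def
proof (intro conjI ballI coalgebra D.one_closed counit_one C_submodule)
  show "\<Delta> \<one>\<^bsub>D\<^esub> = tens R D D \<one>\<^bsub>D\<^esub> \<one>\<^bsub>D\<^esub>"
    by (simp add: coproduct_one tensor_one[OF D_algebra D_algebra])
  show "\<epsilon> c = \<zero>\<^bsub>R\<^esub>" if "c \<in> C" for c by (rule counit_C[OF that])
  fix x assume x: "x \<in> carrier D"
  show "\<exists>!(c, a). c \<in> C \<and> a \<in> carrier R \<and> x = c \<oplus>\<^bsub>D\<^esub> a \<odot>\<^bsub>D\<^esub> \<one>\<^bsub>D\<^esub>"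
  proof (rule ex1I[of _ "(proj x, \<epsilon> x)"])
    show "case (proj x, \<epsilon> x) of (c, a) \<Rightarrow> c \<in> C \<and> a \<in> carrier R \<and> x = c \<oplus>\<^bsub>D\<^esub> a \<odot>\<^bsub>D\<^esub> \<one>\<^bsub>D\<^esub>"
      unfolding prod.case
      by (intro conjI proj_in_C counit_closed proj_decomposition x)
    fix p assume p: "case p of (c, a) \<Rightarrow> c \<in> C \<and> a \<in> carrier R \<and> x = c \<oplus>\<^bsub>D\<^esub> a \<odot>\<^bsub>D\<^esub> \<one>\<^bsub>D\<^esub>"
    obtain c a where ca: "p = (c, a)" "c \<in> C" "a \<in> carrier R" "x = c \<oplus>\<^bsub>D\<^esub> a \<odot>\<^bsub>D\<^esub> \<one>\<^bsub>D\<^esub>"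
      using p by (cases p) auto
    have c: "c \<in> carrier D" using ca C_subset by blast
    have "\<epsilon> x = a"
      unfolding ca(4) using ca(2,3) c by (simp add: counit_add counit_smult counit_one counit_C)
    moreover have "proj x = c"
      unfolding proj_def \<open>\<epsilon> x = a\<close> unfolding ca(4)
      using ca(3) c by (simp add: a_minus_def D.a_assoc D.r_neg)
    ultimately show "p = (proj x, \<epsilon> x)" by (simp add: ca(1))
  qed
qed

lemma sub_linear:
  assumes f: "f \<in> linear_maps R D D2" and g: "\<And>c. c \<in> C \<Longrightarrow> g c = reduced f c"
  shows "g \<in> linear_maps R (D\<lparr>carrier := C\<rparr>) (tensor_sub R D D C C)"
proof -
  have C: "c \<in> carrier D" if "c \<in> C" for c using that C_subset by blast
  note F = reduced_linear[OF f]
  have "reduced f \<in> linear_maps R (D\<lparr>carrier := C\<rparr>) (tensor_sub R D D C C)"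
  proof (rule linear_mapsI)
    fix c assume "c \<in> carrier (D\<lparr>carrier := C\<rparr>)"
    then have c: "c \<in> carrier D" using C by simp
    show "reduced f c \<in> carrier (tensor_sub R D D C C)"
      unfolding reduced_def by (rule proj2_in_sub[OF linear_maps_closed[OF f c]])
    show "reduced f (c \<oplus>\<^bsub>D\<lparr>carrier := C\<rparr>\<^esub> d) = reduced f c \<oplus>\<^bsub>tensor_sub R D D C C\<^esub> reduced f d"
      if "d \<in> carrier (D\<lparr>carrier := C\<rparr>)" for d
    proof -
      have "d \<in> carrier D" using C that by simp
      from linear_maps_add[OF F c this] show ?thesis by (simp add: tensor_sub_def)
    qed
    show "reduced f (a \<odot>\<^bsub>D\<lparr>carrier := C\<rparr>\<^esub> c) = a \<odot>\<^bsub>tensor_sub R D D C C\<^esub> reduced f c"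
      if "a \<in> carrier R" for a
      using linear_maps_smult[OF F that c] by (simp add: tensor_sub_def)
  qed
  then show ?thesis
    by (rule iffD2[OF linear_maps_cong[OF submodule.submodule_is_module[OF C_submodule D_module]], rotated])
      (simp add: g)
qed

text \<open>
  On \<open>C\<close> the half coproducts are the reduced maps, which are linear on all of \<open>D\<close>; the maps on \<open>C \<otimes> C\<close>
  in the unshuffle relations may thus be replaced by maps on \<open>D \<otimes> D\<close>.
\<close>
lemma unshuffle_coalgebra:
  "is_unshuffle_coalgebra R D \<Delta> \<epsilon> \<one>\<^bsub>D\<^esub> C (coproduct_prec R A) (coproduct_succ R A)"
proof -
  note modules = D_module D_module D2_module D_module
  note modules' = D_module D_module D_module D2_module
  have left: "tensor_assoc R D (tensor_map R D D C C D2 D g (\<lambda>x. x) (reduced k c)) = apply_left f (reduced k c)"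
    if "f \<in> linear_maps R D D2" "\<And>c. c \<in> C \<Longrightarrow> g c = f c" "k \<in> linear_maps R D D2" "c \<in> C" for f g k c
    unfolding apply_left_def
    by (rule arg_cong[where f = "tensor_assoc R D"],
        rule tensor_map_restrict[OF modules that(1) linear_maps_id C_subset C_subset that(2)])
      (use that C_subset linear_maps_closed[OF that(3)] in \<open>auto simp: reduced_def intro!: proj2_in_sub\<close>)
  have right: "tensor_map R D D C C D D2 (\<lambda>x. x) g (reduced k c) = apply_right f (reduced k c)"
    if "f \<in> linear_maps R D D2" "\<And>c. c \<in> C \<Longrightarrow> g c = f c" "k \<in> linear_maps R D D2" "c \<in> C" for f g k c
    unfolding apply_right_def
    by (rule tensor_map_restrict[OF modules' linear_maps_id that(1) C_subset C_subset refl that(2)])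
      (use that C_subset linear_maps_closed[OF that(3)] in \<open>auto simp: reduced_def intro!: proj2_in_sub\<close>)
  note H = half_ext_linear
  note P = red_prec_linear and Q = red_succ_linear and R = red_coproduct_linear
  show ?thesis
    unfolding is_unshuffle_coalgebra_def Let_def
  proof (intro conjI ballI coaugmented)
    show "coproduct_prec R A \<in> linear_maps R (D\<lparr>carrier := C\<rparr>) (tensor_sub R D D C C)"
      by (rule sub_linear[OF H prec_eq(1)])
    show "coproduct_succ R A \<in> linear_maps R (D\<lparr>carrier := C\<rparr>) (tensor_sub R D D C C)"
      by (rule sub_linear[OF H succ_eq(1)])
    fix c assume c: "c \<in> C"
    have cD: "c \<in> carrier D" using c C_subset by blast
    have cl: "red_prec c \<in> carrier D2" "red_succ c \<in> carrier D2" "tens R D D c \<one>\<^bsub>D\<^esub> \<in> carrier D2"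
      "tens R D D \<one>\<^bsub>D\<^esub> c \<in> carrier D2"
      using linear_maps_closed[OF P cD] linear_maps_closed[OF Q cD] cD by (auto intro!: tens_D_closed)
    show "\<Delta> c = coproduct_prec R A c \<oplus>\<^bsub>D2\<^esub> coproduct_succ R A c \<oplus>\<^bsub>D2\<^esub> tens R D D c \<one>\<^bsub>D\<^esub> \<oplus>\<^bsub>D2\<^esub>
        tens R D D \<one>\<^bsub>D\<^esub> c"
      unfolding coproduct_eq_halves[OF c] prec_eq(1)[OF c] succ_eq(1)[OF c]
        half_ext_id_reduced[OF c] half_ext_Not_reduced[OF c]
      using cl by (simp add: D2.add.m_ac)
    show "tensor_assoc R D (tensor_map R D D C C D2 D (coproduct_prec R A) (\<lambda>x. x) (coproduct_prec R A c)) =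
        tensor_map R D D C C D D2 (\<lambda>x. x) (\<lambda>c. coproduct_prec R A c \<oplus>\<^bsub>D2\<^esub> coproduct_succ R A c)
          (coproduct_prec R A c)"
      unfolding prec_eq(1)[OF c]
      by (rule trans[OF left[OF P prec_eq(1) H c]
            trans[OF reduced_unshuffle(1)[OF c] right[OF R reduced_coproduct_eq H c, symmetric]]])
    show "tensor_assoc R D (tensor_map R D D C C D2 D (coproduct_succ R A) (\<lambda>x. x) (coproduct_prec R A c)) =
        tensor_map R D D C C D D2 (\<lambda>x. x) (coproduct_prec R A) (coproduct_succ R A c)"
      unfolding prec_eq(1)[OF c] succ_eq(1)[OF c]
      by (rule trans[OF left[OF Q succ_eq(1) H c]
            trans[OF reduced_unshuffle(2)[OF c] right[OF P prec_eq(1) H c, symmetric]]])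
    show "tensor_assoc R D (tensor_map R D D C C D2 D
          (\<lambda>c. coproduct_prec R A c \<oplus>\<^bsub>D2\<^esub> coproduct_succ R A c) (\<lambda>x. x) (coproduct_succ R A c)) =
        tensor_map R D D C C D D2 (\<lambda>x. x) (coproduct_succ R A) (coproduct_succ R A c)"
      unfolding succ_eq(1)[OF c]
      by (rule trans[OF left[OF R reduced_coproduct_eq H c]
            trans[OF reduced_unshuffle(3)[OF c] right[OF Q succ_eq(1) H c, symmetric]]])
  qed
qed

lemma unshuffle_bialgebra:
  "is_unshuffle_bialgebra R D \<Delta> \<epsilon> C (coproduct_prec R A) (coproduct_succ R A)"
  unfolding is_unshuffle_bialgebra_def Let_def
proof (intro conjI ballI bialgebra unshuffle_coalgebra)
  fix a b assume a: "a \<in> C" and b: "b \<in> C"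
  have bD: "b \<in> carrier D" using b C_subset by blast
  show "coproduct_prec R A (a \<otimes>\<^bsub>D\<^esub> b) \<oplus>\<^bsub>D2\<^esub> tens R D D (a \<otimes>\<^bsub>D\<^esub> b) \<one>\<^bsub>D\<^esub> =
      (coproduct_prec R A a \<oplus>\<^bsub>D2\<^esub> tens R D D a \<one>\<^bsub>D\<^esub>) \<otimes>\<^bsub>D2\<^esub> \<Delta> b"
    unfolding prec_eq(2)[OF a] prec_eq(2)[OF C_mult[OF a b]] by (rule half_ext_mult[OF a bD])
  show "coproduct_succ R A (a \<otimes>\<^bsub>D\<^esub> b) \<oplus>\<^bsub>D2\<^esub> tens R D D \<one>\<^bsub>D\<^esub> (a \<otimes>\<^bsub>D\<^esub> b) =
      (coproduct_succ R A a \<oplus>\<^bsub>D2\<^esub> tens R D D \<one>\<^bsub>D\<^esub> a) \<otimes>\<^bsub>D2\<^esub> \<Delta> b"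
    unfolding succ_eq(2)[OF a] succ_eq(2)[OF C_mult[OF a b]] by (rule half_ext_mult[OF a bD])
qed

end

theorem theorem5:
  fixes R :: "('k, 'r) ring_scheme" and A :: "('k, 'a, 'm) module_scheme"
  assumes "field R"
    and char_zero: "\<And>n::nat. n > 0 \<Longrightarrow> [n] \<cdot>\<^bsub>R\<^esub> \<one>\<^bsub>R\<^esub> \<noteq> \<zero>\<^bsub>R\<^esub>"
    and "assoc_algebra R A"
  shows "is_unshuffle_bialgebra R (TTbar R A) (coproduct R A) (augmentation R (T R A))
           (carrier (TT R A)) (coproduct_prec R A) (coproduct_succ R A)"
  by (rule double_tensor_algebra.unshuffle_bialgebra[OF double_tensor_algebra.intro[OF
        assoc_algebra.axioms(1)[OF assms(3)]]])

end
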